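(* Let $\mathcal{G}$ be a set. The unital $*$-algebra $\mathcal{F}(\mathcal{G})$ becomes a monotone closed quantum semigroup when equipped with the comultiplication $$\Delta:\mathcal{F}(\mathcal{G})\to\mathcal{F}(\mathcal{G})\,\overline{\otimes}\,\mathcal{F}(\mathcal{G}),\qquad \Delta[x_m,e_m]:=[\Delta(x_m),\Delta(e_m)],$$ and the counit $$\epsilon:\mathcal{F}(\mathcal{G})\to\mathbb{C},\qquad \epsilon([x_m,e_m]):=[\epsilon(x_m),\epsilon(e_m)],$$ where on the right-hand sides $\Delta$ and $\epsilon$ are the comultiplication and counit on $\mathcal{F}_0(\mathcal{G})$.
   Context: All algebras are over $\mathbb{C}$. Put $\mathcal{G}^*=\{X^*:X\in\mathcal{G}\}$ inside the unital free $*$-algebra generated by $\mathcal{G}$. The algebra $\mathcal{F}_0(\mathcal{G})$ is the unital $*$-algebra generated by elements $X'(k),X''(k)$ ($X\in\mathcal{G}$, $k\ge1$) and $p_k$ ($k\ge1$), subject only to the following relations: $X''(1)=0$; $p_kp_l=\delta_{k,l}p_k$, $p_k^*=p_k$; and, with $q_0=0$, $q_m=p_1+\cdots+p_m$, $q_\infty=1$, $(X^* )'(k):=(X'(k))^*$, $(X^* )''(k):=(X''(k))^*$, for all $X\in\mathcal{G}\cup\mathcal{G}^*$: $(1-q_m)X'(k)=0$ and $(1-q_m)X''(k)=0$ for $k<m$; $q_m(X'(k)-X''(k))=0$ for $k>m$. $\mathcal{F}^{(m)}(\mathcal{G})$ is the unital $*$-subalgebra generated by all $p_j$ and all $X'(k),X''(k)$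 with $1\le k\le m$; $\mathcal{F}^{(0)}(\mathcal{G})=\mathbb{C}[p_1,p_2,\ldots]$. $\mathcal{F}_0(\mathcal{G})$ is a unital $*$-bialgebra with the unital $*$-homomorphisms $\Delta:\mathcal{F}_0(\mathcal{G})\to\mathcal{F}_0(\mathcal{G})\otimes\mathcal{F}_0(\mathcal{G})$ and $\epsilon:\mathcal{F}_0(\mathcal{G})\to\mathbb{C}$ given by $\Delta(X'(k))=X'(k)\otimes q_k+q_k\otimes X'(k)$, $\Delta(X''(k))=X''(k)\otimes q_{k-1}+q_{k-1}\otimes X''(k)$, $\Delta(q_k)=q_k\otimes q_k$, $\epsilon(X'(k))=\epsilon(X''(k))=0$, $\epsilon(q_k)=1$ ($k\ge1$). Monotone closure. Let $\mathcal{C}_0=\bigcup_m\mathcal{C}^{(m)}$ be a union of increasing unital $*$-algebras and let $\mathcal{P}=\{c_m:0\le m\le\infty\}\subset\mathcal{C}^{(0)}$ be an increasing chain of projections with $c_0=0$, $c_\infty=1$. A monotone strongly dense domain (MSDD) is an increasing sequence $(e_m)_{m\ge1}$ in $\mathcal{P}$ with supremum $1$ in $\mathcal{P}$. An operator with monotone closure (OWMC) is a sequence $(x_m,e_m)_{m\ge1}$ with $x_m\in\mathcal{C}^{(m)}$, $(e_m)$ an MSDD, and $x_ne_m=x_me_m$, $x_n^*e_m=x_m^*e_m$ for $n>m$. Two OWMC $(x_m,e_m)$, $(y_m,f_m)$ are equivalent if for some MSDD $(g_m)$, $x_mg_m=y_mg_m$ and $x_m^*g_m=y_m^*g_m$ for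 all $m$. The classes $[x_m,e_m]$ are called monotone closed operators (MCO). For $x\in\mathcal{C}_0$, $e\in\mathcal{P}$, $x^{-1}(e)$ is the largest $g\in\mathcal{P}$ with $exg=xg$. The MCO form a unital $*$-algebra (the monotone closure $\overline{\mathcal{C}_0}$) under $[x_m,e_m]+[y_m,f_m]=[x_m+y_m,e_mf_m]$, $\lambda[x_m,e_m]=[\lambda x_m,e_m]$, $[x_m,e_m]^*=[x_m^*,e_m]$, $[x_m,e_m][y_m,f_m]=[x_my_m,k_m]$, $k_m=f_my_m^{-1}(e_m)e_m(x_m^* )^{-1}(f_m)$. $\mathcal{F}(\mathcal{G})$ is the monotone closure of $\mathcal{F}_0(\mathcal{G})$ with $\mathcal{C}^{(m)}=\mathcal{F}^{(m)}(\mathcal{G})$, $c_m=q_m$. The monotone tensor products are $\mathcal{F}(\mathcal{G})^{\overline{\otimes}n}=\overline{\mathcal{F}_0(\mathcal{G})^{\otimes n}}$, the closure being with respect to $\mathcal{C}^{(m)}=\mathcal{F}^{(m)}(\mathcal{G})^{\otimes n}$ and $c_m=q_m^{\otimes n}$. For $\mathbb{C}$ the chain is $\{0,1\}=\epsilon(\mathcal{P})$, every MCO is an eventually constant sequence of scalars, and the monotone closure of $\mathbb{C}$ is identified with $\mathbb{C}$ via the eventual value. Monotone tensor products of maps $\tau,\sigma\in\{\Delta,\epsilon,\mathrm{id}\}$ are defined by $$(\tau\,\overline{\otimes}\,\sigma)\Big[\sum_kw_m^{(k)}\otimes u_m^{(k)},\,e_m\otimes f_m\Big]=\Big[\sum_k\tau(w_m^{(k)})\otimes\sigma(u_m^{(k)}),\,\tau(e_m)\otimes\sigma(f_m)\Big].$$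 A monotone closed quantum semigroup is a unital $*$-bialgebra with respect to the monotone tensor product: $\Delta$ and $\epsilon$ are (well-defined) unital $*$-homomorphisms satisfying $(\Delta\,\overline{\otimes}\,\mathrm{id})\circ\Delta=(\mathrm{id}\,\overline{\otimes}\,\Delta)\circ\Delta$ and $(\epsilon\,\overline{\otimes}\,\mathrm{id})\circ\Delta=\mathrm{id}=(\mathrm{id}\,\overline{\otimes}\,\epsilon)\circ\Delta$. *)

theory Defs
  imports
    Complex_Main
    "HOL-Algebra.QuotRing"
    "HOL-Algebra.Subrings"
    "HOL-Library.Poly_Mapping"
    "HOL-Library.Extended_Nat"
begin

section \<open>Unital *-algebras over the complex numbers\<close>

record 'a star_algebra = "(complex, 'a) module" +
  star :: "'a \<Rightarrow> 'a"

definition complex_algebra :: "complex star_algebra" where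
  "complex_algebra =
     \<lparr>carrier = UNIV, mult = (*), one = 1, zero = 0, add = (+), smult = (*), star = cnj\<rparr>"

locale unital_star_algebra = module complex_algebra A + ring A
  for A :: "('a, 'm) star_algebra_scheme" (structure) +
  assumes smult_mult_left:
      "\<lbrakk>x \<in> carrier A; y \<in> carrier A\<rbrakk> \<Longrightarrow> (c \<odot> x) \<otimes> y = c \<odot> (x \<otimes> y)"
    and smult_mult_right:
      "\<lbrakk>x \<in> carrier A; y \<in> carrier A\<rbrakk> \<Longrightarrow> x \<otimes> (c \<odot> y) = c \<odot> (x \<otimes> y)"
    and star_closed: "x \<in> carrier A \<Longrightarrow> star A x \<in> carrier A"
    and star_star: "x \<in> carrier A \<Longrightarrow> star A (star A x) = x"
    and star_add:
      "\<lbrakk>x \<in> carrier A; y \<in> carrier A\<rbrakk> \<Longrightarrow> star A (x \<oplus> y) = star A x \<oplus> star A y"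
    and star_smult: "x \<in> carrier A \<Longrightarrow> star A (c \<odot> x) = cnj c \<odot> star A x"
    and star_mult:
      "\<lbrakk>x \<in> carrier A; y \<in> carrier A\<rbrakk> \<Longrightarrow> star A (x \<otimes> y) = star A y \<otimes> star A x"

definition star_hom ::
  "('a, 'm) star_algebra_scheme \<Rightarrow> ('b, 'n) star_algebra_scheme \<Rightarrow> ('a \<Rightarrow> 'b) set" where
  "star_hom A B = {f \<in> ring_hom A B. \<forall>x\<in>carrier A.
     (\<forall>c. f (c \<odot>\<^bsub>A\<^esub> x) = c \<odot>\<^bsub>B\<^esub> f x) \<and> f (star A x) = star B (f x)}"

definition star_subalgebra :: "('a, 'm) star_algebra_scheme \<Rightarrow> 'a set \<Rightarrow> bool" where
  "star_subalgebra A S \<longleftrightarrow> subring S A \<and> (\<forall>x\<in>S. (\<forall>c. c \<odot>\<^bsub>A\<^esub> x \<in> S) \<and> star A x \<in> S)"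

definition star_generated :: "('a, 'm) star_algebra_scheme \<Rightarrow> 'a set \<Rightarrow> 'a set" where
  "star_generated A X = \<Inter>{S. star_subalgebra A S \<and> X \<subseteq> S}"

definition lin_span :: "('a, 'm) star_algebra_scheme \<Rightarrow> 'a set \<Rightarrow> 'a set" where
  "lin_span A X = \<Inter>{V. submodule V complex_algebra A \<and> X \<subseteq> V}"

text \<open>
  The *-algebra of a monoid \<open>M\<close> with involution \<open>s\<close>: formal complex linear combinations of
  elements of \<open>M\<close> with convolution product.
\<close>

definition monoid_algebra ::
  "('w, 'm) monoid_scheme \<Rightarrow> ('w \<Rightarrow> 'w) \<Rightarrow> ('w \<Rightarrow>\<^sub>0 complex) star_algebra" where
  "monoid_algebra M s =
     \<lparr>carrier = {f. Poly_Mapping.keys f \<subseteq> carrier M},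
      mult = (\<lambda>f g. \<Sum>u\<in>Poly_Mapping.keys f. \<Sum>v\<in>Poly_Mapping.keys g.
        Poly_Mapping.single (u \<otimes>\<^bsub>M\<^esub> v) (Poly_Mapping.lookup f u * Poly_Mapping.lookup g v)),
      one = Poly_Mapping.single \<one>\<^bsub>M\<^esub> 1,
      zero = 0,
      add = (+),
      smult = (\<lambda>c. Poly_Mapping.map ((*) c)),
      star = (\<lambda>f. \<Sum>u\<in>Poly_Mapping.keys f.
        Poly_Mapping.single (s u) (cnj (Poly_Mapping.lookup f u)))\<rparr>"

definition quotient_algebra ::
  "('a, 'm) star_algebra_scheme \<Rightarrow> 'a set \<Rightarrow> 'a set star_algebra" where
  "quotient_algebra A I =
     \<lparr>carrier = carrier (A Quot I), mult = mult (A Quot I), one = one (A Quot I),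
      zero = zero (A Quot I), add = add (A Quot I),
      smult = (\<lambda>c U. I <+>\<^bsub>A\<^esub> ((\<lambda>x. c \<odot>\<^bsub>A\<^esub> x) ` U)),
      star = (\<lambda>U. star A ` U)\<rparr>"

section \<open>Algebraic tensor products\<close>

text \<open>
  \<open>A \<otimes> B\<close> is the vector space with basis \<open>carrier A \<times> carrier B\<close> modulo the linear span of the
  bilinearity relations.  With the product and involution of pairs the vector space is the
  monoid *-algebra of \<open>A \<times>\<times> B\<close>, in which that span is a two-sided *-ideal.
\<close>

definition tensor_pre ::
  "('a, 'm) star_algebra_scheme \<Rightarrow> ('b, 'n) star_algebra_scheme \<Rightarrow> ('a \<times> 'b \<Rightarrow>\<^sub>0 complex) star_algebra"
  where "tensor_pre A B = monoid_algebra (A \<times>\<times> B) (map_prod (star A) (star B))"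

definition tensor_relations ::
  "('a, 'm) star_algebra_scheme \<Rightarrow> ('b, 'n) star_algebra_scheme \<Rightarrow> ('a \<times> 'b \<Rightarrow>\<^sub>0 complex) set" where
  "tensor_relations A B =
     (let d = (\<lambda>a b. Poly_Mapping.single (a, b) (1::complex)) in
      {d (a \<oplus>\<^bsub>A\<^esub> a') b - d a b - d a' b | a a' b.
         a \<in> carrier A \<and> a' \<in> carrier A \<and> b \<in> carrier B} \<union>
      {d a (b \<oplus>\<^bsub>B\<^esub> b') - d a b - d a b' | a b b'.
         a \<in> carrier A \<and> b \<in> carrier B \<and> b' \<in> carrier B} \<union>
      {d (c \<odot>\<^bsub>A\<^esub> a) b - Poly_Mapping.single (a, b) c | c a b. a \<in> carrier A \<and> b \<in> carrier B} \<union>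
      {d a (c \<odot>\<^bsub>B\<^esub> b) - Poly_Mapping.single (a, b) c | c a b. a \<in> carrier A \<and> b \<in> carrier B})"

definition tensor_ideal ::
  "('a, 'm) star_algebra_scheme \<Rightarrow> ('b, 'n) star_algebra_scheme \<Rightarrow> ('a \<times> 'b \<Rightarrow>\<^sub>0 complex) set" where
  "tensor_ideal A B = lin_span (tensor_pre A B) (tensor_relations A B)"

definition tensor_algebra ::
  "('a, 'm) star_algebra_scheme \<Rightarrow> ('b, 'n) star_algebra_scheme \<Rightarrow>
     ('a \<times> 'b \<Rightarrow>\<^sub>0 complex) set star_algebra" where
  "tensor_algebra A B = quotient_algebra (tensor_pre A B) (tensor_ideal A B)"

definition tens ::
  "('a, 'm) star_algebra_scheme \<Rightarrow> ('b, 'n) star_algebra_scheme \<Rightarrow> 'a \<Rightarrow> 'b \<Rightarrow>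
     ('a \<times> 'b \<Rightarrow>\<^sub>0 complex) set" where
  "tens A B a b = tensor_ideal A B +>\<^bsub>tensor_pre A B\<^esub> Poly_Mapping.single (a, b) 1"

text \<open>
  The linear map on a tensor product with values in \<open>E\<close> induced by a bilinear map \<open>f\<close>.  The
  elements of the tensor product are cosets; \<^const>\<open>the_elem\<close> picks the value common to all
  representatives.
\<close>

definition tensor_lift ::
  "('c, 'm) star_algebra_scheme \<Rightarrow> ('a \<Rightarrow> 'b \<Rightarrow> 'c) \<Rightarrow> ('a \<times> 'b \<Rightarrow>\<^sub>0 complex) set \<Rightarrow> 'c" where
  "tensor_lift E f T = the_elem
     ((\<lambda>t. \<Oplus>\<^bsub>E\<^esub>p\<in>Poly_Mapping.keys t. Poly_Mapping.lookup t p \<odot>\<^bsub>E\<^esub> f (fst p) (snd p)) ` T)"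

definition tensor_map ::
  "('c, 'm) star_algebra_scheme \<Rightarrow> ('d, 'n) star_algebra_scheme \<Rightarrow> ('a \<Rightarrow> 'c) \<Rightarrow> ('b \<Rightarrow> 'd) \<Rightarrow>
     ('a \<times> 'b \<Rightarrow>\<^sub>0 complex) set \<Rightarrow> ('c \<times> 'd \<Rightarrow>\<^sub>0 complex) set" where
  "tensor_map C D \<tau> \<sigma> = tensor_lift (tensor_algebra C D) (\<lambda>a b. tens C D (\<tau> a) (\<sigma> b))"

section \<open>Monotone closure\<close>

text \<open>
  The algebra \<open>\<C>\<^sub>0\<close> together with the filtration \<open>level m = \<C>\<^sup>m\<close> and the chain of projections
  \<open>chain m = c\<^sub>m\<close>, \<open>0 \<le> m \<le> \<infinity>\<close>.
\<close>

record 'a mono_algebra = "'a star_algebra" +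
  level :: "nat \<Rightarrow> 'a set"
  chain :: "enat \<Rightarrow> 'a"

definition proj_le :: "('a, 'm) mono_algebra_scheme \<Rightarrow> 'a \<Rightarrow> 'a \<Rightarrow> bool" where
  "proj_le D e f \<longleftrightarrow> e \<otimes>\<^bsub>D\<^esub> f = e"

text \<open>
  Sequences \<open>(x\<^sub>m)\<close> with \<open>m \<ge> 1\<close> are functions on \<^typ>\<open>nat\<close> whose value at \<open>0\<close> is unconstrained
  and irrelevant: operators with monotone closure differing only there are equivalent.
\<close>

definition msdd :: "('a, 'm) mono_algebra_scheme \<Rightarrow> (nat \<Rightarrow> 'a) \<Rightarrow> bool" where
  "msdd D e \<longleftrightarrow>
     (\<forall>m\<ge>1. e m \<in> range (chain D)) \<and>
     (\<forall>m n. 1 \<le> m \<and> m \<le> n \<longrightarrow> proj_le D (e m) (e n)) \<and>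
     (\<forall>m\<ge>1. proj_le D (e m) \<one>\<^bsub>D\<^esub>) \<and>
     (\<forall>h\<in>range (chain D). (\<forall>m\<ge>1. proj_le D (e m) h) \<longrightarrow> proj_le D \<one>\<^bsub>D\<^esub> h)"

definition owmc :: "('a, 'm) mono_algebra_scheme \<Rightarrow> ((nat \<Rightarrow> 'a) \<times> (nat \<Rightarrow> 'a)) set" where
  "owmc D = {(x, e). (\<forall>m\<ge>1. x m \<in> level D m) \<and> msdd D e \<and>
     (\<forall>m n. 1 \<le> m \<and> m < n \<longrightarrow>
        x n \<otimes>\<^bsub>D\<^esub> e m = x m \<otimes>\<^bsub>D\<^esub> e m \<and>
        star D (x n) \<otimes>\<^bsub>D\<^esub> e m = star D (x m) \<otimes>\<^bsub>D\<^esub> e m)}"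

definition owmc_equiv ::
  "('a, 'm) mono_algebra_scheme \<Rightarrow> (((nat \<Rightarrow> 'a) \<times> (nat \<Rightarrow> 'a)) \<times> ((nat \<Rightarrow> 'a) \<times> (nat \<Rightarrow> 'a))) set"
  where
  "owmc_equiv D = {((x, e), (y, f)). (x, e) \<in> owmc D \<and> (y, f) \<in> owmc D \<and>
     (\<exists>g. msdd D g \<and> (\<forall>m\<ge>1.
        x m \<otimes>\<^bsub>D\<^esub> g m = y m \<otimes>\<^bsub>D\<^esub> g m \<and>
        star D (x m) \<otimes>\<^bsub>D\<^esub> g m = star D (y m) \<otimes>\<^bsub>D\<^esub> g m))}"

type_synonym 'a mco = "((nat \<Rightarrow> 'a) \<times> (nat \<Rightarrow> 'a)) set"

definition mco_class ::
  "('a, 'm) mono_algebra_scheme \<Rightarrow> (nat \<Rightarrow> 'a) \<Rightarrow> (nat \<Rightarrow> 'a) \<Rightarrow> 'a mco" where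
  "mco_class D x e = owmc_equiv D `` {(x, e)}"

definition proj_preimage :: "('a, 'm) mono_algebra_scheme \<Rightarrow> 'a \<Rightarrow> 'a \<Rightarrow> 'a" where
  "proj_preimage D x e =
     (let ok = (\<lambda>g. g \<in> range (chain D) \<and> e \<otimes>\<^bsub>D\<^esub> x \<otimes>\<^bsub>D\<^esub> g = x \<otimes>\<^bsub>D\<^esub> g)
      in THE g. ok g \<and> (\<forall>h. ok h \<longrightarrow> proj_le D h g))"

definition mult_domain ::
  "('a, 'm) mono_algebra_scheme \<Rightarrow> (nat \<Rightarrow> 'a) \<times> (nat \<Rightarrow> 'a) \<Rightarrow> (nat \<Rightarrow> 'a) \<times> (nat \<Rightarrow> 'a) \<Rightarrow> nat \<Rightarrow> 'a"
  where
  "mult_domain D = (\<lambda>(x, e) (y, f) m.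
     f m \<otimes>\<^bsub>D\<^esub> proj_preimage D (y m) (e m) \<otimes>\<^bsub>D\<^esub> e m \<otimes>\<^bsub>D\<^esub> proj_preimage D (star D (x m)) (f m))"

text \<open>
  An operation on classes is the union of the classes obtained from all choices of
  representatives, so it takes values in the carrier only if it does not depend on them.
\<close>

definition mclosure :: "('a, 'm) mono_algebra_scheme \<Rightarrow> 'a mco star_algebra" where
  "mclosure D =
     \<lparr>carrier = owmc D // owmc_equiv D,
      mult = (\<lambda>U V. \<Union>(x, e)\<in>U. \<Union>(y, f)\<in>V.
        mco_class D (\<lambda>m. x m \<otimes>\<^bsub>D\<^esub> y m) (mult_domain D (x, e) (y, f))),
      one = mco_class D (\<lambda>_. \<one>\<^bsub>D\<^esub>) (\<lambda>_. \<one>\<^bsub>D\<^esub>),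
      zero = mco_class D (\<lambda>_. \<zero>\<^bsub>D\<^esub>) (\<lambda>_. \<one>\<^bsub>D\<^esub>),
      add = (\<lambda>U V. \<Union>(x, e)\<in>U. \<Union>(y, f)\<in>V.
        mco_class D (\<lambda>m. x m \<oplus>\<^bsub>D\<^esub> y m) (\<lambda>m. e m \<otimes>\<^bsub>D\<^esub> f m)),
      smult = (\<lambda>c U. \<Union>(x, e)\<in>U. mco_class D (\<lambda>m. c \<odot>\<^bsub>D\<^esub> x m) e),
      star = (\<lambda>U. \<Union>(x, e)\<in>U. mco_class D (\<lambda>m. star D (x m)) e)\<rparr>"

text \<open>The map \<open>[x\<^sub>m, e\<^sub>m] \<mapsto> [\<phi> x\<^sub>m, \<phi> e\<^sub>m]\<close> into the monotone closure of \<open>E\<close>.\<close>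

definition mlift :: "('b, 'm) mono_algebra_scheme \<Rightarrow> ('a \<Rightarrow> 'b) \<Rightarrow> 'a mco \<Rightarrow> 'b mco" where
  "mlift E \<phi> U = (\<Union>(x, e)\<in>U. mco_class E (\<phi> \<circ> x) (\<phi> \<circ> e))"

definition mlift_well_defined ::
  "('a, 'm) mono_algebra_scheme \<Rightarrow> ('b, 'n) mono_algebra_scheme \<Rightarrow> ('a \<Rightarrow> 'b) \<Rightarrow> bool" where
  "mlift_well_defined D E \<phi> \<longleftrightarrow> (\<forall>(x, e)\<in>owmc D.
     (\<phi> \<circ> x, \<phi> \<circ> e) \<in> owmc E \<and>
     mlift E \<phi> (mco_class D x e) = mco_class E (\<phi> \<circ> x) (\<phi> \<circ> e))"

text \<open>
  In the tensor product the level \<open>m\<close> is (the image of) the tensor product of the levels \<open>m\<close>, and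
  the projections are \<open>c\<^sub>m \<otimes> c\<^sub>m\<close>.
\<close>

definition mtensor ::
  "('a, 'm) mono_algebra_scheme \<Rightarrow> ('b, 'n) mono_algebra_scheme \<Rightarrow>
     ('a \<times> 'b \<Rightarrow>\<^sub>0 complex) set mono_algebra" (infixr \<open>\<boxtimes>\<close> 70) where
  "D \<boxtimes> E = star_algebra.extend (tensor_algebra D E)
     (mono_algebra.fields
       (\<lambda>m. lin_span (tensor_algebra D E) {tens D E a b | a b. a \<in> level D m \<and> b \<in> level E m})
       (\<lambda>m. tens D E (chain D m) (chain E m)))"

definition complex_mono :: "complex mono_algebra" where
  "complex_mono = star_algebra.extend complex_algebra
     (mono_algebra.fields (\<lambda>m. UNIV) (\<lambda>m. if m = 0 then 0 else 1))"

definition eventual_value :: "complex mco \<Rightarrow> complex" where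
  "eventual_value U = (THE l. \<forall>(x, e)\<in>U. \<forall>\<^sub>F m in sequentially. x m = l)"

section \<open>Monotone closed quantum semigroups\<close>

text \<open>
  The identifications implicit in coassociativity and in the counit property are
  \<open>(a \<otimes> b) \<otimes> c \<mapsto> a \<otimes> (b \<otimes> c)\<close>, \<open>\<lambda> \<otimes> a \<mapsto> \<lambda>a\<close> and \<open>a \<otimes> \<lambda> \<mapsto> \<lambda>a\<close>.
\<close>

definition tensor_assoc ::
  "('a, 'm) mono_algebra_scheme \<Rightarrow>
     (('a \<times> 'a \<Rightarrow>\<^sub>0 complex) set \<times> 'a \<Rightarrow>\<^sub>0 complex) set \<Rightarrow>
     ('a \<times> ('a \<times> 'a \<Rightarrow>\<^sub>0 complex) set \<Rightarrow>\<^sub>0 complex) set" where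
  "tensor_assoc D =
     tensor_lift (D \<boxtimes> D \<boxtimes> D) (\<lambda>t c. tensor_lift (D \<boxtimes> D \<boxtimes> D) (\<lambda>a b. tens D (D \<boxtimes> D) a (tens D D b c)) t)"

definition tensor_unit_left ::
  "('a, 'm) mono_algebra_scheme \<Rightarrow> (complex \<times> 'a \<Rightarrow>\<^sub>0 complex) set \<Rightarrow> 'a" where
  "tensor_unit_left D = tensor_lift D (\<lambda>c a. c \<odot>\<^bsub>D\<^esub> a)"

definition tensor_unit_right ::
  "('a, 'm) mono_algebra_scheme \<Rightarrow> ('a \<times> complex \<Rightarrow>\<^sub>0 complex) set \<Rightarrow> 'a" where
  "tensor_unit_right D = tensor_lift D (\<lambda>a c. c \<odot>\<^bsub>D\<^esub> a)"

text \<open>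
  \<open>\<Delta>\<close> and \<open>\<epsilon>\<close> are the maps on the underlying algebra \<open>\<C>\<^sub>0\<close>; the comultiplication and the counit
  on the monotone closure are the maps they induce.
\<close>

definition mcomult ::
  "('a, 'm) mono_algebra_scheme \<Rightarrow> ('a \<Rightarrow> ('a \<times> 'a \<Rightarrow>\<^sub>0 complex) set) \<Rightarrow>
     'a mco \<Rightarrow> ('a \<times> 'a \<Rightarrow>\<^sub>0 complex) set mco" where
  "mcomult D \<Delta> = mlift (D \<boxtimes> D) \<Delta>"

definition mcounit :: "('a \<Rightarrow> complex) \<Rightarrow> 'a mco \<Rightarrow> complex" where
  "mcounit \<epsilon> U = eventual_value (mlift complex_mono \<epsilon> U)"

definition mtensor_map ::
  "('c, 'm) mono_algebra_scheme \<Rightarrow> ('d, 'n) mono_algebra_scheme \<Rightarrow> ('a \<Rightarrow> 'c) \<Rightarrow> ('b \<Rightarrow> 'd) \<Rightarrow>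
     ('a \<times> 'b \<Rightarrow>\<^sub>0 complex) set mco \<Rightarrow> ('c \<times> 'd \<Rightarrow>\<^sub>0 complex) set mco" where
  "mtensor_map C D \<tau> \<sigma> = mlift (C \<boxtimes> D) (tensor_map C D \<tau> \<sigma>)"

definition monotone_closed_quantum_semigroup ::
  "('a, 'm) mono_algebra_scheme \<Rightarrow> ('a \<Rightarrow> ('a \<times> 'a \<Rightarrow>\<^sub>0 complex) set) \<Rightarrow> ('a \<Rightarrow> complex) \<Rightarrow> bool"
  where
  "monotone_closed_quantum_semigroup D \<Delta> \<epsilon> \<longleftrightarrow>
     unital_star_algebra (mclosure D) \<and>
     unital_star_algebra (mclosure (D \<boxtimes> D)) \<and>
     mlift_well_defined D (D \<boxtimes> D) \<Delta> \<and>
     mlift_well_defined D complex_mono \<epsilon> \<and>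
     mcomult D \<Delta> \<in> star_hom (mclosure D) (mclosure (D \<boxtimes> D)) \<and>
     mcounit \<epsilon> \<in> star_hom (mclosure D) complex_algebra \<and>
     mlift_well_defined (D \<boxtimes> D) ((D \<boxtimes> D) \<boxtimes> D) (tensor_map (D \<boxtimes> D) D \<Delta> id) \<and>
     mlift_well_defined (D \<boxtimes> D) (D \<boxtimes> (D \<boxtimes> D)) (tensor_map D (D \<boxtimes> D) id \<Delta>) \<and>
     mlift_well_defined (D \<boxtimes> D) (complex_mono \<boxtimes> D) (tensor_map complex_mono D \<epsilon> id) \<and>
     mlift_well_defined (D \<boxtimes> D) (D \<boxtimes> complex_mono) (tensor_map D complex_mono id \<epsilon>) \<and>
     (\<forall>U\<in>carrier (mclosure D).
        mlift (D \<boxtimes> (D \<boxtimes> D)) (tensor_assoc D) (mtensor_map (D \<boxtimes> D) D \<Delta> id (mcomult D \<Delta> U)) =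
          mtensor_map D (D \<boxtimes> D) id \<Delta> (mcomult D \<Delta> U) \<and>
        mlift D (tensor_unit_left D) (mtensor_map complex_mono D \<epsilon> id (mcomult D \<Delta> U)) = U \<and>
        mlift D (tensor_unit_right D) (mtensor_map D complex_mono id \<epsilon> (mcomult D \<Delta> U)) = U)"

section \<open>The *-bialgebra generated by a set\<close>

text \<open>
  \<open>Xp X k\<close>, \<open>Xpp X k\<close> and \<open>Pj k\<close> stand for \<open>X'(k)\<close>, \<open>X''(k)\<close> and \<open>p\<^sub>k\<close>.  The letter \<open>(g, b)\<close> of the
  free *-algebra is \<open>g\<close> if \<open>b\<close> is false and \<open>g\<^sup>*\<close> if \<open>b\<close> is true; in particular \<open>(Xp X k, True)\<close>
  is \<open>(X\<^sup>*)'(k)\<close>.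
\<close>

datatype 'g fgen = Xp 'g nat | Xpp 'g nat | Pj nat

type_synonym 'g fword = "('g fgen \<times> bool) list"

definition fgens :: "'g set \<Rightarrow> 'g fgen set" where
  "fgens G = {Xp X k | X k. X \<in> G \<and> 1 \<le> k} \<union> {Xpp X k | X k. X \<in> G \<and> 1 \<le> k} \<union> {Pj k | k. 1 \<le> k}"

definition free_star_algebra :: "'g set \<Rightarrow> ('g fword \<Rightarrow>\<^sub>0 complex) star_algebra" where
  "free_star_algebra G = monoid_algebra
     \<lparr>carrier = lists (fgens G \<times> UNIV), mult = (@), one = []\<rparr>
     (\<lambda>w. rev (map (\<lambda>(g, b). (g, \<not> b)) w))"

definition letter :: "'g fgen \<Rightarrow> bool \<Rightarrow> ('g fword \<Rightarrow>\<^sub>0 complex)" where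
  "letter g b = Poly_Mapping.single [(g, b)] 1"

definition free_q :: "nat \<Rightarrow> ('g fword \<Rightarrow>\<^sub>0 complex)" where
  "free_q m = (\<Sum>j=1..m. letter (Pj j) False)"

text \<open>
  A relation \<open>r = 0\<close> is given by its left-hand side \<open>r\<close>.  The relations involving \<open>q\<^sub>\<infinity> = 1\<close> are
  trivial.
\<close>

definition F0_relations :: "'g set \<Rightarrow> ('g fword \<Rightarrow>\<^sub>0 complex) set" where
  "F0_relations G = (let A = free_star_algebra G in
     {letter (Xpp X 1) False | X. X \<in> G} \<union>
     {letter (Pj k) False \<otimes>\<^bsub>A\<^esub> letter (Pj l) False - (if k = l then letter (Pj k) False else 0) | k l.
        1 \<le> k \<and> 1 \<le> l} \<union>
     {star A (letter (Pj k) False) - letter (Pj k) False | k. 1 \<le> k} \<union>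
     {(\<one>\<^bsub>A\<^esub> - free_q m) \<otimes>\<^bsub>A\<^esub> letter (Xp X k) b | X k m b. X \<in> G \<and> 1 \<le> k \<and> k < m} \<union>
     {(\<one>\<^bsub>A\<^esub> - free_q m) \<otimes>\<^bsub>A\<^esub> letter (Xpp X k) b | X k m b. X \<in> G \<and> 1 \<le> k \<and> k < m} \<union>
     {free_q m \<otimes>\<^bsub>A\<^esub> (letter (Xp X k) b - letter (Xpp X k) b) | X k m b. X \<in> G \<and> 1 \<le> k \<and> m < k})"

definition F0_ideal :: "'g set \<Rightarrow> ('g fword \<Rightarrow>\<^sub>0 complex) set" where
  "F0_ideal G = (let A = free_star_algebra G in
     Idl\<^bsub>A\<^esub> (F0_relations G \<union> star A ` F0_relations G))"

definition F0_class :: "'g set \<Rightarrow> ('g fword \<Rightarrow>\<^sub>0 complex) \<Rightarrow> ('g fword \<Rightarrow>\<^sub>0 complex) set" where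
  "F0_class G f = F0_ideal G +>\<^bsub>free_star_algebra G\<^esub> f"

definition F0_gen :: "'g set \<Rightarrow> 'g fgen \<Rightarrow> ('g fword \<Rightarrow>\<^sub>0 complex) set" where
  "F0_gen G g = F0_class G (letter g False)"

definition F0_algebra :: "'g set \<Rightarrow> ('g fword \<Rightarrow>\<^sub>0 complex) set star_algebra" where
  "F0_algebra G = quotient_algebra (free_star_algebra G) (F0_ideal G)"

definition F0_q :: "'g set \<Rightarrow> enat \<Rightarrow> ('g fword \<Rightarrow>\<^sub>0 complex) set" where
  "F0_q G m = (case m of enat n \<Rightarrow> \<Oplus>\<^bsub>F0_algebra G\<^esub>j\<in>{1..n}. F0_gen G (Pj j) | \<infinity> \<Rightarrow> \<one>\<^bsub>F0_algebra G\<^esub>)"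

definition F0_level :: "'g set \<Rightarrow> nat \<Rightarrow> ('g fword \<Rightarrow>\<^sub>0 complex) set set" where
  "F0_level G m = star_generated (F0_algebra G)
     ({F0_gen G (Pj j) | j. 1 \<le> j} \<union>
      {F0_gen G (Xp X k) | X k. X \<in> G \<and> 1 \<le> k \<and> k \<le> m} \<union>
      {F0_gen G (Xpp X k) | X k. X \<in> G \<and> 1 \<le> k \<and> k \<le> m})"

definition F0 :: "'g set \<Rightarrow> ('g fword \<Rightarrow>\<^sub>0 complex) set mono_algebra" where
  "F0 G = star_algebra.extend (F0_algebra G) (mono_algebra.fields (F0_level G) (F0_q G))"

text \<open>
  The comultiplication and the counit are the unital *-homomorphisms with the stated values; as
  \<open>p\<^sub>k = q\<^sub>k - q\<^bsub>k-1\<^esub>\<close>, these determine them on \<open>carrier (F0 G)\<close>, and \<^const>\<open>extensional\<close> fixes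
  the irrelevant values elsewhere.
\<close>

definition F0_comult ::
  "'g set \<Rightarrow> ('g fword \<Rightarrow>\<^sub>0 complex) set \<Rightarrow>
     (('g fword \<Rightarrow>\<^sub>0 complex) set \<times> ('g fword \<Rightarrow>\<^sub>0 complex) set \<Rightarrow>\<^sub>0 complex) set" where
  "F0_comult G = (let A = F0 G; T = tens A A; q = (\<lambda>n. F0_q G (enat n)) in
     THE \<Delta>. \<Delta> \<in> extensional (carrier A) \<and> \<Delta> \<in> star_hom A (A \<boxtimes> A) \<and>
       (\<forall>k\<ge>1.
         (\<forall>X\<in>G. let x = F0_gen G (Xp X k); y = F0_gen G (Xpp X k) in
            \<Delta> x = T x (q k) \<oplus>\<^bsub>A \<boxtimes> A\<^esub> T (q k) x \<and>
            \<Delta> y = T y (q (k - 1)) \<oplus>\<^bsub>A \<boxtimes> A\<^esub> T (q (k - 1)) y) \<and>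
         \<Delta> (q k) = T (q k) (q k)))"

definition F0_counit :: "'g set \<Rightarrow> ('g fword \<Rightarrow>\<^sub>0 complex) set \<Rightarrow> complex" where
  "F0_counit G = (let A = F0 G in
     THE \<epsilon>. \<epsilon> \<in> extensional (carrier A) \<and> \<epsilon> \<in> star_hom A complex_algebra \<and>
       (\<forall>k\<ge>1.
         (\<forall>X\<in>G. \<epsilon> (F0_gen G (Xp X k)) = 0 \<and> \<epsilon> (F0_gen G (Xpp X k)) = 0) \<and>
         \<epsilon> (F0_q G (enat k)) = 1))"

end

theory Submission
  imports Defs
begin

text \<open>
  An MCO is determined by its finite truncations: \<open>[x\<^sub>m, e\<^sub>m] = [y\<^sub>m, f\<^sub>m]\<close> iff for every finite \<open>N\<close>
  eventually \<open>x\<^sub>m c\<^sub>N = y\<^sub>m c\<^sub>N\<close> and \<open>x\<^sub>m\<^sup>* c\<^sub>N = y\<^sub>m\<^sup>* c\<^sub>N\<close>.  Hence the domains \<open>e\<^sub>m\<close> are irrelevant for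
  equality, identities between MCOs may be checked termwise on representatives, and every
  *-homomorphism respecting levels and chains lifts to the monotone closures.  The product needs two
  further properties: for all \<open>x\<close> and \<open>N\<close> there is a finite \<open>K\<close> with \<open>c\<^sub>K x c\<^sub>N = x c\<^sub>N\<close> (the product
  domains form an MSDD), and \<open>x = 0\<close> if \<open>x c\<^sub>N = 0\<close> for all finite \<open>N\<close> (the projection \<open>x\<^sup>-\<^sup>1(e)\<close>
  exists).  Both hold in \<open>\<F>\<^sub>0\<close> because each of its elements is a scalar plus an element living under
  some \<open>q\<^sub>N\<close>; they pass to the tensor square by slicing with characters of \<open>\<F>\<^sub>0\<close> that separate
  \<open>q\<^sub>N\<close> from \<open>q\<^bsub>N+1\<^esub>\<close>.  The bialgebra identities are then inherited from \<open>\<F>\<^sub>0\<close>, where they hold on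
  generators.
\<close>

section \<open>Unital *-algebras\<close>

text \<open>Faithfulness of the chain is not visibly inherited by tensor products, whose elements
  are cosets. What survives is behaviour at infinity: if x (1 - c_N) is a scalar multiple of 1 - c_N
  on each leg, then an element killed by all 1 \<otimes> c_n has the form a \<otimes> (1 - c_N), and
  a functional nonzero on c_{N+1} - c_N recovers a. In F0 the scalar exists because q_m absorbs
  X'(k), X''(k) and their adjoints for m > k, so that generators vanish beyond q_m on both sides.
  The characters send one p_n to 1 and all other generators to 0; n = 1 is the counit. The supremum
  axiom for the chains c_m \<otimes> c_m is derived from distinctness of these projections. Slicing
  one leg with the counit, which is 1 on every q_m with m > 0, maps the tensor chain onto that of
  the other leg. Products of classes are formed only over F0, its square and the scalars; through
  the threefold products and those with the scalars only liftings pass, and there distinctness of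
  the chain is the point to prove.\<close>

lemma complex_algebra_simps [simp]:
  "carrier complex_algebra = UNIV" "mult complex_algebra = (*)" "one complex_algebra = 1"
  "zero complex_algebra = 0" "add complex_algebra = (+)" "smult complex_algebra = (*)"
  "star complex_algebra = cnj"
  by (simp_all add: complex_algebra_def)

lemma cring_complex_algebra: "cring complex_algebra"
proof (intro cringI abelian_groupI comm_monoidI)
  fix x assume "x \<in> carrier complex_algebra"
  show "\<exists>y\<in>carrier complex_algebra. y \<oplus>\<^bsub>complex_algebra\<^esub> x = \<zero>\<^bsub>complex_algebra\<^esub>"
    by (rule bexI[of _ "- x"]) simp_all
qed (simp_all add: algebra_simps)

text \<open>Additive inverses come from the scalars: (-1) x + x = 0 x = 0.\<close>

lemma unital_star_algebraI:
  fixes A (structure)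
  assumes "\<And>x y. \<lbrakk>x \<in> carrier A; y \<in> carrier A\<rbrakk> \<Longrightarrow> x \<oplus> y \<in> carrier A"
    and "\<zero> \<in> carrier A"
    and "\<And>x y z. \<lbrakk>x \<in> carrier A; y \<in> carrier A; z \<in> carrier A\<rbrakk> \<Longrightarrow> (x \<oplus> y) \<oplus> z = x \<oplus> (y \<oplus> z)"
    and "\<And>x y. \<lbrakk>x \<in> carrier A; y \<in> carrier A\<rbrakk> \<Longrightarrow> x \<oplus> y = y \<oplus> x"
    and "\<And>x. x \<in> carrier A \<Longrightarrow> \<zero> \<oplus> x = x"
    and "\<And>x y. \<lbrakk>x \<in> carrier A; y \<in> carrier A\<rbrakk> \<Longrightarrow> x \<otimes> y \<in> carrier A"
    and "\<one> \<in> carrier A"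
    and "\<And>x y z. \<lbrakk>x \<in> carrier A; y \<in> carrier A; z \<in> carrier A\<rbrakk> \<Longrightarrow> (x \<otimes> y) \<otimes> z = x \<otimes> (y \<otimes> z)"
    and "\<And>x. x \<in> carrier A \<Longrightarrow> \<one> \<otimes> x = x"
    and "\<And>x. x \<in> carrier A \<Longrightarrow> x \<otimes> \<one> = x"
    and "\<And>x y z. \<lbrakk>x \<in> carrier A; y \<in> carrier A; z \<in> carrier A\<rbrakk> \<Longrightarrow> (x \<oplus> y) \<otimes> z = x \<otimes> z \<oplus> y \<otimes> z"
    and "\<And>x y z. \<lbrakk>x \<in> carrier A; y \<in> carrier A; z \<in> carrier A\<rbrakk> \<Longrightarrow> z \<otimes> (x \<oplus> y) = z \<otimes> x \<oplus> z \<otimes> y"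
    and "\<And>c x. x \<in> carrier A \<Longrightarrow> c \<odot> x \<in> carrier A"
    and smult_l: "\<And>c d x. x \<in> carrier A \<Longrightarrow> (c + d) \<odot> x = c \<odot> x \<oplus> d \<odot> x"
    and "\<And>c x y. \<lbrakk>x \<in> carrier A; y \<in> carrier A\<rbrakk> \<Longrightarrow> c \<odot> (x \<oplus> y) = c \<odot> x \<oplus> c \<odot> y"
    and "\<And>c d x. x \<in> carrier A \<Longrightarrow> (c * d) \<odot> x = c \<odot> (d \<odot> x)"
    and smult_1: "\<And>x. x \<in> carrier A \<Longrightarrow> 1 \<odot> x = x"
    and smult_0: "\<And>x. x \<in> carrier A \<Longrightarrow> 0 \<odot> x = \<zero>"
    and "\<And>c x y. \<lbrakk>x \<in> carrier A; y \<in> carrier A\<rbrakk> \<Longrightarrow> (c \<odot> x) \<otimes> y = c \<odot> (x \<otimes> y)"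
    and "\<And>c x y. \<lbrakk>x \<in> carrier A; y \<in> carrier A\<rbrakk> \<Longrightarrow> x \<otimes> (c \<odot> y) = c \<odot> (x \<otimes> y)"
    and "\<And>x. x \<in> carrier A \<Longrightarrow> star A x \<in> carrier A"
    and "\<And>x. x \<in> carrier A \<Longrightarrow> star A (star A x) = x"
    and "\<And>x y. \<lbrakk>x \<in> carrier A; y \<in> carrier A\<rbrakk> \<Longrightarrow> star A (x \<oplus> y) = star A x \<oplus> star A y"
    and "\<And>c x. x \<in> carrier A \<Longrightarrow> star A (c \<odot> x) = cnj c \<odot> star A x"
    and "\<And>x y. \<lbrakk>x \<in> carrier A; y \<in> carrier A\<rbrakk> \<Longrightarrow> star A (x \<otimes> y) = star A y \<otimes> star A x"
  shows "unital_star_algebra A"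
proof -
  have grp: "abelian_group A"
  proof (rule abelian_groupI)
    fix x assume x: "x \<in> carrier A"
    have "(- 1) \<odot> x \<oplus> x = \<zero>"
      using smult_l[OF x, of "- 1" 1] x by (simp add: smult_0 smult_1)
    thus "\<exists>y\<in>carrier A. y \<oplus> x = \<zero>" using assms(13)[OF x] by blast
  qed (use assms in auto)
  moreover have "ring A"
    by (rule ringI[OF grp monoidI]) (use assms in auto)
  moreover have "module complex_algebra A"
    by (rule moduleI[OF cring_complex_algebra grp]) (use assms in auto)
  ultimately show ?thesis
    unfolding unital_star_algebra_def unital_star_algebra_axioms_def using assms by auto
qed

lemma unital_star_algebra_complex: "unital_star_algebra complex_algebra"
  by (rule unital_star_algebraI) (simp_all add: algebra_simps)

section \<open>Scalars, *-subalgebras and linear spans\<close>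

context unital_star_algebra
begin

lemma scale_closed [simp, intro]: "x \<in> carrier A \<Longrightarrow> c \<odot> x \<in> carrier A"
  using smult_closed[of c x] by simp

lemma scale_add_left: "x \<in> carrier A \<Longrightarrow> (c + d) \<odot> x = c \<odot> x \<oplus> d \<odot> x"
  using smult_l_distr[of c d x] by simp

lemma scale_add_right:
  "\<lbrakk>x \<in> carrier A; y \<in> carrier A\<rbrakk> \<Longrightarrow> c \<odot> (x \<oplus> y) = c \<odot> x \<oplus> c \<odot> y"
  using smult_r_distr[of c x y] by simp

lemma scale_scale: "x \<in> carrier A \<Longrightarrow> c \<odot> (d \<odot> x) = (c * d) \<odot> x"
  using smult_assoc1[of c d x] by simp

lemma scale_one [simp]: "x \<in> carrier A \<Longrightarrow> 1 \<odot> x = x"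
  using smult_one[of x] by simp

lemma scale_zero_left [simp]: "x \<in> carrier A \<Longrightarrow> 0 \<odot> x = \<zero>"
  using smult_l_null[of x] by simp

lemma scale_zero_right [simp]: "c \<odot> \<zero> = \<zero>"
  using smult_r_null[of c] by simp

lemma uminus_eq_scale: "x \<in> carrier A \<Longrightarrow> \<ominus> x = (- 1) \<odot> x"
  using scale_add_left[of x "- 1" 1] by (simp add: minus_equality)

lemma scale_eq_zero:
  assumes "c \<odot> x = \<zero>" "c \<noteq> 0" "x \<in> carrier A" shows "x = \<zero>"
proof -
  have "inverse c \<odot> (c \<odot> x) = x" using assms(2,3) by (simp add: scale_scale)
  thus ?thesis using assms(1) by simp
qed

lemma scale_finsum:
  assumes "finite I" "f \<in> I \<rightarrow> carrier A"
  shows "c \<odot> (\<Oplus>i\<in>I. f i) = (\<Oplus>i\<in>I. c \<odot> f i)"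
  using finsum_smult_ldistr[of I c f] assms by simp

lemmas [simp, intro] = star_closed
lemmas [simp] = star_star

lemma star_one [simp]: "star A \<one> = \<one>"
  using star_mult[of "star A \<one>" \<one>] by simp

lemma star_zero [simp]: "star A \<zero> = \<zero>"
  using star_smult[of \<zero> 0] by simp

lemma star_uminus: "x \<in> carrier A \<Longrightarrow> star A (\<ominus> x) = \<ominus> star A x"
  by (simp add: uminus_eq_scale star_smult)

lemma star_minus: "\<lbrakk>x \<in> carrier A; y \<in> carrier A\<rbrakk> \<Longrightarrow> star A (x \<ominus> y) = star A x \<ominus> star A y"
  by (simp add: minus_eq star_add star_uminus)

lemma star_subalgebraI:
  assumes "S \<subseteq> carrier A" "\<one> \<in> S" "\<And>x y. \<lbrakk>x \<in> S; y \<in> S\<rbrakk> \<Longrightarrow> x \<oplus> y \<in> S"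
    "\<And>x y. \<lbrakk>x \<in> S; y \<in> S\<rbrakk> \<Longrightarrow> x \<otimes> y \<in> S" "\<And>c x. x \<in> S \<Longrightarrow> c \<odot> x \<in> S" "\<And>x. x \<in> S \<Longrightarrow> star A x \<in> S"
  shows "star_subalgebra A S"
proof -
  have "\<ominus> x \<in> S" if "x \<in> S" for x
    using assms(1,5) that uminus_eq_scale[of x] by auto
  thus ?thesis
    unfolding star_subalgebra_def using assms by (auto intro: subringI)
qed

lemma star_subalgebraD:
  assumes "star_subalgebra A S"
  shows "S \<subseteq> carrier A" "\<one> \<in> S" "\<zero> \<in> S" "\<And>x y. \<lbrakk>x \<in> S; y \<in> S\<rbrakk> \<Longrightarrow> x \<oplus> y \<in> S"
    "\<And>x y. \<lbrakk>x \<in> S; y \<in> S\<rbrakk> \<Longrightarrow> x \<otimes> y \<in> S" "\<And>c x. x \<in> S \<Longrightarrow> c \<odot> x \<in> S" "\<And>x. x \<in> S \<Longrightarrow> star A x \<in> S"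
    "\<And>x y. \<lbrakk>x \<in> S; y \<in> S\<rbrakk> \<Longrightarrow> x \<ominus> y \<in> S"
proof -
  have S: "subring S A" using assms by (simp add: star_subalgebra_def)
  show "S \<subseteq> carrier A" "\<one> \<in> S" "\<zero> \<in> S" "\<And>x y. \<lbrakk>x \<in> S; y \<in> S\<rbrakk> \<Longrightarrow> x \<oplus> y \<in> S"
    "\<And>x y. \<lbrakk>x \<in> S; y \<in> S\<rbrakk> \<Longrightarrow> x \<otimes> y \<in> S" "\<And>x y. \<lbrakk>x \<in> S; y \<in> S\<rbrakk> \<Longrightarrow> x \<ominus> y \<in> S"
    using subringE[OF S] by (auto simp: minus_eq)
  show "\<And>c x. x \<in> S \<Longrightarrow> c \<odot> x \<in> S" "\<And>x. x \<in> S \<Longrightarrow> star A x \<in> S"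
    using assms by (auto simp: star_subalgebra_def)
qed

lemma star_subalgebra_carrier: "star_subalgebra A (carrier A)"
  by (rule star_subalgebraI) auto

lemma star_subalgebra_finsum:
  assumes S: "star_subalgebra A S" and "finite I" "\<And>i. i \<in> I \<Longrightarrow> f i \<in> S"
  shows "(\<Oplus>i\<in>I. f i) \<in> S"
  using assms(2,3)
proof (induction I)
  case (insert i I)
  have "f \<in> I \<rightarrow> carrier A" "f i \<in> carrier A"
    using insert star_subalgebraD(1)[OF S] by auto
  thus ?case using insert star_subalgebraD(4)[OF S] by (simp add: finsum_insert)
qed (simp add: star_subalgebraD[OF S])

lemma star_generated_minimal:
  "\<lbrakk>star_subalgebra A S; X \<subseteq> S\<rbrakk> \<Longrightarrow> star_generated A X \<subseteq> S"
  by (auto simp: star_generated_def)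

lemma star_generated_superset: "X \<subseteq> star_generated A X"
  by (auto simp: star_generated_def)

lemma star_subalgebra_star_generated:
  assumes "X \<subseteq> carrier A" shows "star_subalgebra A (star_generated A X)"
proof (rule star_subalgebraI)
  show "star_generated A X \<subseteq> carrier A"
    by (rule star_generated_minimal[OF star_subalgebra_carrier assms])
qed (auto simp: star_generated_def dest: star_subalgebraD)

text \<open>Negation is scaling by -1, so closure under it follows from closure under scalars. In
  this form a subspace is recognised by simplification each time minimality of a span is
  invoked.\<close>

lemma submodule_iff:
  "submodule V complex_algebra A \<longleftrightarrow>
     V \<subseteq> carrier A \<and> \<zero> \<in> V \<and> (\<forall>x\<in>V. \<forall>y\<in>V. x \<oplus> y \<in> V) \<and> (\<forall>c. \<forall>x\<in>V. c \<odot> x \<in> V)"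
  (is "?l \<longleftrightarrow> ?r")
proof
  assume l: ?l
  note E = submoduleE[OF l]
  obtain v where "v \<in> V" using E(2) by blast
  hence "\<zero> \<in> V" using E(1) E(4)[of 0 v] by auto
  thus ?r using E by auto
next
  assume r: ?r
  show ?l
  proof (rule submoduleI)
    fix a assume "a \<in> V" thus "\<ominus> a \<in> V" using r uminus_eq_scale[of a] by auto
  qed (use r in auto)
qed

lemma lin_span_minimal:
  "\<lbrakk>submodule V complex_algebra A; X \<subseteq> V\<rbrakk> \<Longrightarrow> lin_span A X \<subseteq> V"
  by (auto simp: lin_span_def)

lemma lin_span_superset: "X \<subseteq> lin_span A X"
  by (auto simp: lin_span_def)

lemma submodule_lin_span:
  assumes "X \<subseteq> carrier A" shows "submodule (lin_span A X) complex_algebra A"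
  unfolding submodule_iff
proof (intro conjI)
  show "lin_span A X \<subseteq> carrier A"
    by (rule lin_span_minimal[OF carrier_is_submodule assms])
qed (auto simp: lin_span_def submodule_iff)

text \<open>Products are treated one factor at a time: the right factors that are good for a fixed
  element of X form a subspace containing X, and then so do the left factors that are good for a
  fixed element of the span.\<close>

lemma star_subalgebra_lin_span:
  assumes X: "X \<subseteq> carrier A" and one: "\<one> \<in> X"
    and mult: "\<And>x y. \<lbrakk>x \<in> X; y \<in> X\<rbrakk> \<Longrightarrow> x \<otimes> y \<in> X" and star: "\<And>x. x \<in> X \<Longrightarrow> star A x \<in> X"
  shows "star_subalgebra A (lin_span A X)"
proof -
  let ?S = "lin_span A X"
  have S: "?S \<subseteq> carrier A" "\<zero> \<in> ?S" "\<And>x y. \<lbrakk>x \<in> ?S; y \<in> ?S\<rbrakk> \<Longrightarrow> x \<oplus> y \<in> ?S"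
    "\<And>c x. x \<in> ?S \<Longrightarrow> c \<odot> x \<in> ?S"
    using submodule_lin_span[OF X] by (auto simp: submodule_iff)
  have sup: "x \<in> X \<Longrightarrow> x \<in> ?S" for x using lin_span_superset by blast
  have 1: "x \<otimes> y \<in> ?S" if "x \<in> X" "y \<in> ?S" for x y
  proof -
    have "?S \<subseteq> {y \<in> carrier A. x \<otimes> y \<in> ?S}"
    proof (rule lin_span_minimal)
      show "submodule {y \<in> carrier A. x \<otimes> y \<in> ?S} complex_algebra A"
        using S that X by (auto simp: submodule_iff r_distr smult_mult_right subset_iff)
    qed (use X mult that sup in auto)
    thus ?thesis using that by auto
  qed
  have 2: "x \<otimes> y \<in> ?S" if "x \<in> ?S" "y \<in> ?S" for x y
  proof -
    have "?S \<subseteq> {x \<in> carrier A. x \<otimes> y \<in> ?S}"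
    proof (rule lin_span_minimal)
      show "submodule {x \<in> carrier A. x \<otimes> y \<in> ?S} complex_algebra A"
        using S that by (auto simp: submodule_iff l_distr smult_mult_left subset_iff)
    qed (use X 1 that in auto)
    thus ?thesis using that by auto
  qed
  have 3: "star A x \<in> ?S" if "x \<in> ?S" for x
  proof -
    have "?S \<subseteq> {x \<in> carrier A. star A x \<in> ?S}"
    proof (rule lin_span_minimal)
      show "submodule {x \<in> carrier A. star A x \<in> ?S} complex_algebra A"
        using S by (auto simp: submodule_iff star_add star_smult subset_iff)
    qed (use X star sup in auto)
    thus ?thesis using that by auto
  qed
  show ?thesis using S 2 3 sup one by (intro star_subalgebraI) auto
qed

end

section \<open>Homomorphisms, equalizers and images\<close>

lemma star_homI:
  assumes "\<And>x. x \<in> carrier A \<Longrightarrow> f x \<in> carrier B"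
    "\<And>x y. \<lbrakk>x \<in> carrier A; y \<in> carrier A\<rbrakk> \<Longrightarrow> f (x \<otimes>\<^bsub>A\<^esub> y) = f x \<otimes>\<^bsub>B\<^esub> f y"
    "\<And>x y. \<lbrakk>x \<in> carrier A; y \<in> carrier A\<rbrakk> \<Longrightarrow> f (x \<oplus>\<^bsub>A\<^esub> y) = f x \<oplus>\<^bsub>B\<^esub> f y"
    "f \<one>\<^bsub>A\<^esub> = \<one>\<^bsub>B\<^esub>"
    "\<And>c x. x \<in> carrier A \<Longrightarrow> f (c \<odot>\<^bsub>A\<^esub> x) = c \<odot>\<^bsub>B\<^esub> f x"
    "\<And>x. x \<in> carrier A \<Longrightarrow> f (star A x) = star B (f x)"
  shows "f \<in> star_hom A B"
  using assms by (auto simp: star_hom_def ring_hom_def)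

lemma star_homD:
  assumes "f \<in> star_hom A B"
  shows "\<And>x. x \<in> carrier A \<Longrightarrow> f x \<in> carrier B"
    "\<And>x y. \<lbrakk>x \<in> carrier A; y \<in> carrier A\<rbrakk> \<Longrightarrow> f (x \<otimes>\<^bsub>A\<^esub> y) = f x \<otimes>\<^bsub>B\<^esub> f y"
    "\<And>x y. \<lbrakk>x \<in> carrier A; y \<in> carrier A\<rbrakk> \<Longrightarrow> f (x \<oplus>\<^bsub>A\<^esub> y) = f x \<oplus>\<^bsub>B\<^esub> f y"
    "f \<one>\<^bsub>A\<^esub> = \<one>\<^bsub>B\<^esub>"
    "\<And>c x. x \<in> carrier A \<Longrightarrow> f (c \<odot>\<^bsub>A\<^esub> x) = c \<odot>\<^bsub>B\<^esub> f x"
    "\<And>x. x \<in> carrier A \<Longrightarrow> f (star A x) = star B (f x)"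
  using assms by (auto simp: star_hom_def ring_hom_def)

lemma star_hom_zero:
  assumes "unital_star_algebra A" "unital_star_algebra B" "f \<in> star_hom A B"
  shows "f \<zero>\<^bsub>A\<^esub> = \<zero>\<^bsub>B\<^esub>"
proof -
  interpret A: unital_star_algebra A by fact
  interpret B: unital_star_algebra B by fact
  have "f (0 \<odot>\<^bsub>A\<^esub> \<zero>\<^bsub>A\<^esub>) = 0 \<odot>\<^bsub>B\<^esub> f \<zero>\<^bsub>A\<^esub>"
    by (rule star_homD(5)[OF assms(3)]) simp
  thus ?thesis using star_homD(1)[OF assms(3), of "\<zero>\<^bsub>A\<^esub>"] by simp
qed

lemma star_hom_minus:
  assumes "unital_star_algebra A" "unital_star_algebra B" "f \<in> star_hom A B"
    "x \<in> carrier A" "y \<in> carrier A"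
  shows "f (x \<ominus>\<^bsub>A\<^esub> y) = f x \<ominus>\<^bsub>B\<^esub> f y"
proof -
  interpret A: unital_star_algebra A by fact
  interpret B: unital_star_algebra B by fact
  show ?thesis
    using star_homD[OF assms(3)] assms(4,5)
    by (simp add: A.minus_eq B.minus_eq A.uminus_eq_scale B.uminus_eq_scale)
qed

lemma star_hom_comp:
  assumes "f \<in> star_hom A B" "g \<in> star_hom B C" shows "g \<circ> f \<in> star_hom A C"
  using star_homD[OF assms(1)] star_homD[OF assms(2)] by (intro star_homI) auto

lemma star_subalgebra_equalizer:
  assumes "unital_star_algebra A" "f \<in> star_hom A B" "g \<in> star_hom A B"
  shows "star_subalgebra A {x \<in> carrier A. f x = g x}"
proof -
  interpret A: unital_star_algebra A by fact
  show ?thesis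
    using star_homD[OF assms(2)] star_homD[OF assms(3)] by (intro A.star_subalgebraI) auto
qed

lemma star_subalgebra_vimage:
  assumes "unital_star_algebra A" "unital_star_algebra B" "f \<in> star_hom A B" "star_subalgebra B S"
  shows "star_subalgebra A {x \<in> carrier A. f x \<in> S}"
proof -
  interpret A: unital_star_algebra A by fact
  interpret B: unital_star_algebra B by fact
  show ?thesis
    using star_homD[OF assms(3)] B.star_subalgebraD[OF assms(4)] by (intro A.star_subalgebraI) auto
qed

text \<open>All axioms are identities, so they pass along a surjection that respects the operations.
  Here \<open>B\<close> is not yet known to be an algebra, so preservation of zero cannot be derived
  and is assumed. Besides quotients, this covers records that extend an algebra by further fields,
  with the identity as surjection.\<close>

lemma unital_star_algebra_image:
  assumes "unital_star_algebra A" and im: "\<pi> ` carrier A = carrier B" and hom: "\<pi> \<in> star_hom A B"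
    and zero: "\<pi> \<zero>\<^bsub>A\<^esub> = \<zero>\<^bsub>B\<^esub>"
  shows "unital_star_algebra B"
proof -
  interpret A: unital_star_algebra A by fact
  note h = star_homD[OF hom]
  have E: "\<exists>a\<in>carrier A. y = \<pi> a" if "y \<in> carrier B" for y
    using that unfolding im[symmetric] by auto
  note hs = h(2-6)[symmetric] zero[symmetric]
  show ?thesis
  proof (rule unital_star_algebraI)
    fix x y assume "x \<in> carrier B" "y \<in> carrier B"
    then obtain a b where ab: "a \<in> carrier A" "b \<in> carrier A" "x = \<pi> a" "y = \<pi> b"
      using E by meson
    show "x \<oplus>\<^bsub>B\<^esub> y \<in> carrier B" "x \<oplus>\<^bsub>B\<^esub> y = y \<oplus>\<^bsub>B\<^esub> x" "x \<otimes>\<^bsub>B\<^esub> y \<in> carrier B"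
      "star B (x \<oplus>\<^bsub>B\<^esub> y) = star B x \<oplus>\<^bsub>B\<^esub> star B y"
      "star B (x \<otimes>\<^bsub>B\<^esub> y) = star B y \<otimes>\<^bsub>B\<^esub> star B x"
      using ab by (simp_all add: hs h(1) A.a_comm A.star_add A.star_mult)
    fix c
    show "c \<odot>\<^bsub>B\<^esub> (x \<oplus>\<^bsub>B\<^esub> y) = c \<odot>\<^bsub>B\<^esub> x \<oplus>\<^bsub>B\<^esub> c \<odot>\<^bsub>B\<^esub> y"
      "(c \<odot>\<^bsub>B\<^esub> x) \<otimes>\<^bsub>B\<^esub> y = c \<odot>\<^bsub>B\<^esub> (x \<otimes>\<^bsub>B\<^esub> y)" "x \<otimes>\<^bsub>B\<^esub> (c \<odot>\<^bsub>B\<^esub> y) = c \<odot>\<^bsub>B\<^esub> (x \<otimes>\<^bsub>B\<^esub> y)"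
      using ab by (simp_all add: hs A.scale_add_right A.smult_mult_left A.smult_mult_right)
    fix z assume "z \<in> carrier B"
    then obtain d where d: "d \<in> carrier A" "z = \<pi> d" using E by meson
    show "(x \<oplus>\<^bsub>B\<^esub> y) \<oplus>\<^bsub>B\<^esub> z = x \<oplus>\<^bsub>B\<^esub> (y \<oplus>\<^bsub>B\<^esub> z)" "(x \<otimes>\<^bsub>B\<^esub> y) \<otimes>\<^bsub>B\<^esub> z = x \<otimes>\<^bsub>B\<^esub> (y \<otimes>\<^bsub>B\<^esub> z)"
      "(x \<oplus>\<^bsub>B\<^esub> y) \<otimes>\<^bsub>B\<^esub> z = x \<otimes>\<^bsub>B\<^esub> z \<oplus>\<^bsub>B\<^esub> y \<otimes>\<^bsub>B\<^esub> z"
      "z \<otimes>\<^bsub>B\<^esub> (x \<oplus>\<^bsub>B\<^esub> y) = z \<otimes>\<^bsub>B\<^esub> x \<oplus>\<^bsub>B\<^esub> z \<otimes>\<^bsub>B\<^esub> y"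
      using ab d by (simp_all add: hs A.a_assoc A.m_assoc A.l_distr A.r_distr)
  next
    fix x assume "x \<in> carrier B"
    then obtain a where a: "a \<in> carrier A" "x = \<pi> a" using E by meson
    fix c d
    show "\<zero>\<^bsub>B\<^esub> \<oplus>\<^bsub>B\<^esub> x = x" "\<one>\<^bsub>B\<^esub> \<otimes>\<^bsub>B\<^esub> x = x" "x \<otimes>\<^bsub>B\<^esub> \<one>\<^bsub>B\<^esub> = x" "c \<odot>\<^bsub>B\<^esub> x \<in> carrier B"
      "(c + d) \<odot>\<^bsub>B\<^esub> x = c \<odot>\<^bsub>B\<^esub> x \<oplus>\<^bsub>B\<^esub> d \<odot>\<^bsub>B\<^esub> x" "(c * d) \<odot>\<^bsub>B\<^esub> x = c \<odot>\<^bsub>B\<^esub> (d \<odot>\<^bsub>B\<^esub> x)"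
      "1 \<odot>\<^bsub>B\<^esub> x = x" "0 \<odot>\<^bsub>B\<^esub> x = \<zero>\<^bsub>B\<^esub>" "star B x \<in> carrier B" "star B (star B x) = x"
      "star B (c \<odot>\<^bsub>B\<^esub> x) = cnj c \<odot>\<^bsub>B\<^esub> star B x"
      using a by (simp_all add: hs h(1) A.scale_add_left A.scale_scale A.star_smult)
  qed (use zero h(1)[of "\<zero>\<^bsub>A\<^esub>"] h(1)[of "\<one>\<^bsub>A\<^esub>"] h(4) in auto)
qed

section \<open>Quotients by ideals stable under the involution\<close>

locale star_ideal = unital_star_algebra A + ideal I A for I and A (structure) +
  assumes star_ideal: "x \<in> I \<Longrightarrow> star A x \<in> I"
begin

abbreviation "Q \<equiv> quotient_algebra A I"

text \<open>A scalar c acts as left multiplication by c 1, so a ring ideal is automatically a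
  subspace.\<close>

lemma scale_ideal: "x \<in> I \<Longrightarrow> c \<odot> x \<in> I"
  using I_l_closed[of x "c \<odot> \<one>"] by (simp add: smult_mult_left)

lemma coset_eq_iff:
  assumes "x \<in> carrier A" "y \<in> carrier A"
  shows "I +> x = I +> y \<longleftrightarrow> x \<ominus> y \<in> I"
  using quotient_eq_iff_same_a_r_cos[OF is_ideal assms] by simp

lemma coset_image_star:
  assumes "x \<in> carrier A" shows "star A ` (I +> x) = I +> star A x"
proof (intro Set.set_eqI iffI)
  fix u assume "u \<in> star A ` (I +> x)"
  then show "u \<in> I +> star A x"
    using assms by (force simp: a_r_coset_def' star_add star_ideal)
next
  fix u assume "u \<in> I +> star A x"
  then obtain i where i: "i \<in> I" "u = i \<oplus> star A x" by (auto simp: a_r_coset_def')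
  hence "u = star A (star A i \<oplus> x)" using assms by (simp add: star_add)
  thus "u \<in> star A ` (I +> x)" using i star_ideal by (auto simp: a_r_coset_def')
qed

lemma coset_scale:
  assumes "x \<in> carrier A" shows "I <+>\<^bsub>A\<^esub> (\<lambda>y. c \<odot> y) ` (I +> x) = I +> c \<odot> x"
proof (intro Set.set_eqI iffI)
  fix u assume "u \<in> I <+>\<^bsub>A\<^esub> (\<lambda>y. c \<odot> y) ` (I +> x)"
  then obtain i j where ij: "i \<in> I" "j \<in> I" "u = i \<oplus> c \<odot> (j \<oplus> x)"
    by (auto simp: set_add_def' a_r_coset_def')
  hence "u = (i \<oplus> c \<odot> j) \<oplus> c \<odot> x" using assms by (simp add: scale_add_right a_assoc)
  moreover have "i \<oplus> c \<odot> j \<in> I" using ij scale_ideal by auto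
  ultimately show "u \<in> I +> c \<odot> x" by (auto simp: a_r_coset_def')
next
  fix u assume "u \<in> I +> c \<odot> x"
  then obtain i where "i \<in> I" "u = i \<oplus> c \<odot> x" by (auto simp: a_r_coset_def')
  moreover have "x \<in> I +> x" using assms a_rcos_self by blast
  ultimately show "u \<in> I <+>\<^bsub>A\<^esub> (\<lambda>y. c \<odot> y) ` (I +> x)"
    unfolding set_add_def' by blast
qed

lemma quotient_simps:
  "carrier Q = (+>) I ` carrier A" "\<one>\<^bsub>Q\<^esub> = I +> \<one>" "\<zero>\<^bsub>Q\<^esub> = I"
  by (auto simp: quotient_algebra_def FactRing_def A_RCOSETS_def')

lemma quotient_ops:
  "\<lbrakk>x \<in> carrier A; y \<in> carrier A\<rbrakk> \<Longrightarrow> (I +> x) \<otimes>\<^bsub>Q\<^esub> (I +> y) = I +> x \<otimes> y"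
  "\<lbrakk>x \<in> carrier A; y \<in> carrier A\<rbrakk> \<Longrightarrow> (I +> x) \<oplus>\<^bsub>Q\<^esub> (I +> y) = I +> (x \<oplus> y)"
  "x \<in> carrier A \<Longrightarrow> c \<odot>\<^bsub>Q\<^esub> (I +> x) = I +> c \<odot> x"
  "x \<in> carrier A \<Longrightarrow> star Q (I +> x) = I +> star A x"
  by (simp_all add: quotient_algebra_def FactRing_def rcoset_mult_add a_rcos_sum coset_scale
      coset_image_star)

lemma quotient_hom: "(+>) I \<in> star_hom A Q"
  by (rule star_homI) (auto simp: quotient_simps quotient_ops)

lemma unital_star_algebra_quotient: "unital_star_algebra Q"
proof (rule unital_star_algebra_image[OF unital_star_algebra_axioms _ quotient_hom])
  show "I +> \<zero> = \<zero>\<^bsub>Q\<^esub>" by (simp add: quotient_simps a_coset_add_zero a_subset)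
qed (simp add: quotient_simps)

end

section \<open>Monoid algebras\<close>

lemma lookup_map_times [simp]:
  "Poly_Mapping.lookup (Poly_Mapping.map ((*) (c::complex)) f) k = c * Poly_Mapping.lookup f k"
  by (simp add: Poly_Mapping.map.rep_eq when_def)

lemma keys_map_times: "Poly_Mapping.keys (Poly_Mapping.map ((*) (c::complex)) f) \<subseteq> Poly_Mapping.keys f"
  by (auto simp: in_keys_iff)

lemma map_times_single [simp]:
  "Poly_Mapping.map ((*) (c::complex)) (Poly_Mapping.single k d) = Poly_Mapping.single k (c * d)"
  by (rule poly_mapping_eqI) (simp add: lookup_single when_def)

lemma map_times_zero [simp]: "Poly_Mapping.map ((*) (c::complex)) 0 = 0"
  by (rule poly_mapping_eqI) simp

lemma map_times_add:
  "Poly_Mapping.map ((*) (c::complex)) (f + g) =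
     Poly_Mapping.map ((*) c) f + Poly_Mapping.map ((*) c) g"
  by (rule poly_mapping_eqI) (simp add: lookup_add algebra_simps)

lemma poly_mapping_sum_single:
  "(\<Sum>k\<in>Poly_Mapping.keys f. Poly_Mapping.single k (Poly_Mapping.lookup f k)) = f"
  by (rule poly_mapping_eqI) (simp add: lookup_sum lookup_single when_def in_keys_iff)

lemma poly_mapping_keys_induct [consumes 1, case_names zero single add]:
  fixes f :: "'w \<Rightarrow>\<^sub>0 complex"
  assumes "Poly_Mapping.keys f \<subseteq> S" and "P 0"
    and single: "\<And>k c. k \<in> S \<Longrightarrow> P (Poly_Mapping.single k c)"
    and add: "\<And>f g. \<lbrakk>Poly_Mapping.keys f \<subseteq> S; Poly_Mapping.keys g \<subseteq> S; P f; P g\<rbrakk> \<Longrightarrow> P (f + g)"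
  shows "P f"
proof -
  let ?s = "\<lambda>k. Poly_Mapping.single k (Poly_Mapping.lookup f k)"
  have "finite I \<Longrightarrow> I \<subseteq> S \<Longrightarrow> Poly_Mapping.keys (sum ?s I) \<subseteq> S \<and> P (sum ?s I)" for I
  proof (induction I rule: finite_induct)
    case (insert k I)
    have k: "Poly_Mapping.keys (?s k) \<subseteq> S" using insert by simp
    have "Poly_Mapping.keys (?s k + sum ?s I) \<subseteq> S"
      using k insert keys_add[of "?s k" "sum ?s I"] by auto
    moreover have "P (?s k + sum ?s I)"
      using k insert by (intro add single) auto
    ultimately show ?case using insert by simp
  qed (simp add: assms)
  from this[of "Poly_Mapping.keys f"] show ?thesis
    using assms(1) by (simp add: poly_mapping_sum_single)
qed

text \<open>The sum has the same shape as the one inside \<open>tensor_lift\<close>, so a tensor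
  lift is this map evaluated at an arbitrary representative of the coset.\<close>

definition lin_ext ::
  "('a, 'm) star_algebra_scheme \<Rightarrow> ('w \<Rightarrow> 'a) \<Rightarrow> ('w \<Rightarrow>\<^sub>0 complex) \<Rightarrow> 'a" where
  "lin_ext A h f = (\<Oplus>\<^bsub>A\<^esub>p\<in>Poly_Mapping.keys f. Poly_Mapping.lookup f p \<odot>\<^bsub>A\<^esub> h p)"

context unital_star_algebra
begin

text \<open>Cancellation can make the keys of f + g smaller than the union of the keys of f and g.
  Summing over a common finite superset removes this obstruction to linearity.\<close>

lemma lin_ext_superset:
  assumes "finite S" "Poly_Mapping.keys f \<subseteq> S" "h \<in> S \<rightarrow> carrier A"
  shows "lin_ext A h f = (\<Oplus>p\<in>S. Poly_Mapping.lookup f p \<odot> h p)"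
  unfolding lin_ext_def
  by (rule add.finprod_mono_neutral_cong_left) (use assms in \<open>auto simp: in_keys_iff Pi_iff\<close>)

lemma lin_ext_closed:
  assumes "h \<in> Poly_Mapping.keys f \<rightarrow> carrier A" shows "lin_ext A h f \<in> carrier A"
  unfolding lin_ext_def using assms by (intro finsum_closed) auto

lemma lin_ext_add:
  assumes "h \<in> S \<rightarrow> carrier A" "Poly_Mapping.keys f \<subseteq> S" "Poly_Mapping.keys g \<subseteq> S"
  shows "lin_ext A h (f + g) = lin_ext A h f \<oplus> lin_ext A h g"
proof -
  let ?S = "Poly_Mapping.keys f \<union> Poly_Mapping.keys g"
  have h: "h \<in> ?S \<rightarrow> carrier A" and fin: "finite ?S" using assms by auto
  have "lin_ext A h (f + g) = (\<Oplus>p\<in>?S. Poly_Mapping.lookup (f + g) p \<odot> h p)"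
    using keys_add[of f g] by (intro lin_ext_superset[OF fin _ h])
  also have "\<dots> = (\<Oplus>p\<in>?S. Poly_Mapping.lookup f p \<odot> h p \<oplus> Poly_Mapping.lookup g p \<odot> h p)"
    using h by (intro finsum_cong') (auto simp: lookup_add scale_add_left Pi_iff)
  also have "\<dots> = (\<Oplus>p\<in>?S. Poly_Mapping.lookup f p \<odot> h p) \<oplus> (\<Oplus>p\<in>?S. Poly_Mapping.lookup g p \<odot> h p)"
    using h by (intro finsum_addf) auto
  also have "\<dots> = lin_ext A h f \<oplus> lin_ext A h g"
    using lin_ext_superset[OF fin _ h, of f] lin_ext_superset[OF fin _ h, of g] by simp
  finally show ?thesis .
qed

lemma lin_ext_single:
  assumes "h k \<in> carrier A" shows "lin_ext A h (Poly_Mapping.single k c) = c \<odot> h k"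
  using assms by (subst lin_ext_superset[of "{k}"]) (auto simp: finsum_insert)

lemma lin_ext_zero [simp]: "lin_ext A h 0 = \<zero>"
  by (simp add: lin_ext_def)

lemma lin_ext_scale:
  assumes "h \<in> S \<rightarrow> carrier A" "Poly_Mapping.keys f \<subseteq> S"
  shows "lin_ext A h (Poly_Mapping.map ((*) c) f) = c \<odot> lin_ext A h f"
  using assms keys_map_times[of c f]
  by (subst (1 2) lin_ext_superset[of "Poly_Mapping.keys f"])
    (auto simp: scale_finsum Pi_iff subset_iff scale_scale intro!: finsum_cong')

lemma lin_ext_diff:
  assumes "h \<in> S \<rightarrow> carrier A" "Poly_Mapping.keys f \<subseteq> S" "Poly_Mapping.keys g \<subseteq> S"
  shows "lin_ext A h (f - g) = lin_ext A h f \<ominus> lin_ext A h g"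
proof -
  have k: "Poly_Mapping.keys (f - g) \<subseteq> S" using assms keys_diff[of f g] by auto
  have c: "lin_ext A h f \<in> carrier A" "lin_ext A h g \<in> carrier A" "lin_ext A h (f - g) \<in> carrier A"
    using assms k by (auto intro!: lin_ext_closed)
  have "lin_ext A h (f - g + g) = lin_ext A h (f - g) \<oplus> lin_ext A h g"
    by (rule lin_ext_add[OF assms(1) k assms(3)])
  thus ?thesis using c by (simp add: minus_eq a_assoc r_neg)
qed

end

section \<open>The *-algebra of a monoid with involution\<close>

locale star_monoid = monoid M for M (structure) and s :: "'w \<Rightarrow> 'w" +
  assumes s_closed: "u \<in> carrier M \<Longrightarrow> s u \<in> carrier M"
    and s_s: "u \<in> carrier M \<Longrightarrow> s (s u) = u"
    and s_mult: "\<lbrakk>u \<in> carrier M; v \<in> carrier M\<rbrakk> \<Longrightarrow> s (u \<otimes> v) = s v \<otimes> s u"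

lemma monoid_algebra_simps:
  "carrier (monoid_algebra M s) = {f. Poly_Mapping.keys f \<subseteq> carrier M}"
  "\<one>\<^bsub>monoid_algebra M s\<^esub> = Poly_Mapping.single \<one>\<^bsub>M\<^esub> 1"
  "zero (monoid_algebra M s) = 0" "add (monoid_algebra M s) = (+)"
  "smult (monoid_algebra M s) = (\<lambda>c. Poly_Mapping.map ((*) c))"
  by (simp_all add: monoid_algebra_def)

lemma monoid_algebra_mult_single:
  "Poly_Mapping.single u a \<otimes>\<^bsub>monoid_algebra M s\<^esub> Poly_Mapping.single v b =
     Poly_Mapping.single (u \<otimes>\<^bsub>M\<^esub> v) (a * b)"
  by (cases "a = 0"; cases "b = 0") (simp_all add: monoid_algebra_def)

lemma monoid_algebra_add_mult:
  "(f + g) \<otimes>\<^bsub>monoid_algebra M s\<^esub> h = f \<otimes>\<^bsub>monoid_algebra M s\<^esub> h + g \<otimes>\<^bsub>monoid_algebra M s\<^esub> h"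
  unfolding monoid_algebra_def partial_object.simps monoid.simps
  by (rule setsum_keys_plus_distrib) (simp_all add: distrib_right single_add sum.distrib)

lemma monoid_algebra_mult_add:
  "h \<otimes>\<^bsub>monoid_algebra M s\<^esub> (f + g) = h \<otimes>\<^bsub>monoid_algebra M s\<^esub> f + h \<otimes>\<^bsub>monoid_algebra M s\<^esub> g"
  unfolding monoid_algebra_def partial_object.simps monoid.simps sum.distrib[symmetric]
  by (intro sum.cong refl setsum_keys_plus_distrib) (simp_all add: distrib_left single_add)

lemma monoid_algebra_star_add:
  "star (monoid_algebra M s) (f + g) = star (monoid_algebra M s) f + star (monoid_algebra M s) g"
  unfolding monoid_algebra_def star_algebra.simps
  by (rule setsum_keys_plus_distrib) (simp_all add: single_add)

lemma monoid_algebra_star_single: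
  "star (monoid_algebra M s) (Poly_Mapping.single u a) = Poly_Mapping.single (s u) (cnj a)"
  by (cases "a = 0") (simp_all add: monoid_algebra_def)

lemma monoid_algebra_diff:
  "(f - g) \<otimes>\<^bsub>monoid_algebra M s\<^esub> h = f \<otimes>\<^bsub>monoid_algebra M s\<^esub> h - g \<otimes>\<^bsub>monoid_algebra M s\<^esub> h"
  "h \<otimes>\<^bsub>monoid_algebra M s\<^esub> (f - g) = h \<otimes>\<^bsub>monoid_algebra M s\<^esub> f - h \<otimes>\<^bsub>monoid_algebra M s\<^esub> g"
  "star (monoid_algebra M s) (f - g) = star (monoid_algebra M s) f - star (monoid_algebra M s) g"
  using monoid_algebra_add_mult[of M s "f - g" g h] monoid_algebra_mult_add[of M s h "f - g" g]
    monoid_algebra_star_add[of M s "f - g" g] by (simp_all add: algebra_simps)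

lemma monoid_algebra_zero:
  "0 \<otimes>\<^bsub>monoid_algebra M s\<^esub> h = 0" "h \<otimes>\<^bsub>monoid_algebra M s\<^esub> 0 = 0"
  "star (monoid_algebra M s) 0 = 0"
  by (simp_all add: monoid_algebra_def)

lemma monoid_algebra_single: "u \<in> carrier M \<Longrightarrow> Poly_Mapping.single u c \<in> carrier (monoid_algebra M s)"
  by (simp add: monoid_algebra_simps)

lemmas monoid_algebra_ops = monoid_algebra_simps monoid_algebra_mult_single monoid_algebra_add_mult
  monoid_algebra_mult_add monoid_algebra_star_add monoid_algebra_star_single monoid_algebra_zero

lemma monoid_algebra_induct [consumes 1, case_names zero single add]:
  assumes "f \<in> carrier (monoid_algebra M s)" and "P 0"
    and "\<And>k c. k \<in> carrier M \<Longrightarrow> P (Poly_Mapping.single k c)"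
    and "\<And>f g. \<lbrakk>f \<in> carrier (monoid_algebra M s); g \<in> carrier (monoid_algebra M s); P f; P g\<rbrakk>
           \<Longrightarrow> P (f + g)"
  shows "P f"
  by (rule poly_mapping_keys_induct[of f "carrier M"]) (use assms in \<open>auto simp: monoid_algebra_simps\<close>)

context star_monoid
begin

abbreviation "MA \<equiv> monoid_algebra M s"

lemma add_carrier: "\<lbrakk>f \<in> carrier MA; g \<in> carrier MA\<rbrakk> \<Longrightarrow> f + g \<in> carrier MA"
  using keys_add[of f g] by (auto simp: monoid_algebra_simps)

lemma zero_carrier: "0 \<in> carrier MA"
  by (simp add: monoid_algebra_simps)

lemma mult_carrier:
  assumes "f \<in> carrier MA" "g \<in> carrier MA" shows "f \<otimes>\<^bsub>MA\<^esub> g \<in> carrier MA"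
  using assms(1)
proof (induction rule: monoid_algebra_induct)
  case (single u c)
  show ?case using assms(2)
    by (induction rule: monoid_algebra_induct)
      (simp_all add: single monoid_algebra_ops(6-) monoid_algebra_single add_carrier zero_carrier)
qed (simp_all add: monoid_algebra_ops(6-) add_carrier zero_carrier)

lemma star_carrier:
  assumes "f \<in> carrier MA" shows "star MA f \<in> carrier MA"
  using assms
  by (induction rule: monoid_algebra_induct)
    (simp_all add: monoid_algebra_ops(6-) monoid_algebra_single add_carrier zero_carrier s_closed)

lemma scale_carrier: "f \<in> carrier MA \<Longrightarrow> c \<odot>\<^bsub>MA\<^esub> f \<in> carrier MA"
  using keys_map_times[of c f] by (auto simp: monoid_algebra_simps)

lemma mult_assoc_MA:
  assumes "f \<in> carrier MA" "g \<in> carrier MA" "h \<in> carrier MA"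
  shows "(f \<otimes>\<^bsub>MA\<^esub> g) \<otimes>\<^bsub>MA\<^esub> h = f \<otimes>\<^bsub>MA\<^esub> (g \<otimes>\<^bsub>MA\<^esub> h)"
  using assms(1)
proof (induction rule: monoid_algebra_induct)
  case (single u a)
  show ?case using assms(2)
  proof (induction rule: monoid_algebra_induct)
    case (single v b)
    show ?case using assms(3)
      by (induction rule: monoid_algebra_induct)
        (simp_all add: single \<open>u \<in> carrier M\<close> monoid_algebra_ops(6-) m_assoc mult.assoc)
  qed (simp_all add: monoid_algebra_ops(6-))
qed (simp_all add: monoid_algebra_ops(6-))

lemma scale_mult:
  assumes "f \<in> carrier MA" "g \<in> carrier MA"
  shows "(c \<odot>\<^bsub>MA\<^esub> f) \<otimes>\<^bsub>MA\<^esub> g = c \<odot>\<^bsub>MA\<^esub> (f \<otimes>\<^bsub>MA\<^esub> g)" "f \<otimes>\<^bsub>MA\<^esub> (c \<odot>\<^bsub>MA\<^esub> g) = c \<odot>\<^bsub>MA\<^esub> (f \<otimes>\<^bsub>MA\<^esub> g)"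
proof -
  note ops = monoid_algebra_ops(5-)
  show "(c \<odot>\<^bsub>MA\<^esub> f) \<otimes>\<^bsub>MA\<^esub> g = c \<odot>\<^bsub>MA\<^esub> (f \<otimes>\<^bsub>MA\<^esub> g)"
    using assms(1)
  proof (induction rule: monoid_algebra_induct)
    case (single u a)
    show ?case using assms(2)
      by (induction rule: monoid_algebra_induct) (simp_all add: ops mult.assoc map_times_add)
  qed (simp_all add: ops map_times_add)
  show "f \<otimes>\<^bsub>MA\<^esub> (c \<odot>\<^bsub>MA\<^esub> g) = c \<odot>\<^bsub>MA\<^esub> (f \<otimes>\<^bsub>MA\<^esub> g)"
    using assms(1)
  proof (induction rule: monoid_algebra_induct)
    case (single u a)
    show ?case using assms(2)
      by (induction rule: monoid_algebra_induct) (simp_all add: ops mult_ac map_times_add)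
  qed (simp_all add: ops map_times_add)
qed

lemma star_props:
  assumes "f \<in> carrier MA"
  shows "star MA (star MA f) = f" "star MA (c \<odot>\<^bsub>MA\<^esub> f) = cnj c \<odot>\<^bsub>MA\<^esub> star MA f"
    "\<one>\<^bsub>MA\<^esub> \<otimes>\<^bsub>MA\<^esub> f = f" "f \<otimes>\<^bsub>MA\<^esub> \<one>\<^bsub>MA\<^esub> = f"
  using assms
  by (induction rule: monoid_algebra_induct)
    (simp_all add: monoid_algebra_ops(2-) s_s map_times_add)

lemma star_mult_MA:
  assumes "f \<in> carrier MA" "g \<in> carrier MA"
  shows "star MA (f \<otimes>\<^bsub>MA\<^esub> g) = star MA g \<otimes>\<^bsub>MA\<^esub> star MA f"
  using assms(1)
proof (induction rule: monoid_algebra_induct)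
  case (single u a)
  show ?case using assms(2)
    by (induction rule: monoid_algebra_induct)
      (simp_all add: single monoid_algebra_ops(5-) s_mult mult.commute)
qed (simp_all add: monoid_algebra_ops(5-))

lemma unital_star_algebra_monoid_algebra: "unital_star_algebra MA"
proof (rule unital_star_algebraI)
  fix x y z c d
  assume xy: "x \<in> carrier MA" "y \<in> carrier MA"
  show "x \<otimes>\<^bsub>MA\<^esub> y \<in> carrier MA" "x \<oplus>\<^bsub>MA\<^esub> y \<in> carrier MA"
    "star MA (x \<otimes>\<^bsub>MA\<^esub> y) = star MA y \<otimes>\<^bsub>MA\<^esub> star MA x"
    using xy by (auto simp: star_mult_MA mult_carrier add_carrier monoid_algebra_simps(4))
next
  fix x c d
  show "(c + d) \<odot>\<^bsub>MA\<^esub> x = c \<odot>\<^bsub>MA\<^esub> x \<oplus>\<^bsub>MA\<^esub> d \<odot>\<^bsub>MA\<^esub> x" "(c * d) \<odot>\<^bsub>MA\<^esub> x = c \<odot>\<^bsub>MA\<^esub> (d \<odot>\<^bsub>MA\<^esub> x)"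
    "1 \<odot>\<^bsub>MA\<^esub> x = x" "0 \<odot>\<^bsub>MA\<^esub> x = \<zero>\<^bsub>MA\<^esub>"
    by (auto simp: monoid_algebra_simps intro!: poly_mapping_eqI simp: lookup_add algebra_simps)
qed (simp_all add: mult_assoc_MA star_props scale_mult star_carrier scale_carrier zero_carrier
    monoid_algebra_ops(3,4) monoid_algebra_ops(6-) monoid_algebra_single, simp_all add: add.assoc
    add.commute map_times_add monoid_algebra_simps)

text \<open>The universal property of the monoid algebra: by additivity in each argument everything
  reduces to singletons, where it is the hypothesis on \<open>h\<close>. Applied to the monoid of
  words it evaluates noncommutative polynomials.\<close>

lemma lin_ext_star_hom:
  assumes B: "unital_star_algebra B"
    and h: "\<And>u. u \<in> carrier M \<Longrightarrow> h u \<in> carrier B"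
      "\<And>u v. \<lbrakk>u \<in> carrier M; v \<in> carrier M\<rbrakk> \<Longrightarrow> h (u \<otimes> v) = h u \<otimes>\<^bsub>B\<^esub> h v"
      "h \<one> = \<one>\<^bsub>B\<^esub>" "\<And>u. u \<in> carrier M \<Longrightarrow> h (s u) = star B (h u)"
  shows "lin_ext B h \<in> star_hom MA B"
proof -
  interpret B: unital_star_algebra B by fact
  have hc: "h \<in> carrier M \<rightarrow> carrier B" using h by auto
  have closed: "lin_ext B h f \<in> carrier B" if "f \<in> carrier MA" for f
    using that hc by (auto simp: monoid_algebra_simps intro!: B.lin_ext_closed)
  have Ladd: "lin_ext B h (f + g) = lin_ext B h f \<oplus>\<^bsub>B\<^esub> lin_ext B h g"
    if "f \<in> carrier MA" "g \<in> carrier MA" for f g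
    using that B.lin_ext_add[OF hc] by (auto simp: monoid_algebra_simps)
  have scale: "lin_ext B h (c \<odot>\<^bsub>MA\<^esub> f) = c \<odot>\<^bsub>B\<^esub> lin_ext B h f" if "f \<in> carrier MA" for f c
    using that B.lin_ext_scale[OF hc] by (auto simp: monoid_algebra_simps)
  have Lsingle: "lin_ext B h (Poly_Mapping.single u c) = c \<odot>\<^bsub>B\<^esub> h u" if "u \<in> carrier M" for u c
    using B.lin_ext_single[of h u c] h that by auto
  show ?thesis
  proof (rule star_homI)
    fix f g assume f: "f \<in> carrier MA" and g: "g \<in> carrier MA"
    show "lin_ext B h (f \<oplus>\<^bsub>MA\<^esub> g) = lin_ext B h f \<oplus>\<^bsub>B\<^esub> lin_ext B h g"
      using Ladd[OF f g] by (simp add: monoid_algebra_simps)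
    show "lin_ext B h (f \<otimes>\<^bsub>MA\<^esub> g) = lin_ext B h f \<otimes>\<^bsub>B\<^esub> lin_ext B h g"
      using f
    proof (induction rule: monoid_algebra_induct)
      case zero show ?case by (simp add: monoid_algebra_ops(6-) closed g)
    next
      case (single u a)
      show ?case using g
      proof (induction rule: monoid_algebra_induct)
        case zero
        show ?case using single h(1) by (simp add: monoid_algebra_ops(6-) Lsingle)
      next
        case (single v b)
        thus ?case using \<open>u \<in> carrier M\<close>
          by (simp add: monoid_algebra_ops(6-) Lsingle h B.smult_mult_left
              B.smult_mult_right B.scale_scale mult.commute)
      next
        case (add g g')
        thus ?case using single
          by (simp add: monoid_algebra_ops(6-) Ladd mult_carrier monoid_algebra_single closed B.r_distr)
      qed
    next
      case (add f f')
      thus ?case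
        by (simp add: monoid_algebra_ops(6-) Ladd mult_carrier closed g B.l_distr)
    qed
  next
    fix f assume f: "f \<in> carrier MA"
    thus "lin_ext B h (star MA f) = star B (lin_ext B h f)"
    proof (induction rule: monoid_algebra_induct)
      case (single u a)
      thus ?case by (simp add: monoid_algebra_ops(6-) Lsingle h s_closed B.star_smult)
    next
      case (add f g)
      thus ?case by (simp add: monoid_algebra_ops(6-) Ladd star_carrier closed B.star_add)
    qed (simp add: monoid_algebra_ops(6-))
  qed (use closed scale Lsingle[of \<one> 1] h in \<open>auto simp: monoid_algebra_simps\<close>)
qed

end

text \<open>Multipliers have to be tested only on a spanning set X, because the admissible
  multipliers of a fixed element form a subspace. In the tensor product X consists of the pairs, and
  multiplication by a pair sends a bilinearity relation to a bilinearity relation.\<close>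

lemma (in unital_star_algebra) star_ideal_lin_span:
  assumes R: "R \<subseteq> carrier A" and X: "X \<subseteq> carrier A" "carrier A \<subseteq> lin_span A X"
    and "\<And>x r. \<lbrakk>x \<in> X; r \<in> R\<rbrakk> \<Longrightarrow> x \<otimes> r \<in> R" "\<And>x r. \<lbrakk>x \<in> X; r \<in> R\<rbrakk> \<Longrightarrow> r \<otimes> x \<in> R"
    and "\<And>r. r \<in> R \<Longrightarrow> star A r \<in> R"
  shows "star_ideal (lin_span A R) A"
proof -
  let ?S = "lin_span A R"
  have sub: "submodule ?S complex_algebra A" by (rule submodule_lin_span[OF R])
  have S: "?S \<subseteq> carrier A" "\<zero> \<in> ?S" "\<And>x y. \<lbrakk>x \<in> ?S; y \<in> ?S\<rbrakk> \<Longrightarrow> x \<oplus> y \<in> ?S"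
    "\<And>c x. x \<in> ?S \<Longrightarrow> c \<odot> x \<in> ?S"
    using sub by (auto simp: submodule_iff)
  have sup: "x \<in> R \<Longrightarrow> x \<in> ?S" for x using lin_span_superset by blast
  have 1: "x \<otimes> r \<in> ?S \<and> r \<otimes> x \<in> ?S" if "x \<in> X" "r \<in> ?S" for x r
  proof -
    have "?S \<subseteq> {r \<in> carrier A. x \<otimes> r \<in> ?S \<and> r \<otimes> x \<in> ?S}"
    proof (rule lin_span_minimal)
      show "submodule {r \<in> carrier A. x \<otimes> r \<in> ?S \<and> r \<otimes> x \<in> ?S} complex_algebra A"
        using S that X
        by (auto simp: submodule_iff r_distr l_distr smult_mult_right smult_mult_left subset_iff)
    qed (use R X assms(4,5) that sup in auto)
    thus ?thesis using that by auto
  qed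
  have 2: "x \<otimes> r \<in> ?S \<and> r \<otimes> x \<in> ?S" if "x \<in> carrier A" "r \<in> ?S" for x r
  proof -
    have "lin_span A X \<subseteq> {x \<in> carrier A. x \<otimes> r \<in> ?S \<and> r \<otimes> x \<in> ?S}"
    proof (rule lin_span_minimal)
      show "submodule {x \<in> carrier A. x \<otimes> r \<in> ?S \<and> r \<otimes> x \<in> ?S} complex_algebra A"
        using S that
        by (auto simp: submodule_iff r_distr l_distr smult_mult_right smult_mult_left subset_iff)
    qed (use X 1 that in auto)
    thus ?thesis using that X by auto
  qed
  have 3: "star A x \<in> ?S" if "x \<in> ?S" for x
  proof -
    have "?S \<subseteq> {x \<in> carrier A. star A x \<in> ?S}"
    proof (rule lin_span_minimal)
      show "submodule {x \<in> carrier A. star A x \<in> ?S} complex_algebra A"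
        using S by (auto simp: submodule_iff star_add star_smult subset_iff)
    qed (use R assms(6) sup in auto)
    thus ?thesis using that by auto
  qed
  have "ideal ?S A"
    by (rule idealI[OF ring_axioms submodule.axioms(1)[OF sub]]) (use 2 in auto)
  thus ?thesis
    by (intro star_ideal.intro unital_star_algebra_axioms star_ideal_axioms.intro 3)
qed

section \<open>Tensor products\<close>

text \<open>Slicing maps built from functionals, and the partial maps (with one variable frozen)
  behind associativity, are linear but in general not multiplicative; hence this notion beside
  \<open>star_hom\<close>.\<close>

definition lin_map ::
  "('a, 'm) star_algebra_scheme \<Rightarrow> ('b, 'n) star_algebra_scheme \<Rightarrow> ('a \<Rightarrow> 'b) \<Rightarrow> bool" where
  "lin_map A B f \<longleftrightarrow>
     (\<forall>x\<in>carrier A. f x \<in> carrier B) \<and>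
     (\<forall>x\<in>carrier A. \<forall>y\<in>carrier A. f (x \<oplus>\<^bsub>A\<^esub> y) = f x \<oplus>\<^bsub>B\<^esub> f y) \<and>
     (\<forall>c. \<forall>x\<in>carrier A. f (c \<odot>\<^bsub>A\<^esub> x) = c \<odot>\<^bsub>B\<^esub> f x)"

lemma lin_mapD:
  assumes "lin_map A B f"
  shows "x \<in> carrier A \<Longrightarrow> f x \<in> carrier B"
    "\<lbrakk>x \<in> carrier A; y \<in> carrier A\<rbrakk> \<Longrightarrow> f (x \<oplus>\<^bsub>A\<^esub> y) = f x \<oplus>\<^bsub>B\<^esub> f y"
    "x \<in> carrier A \<Longrightarrow> f (c \<odot>\<^bsub>A\<^esub> x) = c \<odot>\<^bsub>B\<^esub> f x"
  using assms by (auto simp: lin_map_def)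

lemma star_hom_lin_map: "f \<in> star_hom A B \<Longrightarrow> lin_map A B f"
  by (auto simp: lin_map_def dest: star_homD)

lemma lin_map_zero:
  assumes "unital_star_algebra A" "unital_star_algebra B" "lin_map A B f"
  shows "f \<zero>\<^bsub>A\<^esub> = \<zero>\<^bsub>B\<^esub>"
proof -
  interpret A: unital_star_algebra A by fact
  interpret B: unital_star_algebra B by fact
  show ?thesis
    using lin_mapD(3)[OF assms(3), of "\<zero>\<^bsub>A\<^esub>" 0] lin_mapD(1)[OF assms(3), of "\<zero>\<^bsub>A\<^esub>"] by simp
qed

definition bilin_map ::
  "('a, 'm) star_algebra_scheme \<Rightarrow> ('b, 'n) star_algebra_scheme \<Rightarrow> ('c, 'l) star_algebra_scheme \<Rightarrow>
     ('a \<Rightarrow> 'b \<Rightarrow> 'c) \<Rightarrow> bool" where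
  "bilin_map A B E f \<longleftrightarrow>
     (\<forall>a\<in>carrier A. lin_map B E (f a)) \<and> (\<forall>b\<in>carrier B. lin_map A E (\<lambda>a. f a b))"

lemma bilin_mapI:
  assumes "\<And>a. a \<in> carrier A \<Longrightarrow> lin_map B E (f a)"
    "\<And>b. b \<in> carrier B \<Longrightarrow> lin_map A E (\<lambda>a. f a b)"
  shows "bilin_map A B E f"
  using assms by (auto simp: bilin_map_def)

lemma bilin_mapD:
  assumes "bilin_map A B E f" "a \<in> carrier A" "b \<in> carrier B"
  shows "f a b \<in> carrier E"
    "a' \<in> carrier A \<Longrightarrow> f (a \<oplus>\<^bsub>A\<^esub> a') b = f a b \<oplus>\<^bsub>E\<^esub> f a' b"
    "b' \<in> carrier B \<Longrightarrow> f a (b \<oplus>\<^bsub>B\<^esub> b') = f a b \<oplus>\<^bsub>E\<^esub> f a b'"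
    "f (c \<odot>\<^bsub>A\<^esub> a) b = c \<odot>\<^bsub>E\<^esub> f a b" "f a (c \<odot>\<^bsub>B\<^esub> b) = c \<odot>\<^bsub>E\<^esub> f a b"
  using assms by (auto simp: bilin_map_def lin_map_def)

lemma bilin_map_comp:
  assumes "bilin_map C D E f" "lin_map A C g" "lin_map B D h"
  shows "bilin_map A B E (\<lambda>a b. f (g a) (h b))"
  using assms by (auto simp: bilin_map_def lin_map_def)

lemma tensor_relations_cases [consumes 1, case_names add_left add_right scale_left scale_right]:
  assumes "r \<in> tensor_relations A B"
  obtains a a' b where "a \<in> carrier A" "a' \<in> carrier A" "b \<in> carrier B"
      "r = Poly_Mapping.single (a \<oplus>\<^bsub>A\<^esub> a', b) 1 - Poly_Mapping.single (a, b) 1 - Poly_Mapping.single (a', b) 1"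
  | a b b' where "a \<in> carrier A" "b \<in> carrier B" "b' \<in> carrier B"
      "r = Poly_Mapping.single (a, b \<oplus>\<^bsub>B\<^esub> b') 1 - Poly_Mapping.single (a, b) 1 - Poly_Mapping.single (a, b') 1"
  | c a b where "a \<in> carrier A" "b \<in> carrier B"
      "r = Poly_Mapping.single (c \<odot>\<^bsub>A\<^esub> a, b) 1 - Poly_Mapping.single (a, b) c"
  | c a b where "a \<in> carrier A" "b \<in> carrier B"
      "r = Poly_Mapping.single (a, c \<odot>\<^bsub>B\<^esub> b) 1 - Poly_Mapping.single (a, b) c"
  using assms unfolding tensor_relations_def Let_def by blast

lemma tensor_relationsI:
  "\<lbrakk>a \<in> carrier A; a' \<in> carrier A; b \<in> carrier B\<rbrakk> \<Longrightarrow>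
     Poly_Mapping.single (a \<oplus>\<^bsub>A\<^esub> a', b) 1 - Poly_Mapping.single (a, b) 1 - Poly_Mapping.single (a', b) 1
       \<in> tensor_relations A B"
  "\<lbrakk>a \<in> carrier A; b \<in> carrier B; b' \<in> carrier B\<rbrakk> \<Longrightarrow>
     Poly_Mapping.single (a, b \<oplus>\<^bsub>B\<^esub> b') 1 - Poly_Mapping.single (a, b) 1 - Poly_Mapping.single (a, b') 1
       \<in> tensor_relations A B"
  "\<lbrakk>a \<in> carrier A; b \<in> carrier B\<rbrakk> \<Longrightarrow>
     Poly_Mapping.single (c \<odot>\<^bsub>A\<^esub> a, b) 1 - Poly_Mapping.single (a, b) c \<in> tensor_relations A B"
  "\<lbrakk>a \<in> carrier A; b \<in> carrier B\<rbrakk> \<Longrightarrow>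
     Poly_Mapping.single (a, c \<odot>\<^bsub>B\<^esub> b) 1 - Poly_Mapping.single (a, b) c \<in> tensor_relations A B"
  unfolding tensor_relations_def Let_def by blast+

section \<open>The tensor product of two algebras and its universal property\<close>

locale tensor_pair = A: unital_star_algebra A + B: unital_star_algebra B
  for A :: "('a, 'm) star_algebra_scheme" and B :: "('b, 'n) star_algebra_scheme"
begin

abbreviation "pre \<equiv> tensor_pre A B"
abbreviation "I \<equiv> tensor_ideal A B"
abbreviation "AB \<equiv> tensor_algebra A B"
abbreviation "del a b \<equiv> Poly_Mapping.single (a, b) (1::complex)"

lemma star_monoid_pair: "star_monoid (A \<times>\<times> B) (map_prod (star A) (star B))"
proof (intro star_monoid.intro star_monoid_axioms.intro DirProd_monoid)
  show "Group.monoid A" "Group.monoid B" by unfold_locales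
qed (auto simp: A.star_mult B.star_mult)

lemma unital_star_algebra_pre: "unital_star_algebra pre"
  unfolding tensor_pre_def
  by (rule star_monoid.unital_star_algebra_monoid_algebra[OF star_monoid_pair])

sublocale pre: unital_star_algebra pre
  by (rule unital_star_algebra_pre)

lemma pre_simps:
  "carrier pre = {f. Poly_Mapping.keys f \<subseteq> carrier A \<times> carrier B}"
  "\<one>\<^bsub>pre\<^esub> = del \<one>\<^bsub>A\<^esub> \<one>\<^bsub>B\<^esub>"
  "zero pre = 0" "add pre = (+)" "smult pre = (\<lambda>c. Poly_Mapping.map ((*) c))"
  "Poly_Mapping.single (a, b) c \<otimes>\<^bsub>pre\<^esub> Poly_Mapping.single (a', b') d =
     Poly_Mapping.single (a \<otimes>\<^bsub>A\<^esub> a', b \<otimes>\<^bsub>B\<^esub> b') (c * d)"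
  "star pre (Poly_Mapping.single (a, b) c) = Poly_Mapping.single (star A a, star B b) (cnj c)"
  by (simp_all add: tensor_pre_def monoid_algebra_simps monoid_algebra_mult_single
      monoid_algebra_star_single)

lemmas pre_diff = monoid_algebra_diff[of "A \<times>\<times> B" "map_prod (star A) (star B)",
    folded tensor_pre_def]

lemma del_closed [simp]: "\<lbrakk>a \<in> carrier A; b \<in> carrier B\<rbrakk> \<Longrightarrow> Poly_Mapping.single (a, b) c \<in> carrier pre"
  by (simp add: pre_simps)

lemma pre_minus: "\<lbrakk>x \<in> carrier pre; y \<in> carrier pre\<rbrakk> \<Longrightarrow> x \<ominus>\<^bsub>pre\<^esub> y = x - y"
  by (simp add: pre.minus_eq pre.uminus_eq_scale)
    (auto simp: pre_simps lookup_add lookup_minus intro!: poly_mapping_eqI)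

lemma pre_diff_closed: "\<lbrakk>x \<in> carrier pre; y \<in> carrier pre\<rbrakk> \<Longrightarrow> x - y \<in> carrier pre"
  using pre.minus_closed[of x y] by (simp add: pre_minus)

lemma tensor_relations_closed: "tensor_relations A B \<subseteq> carrier pre"
proof
  fix r assume "r \<in> tensor_relations A B"
  thus "r \<in> carrier pre"
    by (cases rule: tensor_relations_cases) (auto intro!: pre_diff_closed)
qed

lemma tensor_relations_mult_left:
  assumes "a \<in> carrier A" "b \<in> carrier B" "r \<in> tensor_relations A B"
  shows "del a b \<otimes>\<^bsub>pre\<^esub> r \<in> tensor_relations A B"
  using assms(3)
  by (cases rule: tensor_relations_cases)
    (use assms(1,2) in \<open>simp_all add: pre_diff pre_simps A.r_distr B.r_distr A.smult_mult_right B.smult_mult_right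
      tensor_relationsI\<close>)

lemma tensor_relations_mult_right:
  assumes "a \<in> carrier A" "b \<in> carrier B" "r \<in> tensor_relations A B"
  shows "r \<otimes>\<^bsub>pre\<^esub> del a b \<in> tensor_relations A B"
  using assms(3)
  by (cases rule: tensor_relations_cases)
    (use assms(1,2) in \<open>simp_all add: pre_diff pre_simps A.l_distr B.l_distr A.smult_mult_left B.smult_mult_left
      tensor_relationsI\<close>)

lemma tensor_relations_star:
  assumes "r \<in> tensor_relations A B" shows "star pre r \<in> tensor_relations A B"
  using assms
  by (cases rule: tensor_relations_cases)
    (simp_all add: pre_diff pre_simps A.star_add A.star_smult B.star_add B.star_smult tensor_relationsI)

lemma pre_span: "carrier pre \<subseteq> lin_span pre {del a b | a b. a \<in> carrier A \<and> b \<in> carrier B}"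
  (is "_ \<subseteq> ?S")
proof
  have S: "submodule ?S complex_algebra pre" by (rule pre.submodule_lin_span) auto
  fix f assume "f \<in> carrier pre"
  hence "Poly_Mapping.keys f \<subseteq> carrier A \<times> carrier B" by (simp add: pre_simps)
  thus "f \<in> ?S"
  proof (induction rule: poly_mapping_keys_induct)
    case (single k c)
    then obtain a b where k: "k = (a, b)" "a \<in> carrier A" "b \<in> carrier B" by auto
    hence "del a b \<in> ?S" by (intro subsetD[OF pre.lin_span_superset]) auto
    hence "c \<odot>\<^bsub>pre\<^esub> del a b \<in> ?S" using S by (simp add: pre.submodule_iff)
    thus ?case using k by (simp add: pre_simps)
  next
    case (add f g)
    hence "f \<oplus>\<^bsub>pre\<^esub> g \<in> ?S" using S by (simp add: pre.submodule_iff)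
    thus ?case by (simp add: pre_simps)
  qed (use S in \<open>simp add: pre.submodule_iff pre_simps\<close>)
qed

lemma star_ideal_tensor: "star_ideal I pre"
  unfolding tensor_ideal_def
  by (rule pre.star_ideal_lin_span[OF tensor_relations_closed _ pre_span])
    (auto simp: tensor_relations_mult_left tensor_relations_mult_right tensor_relations_star)

sublocale I: star_ideal I pre
  by (rule star_ideal_tensor)

sublocale AB: unital_star_algebra AB
  unfolding tensor_algebra_def by (rule I.unital_star_algebra_quotient)

lemma unital_star_algebra_tensor: "unital_star_algebra AB"
  by (rule AB.unital_star_algebra_axioms)

lemma proj_hom: "(+>\<^bsub>pre\<^esub>) I \<in> star_hom pre AB"
  unfolding tensor_algebra_def by (rule I.quotient_hom)

lemma relations_in_ideal: "r \<in> tensor_relations A B \<Longrightarrow> r \<in> I"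
  unfolding tensor_ideal_def by (rule subsetD[OF pre.lin_span_superset])

lemma tens_closed [simp, intro]: "\<lbrakk>a \<in> carrier A; b \<in> carrier B\<rbrakk> \<Longrightarrow> tens A B a b \<in> carrier AB"
  unfolding tens_def using star_homD(1)[OF proj_hom] by simp

lemma coset_eqI:
  assumes "x \<in> carrier pre" "y \<in> carrier pre" "x - y \<in> I"
  shows "I +>\<^bsub>pre\<^esub> x = I +>\<^bsub>pre\<^esub> y"
  using assms by (simp add: I.coset_eq_iff pre_minus)

lemma bilin_tens: "bilin_map A B AB (tens A B)"
proof (rule bilin_mapI)
  have add: "(I +>\<^bsub>pre\<^esub> x) \<oplus>\<^bsub>AB\<^esub> (I +>\<^bsub>pre\<^esub> y) = I +>\<^bsub>pre\<^esub> (x + y)"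
    if "x \<in> carrier pre" "y \<in> carrier pre" for x y
    using star_homD(3)[OF proj_hom that] by (simp add: pre_simps)
  have scale: "c \<odot>\<^bsub>AB\<^esub> (I +>\<^bsub>pre\<^esub> del a b) = I +>\<^bsub>pre\<^esub> (Poly_Mapping.single (a, b) c)"
    if "a \<in> carrier A" "b \<in> carrier B" for a b c
    using star_homD(5)[OF proj_hom, of "del a b" c] that by (simp add: pre_simps)
  have add_closed: "x + y \<in> carrier pre" if "x \<in> carrier pre" "y \<in> carrier pre" for x y
    using pre.a_closed[OF that] by (simp add: pre_simps)
  { fix a assume a: "a \<in> carrier A"
    show "lin_map B AB (tens A B a)"
      unfolding lin_map_def
    proof (intro conjI ballI allI)
      fix b b' assume "b \<in> carrier B" "b' \<in> carrier B"
      then show "tens A B a (b \<oplus>\<^bsub>B\<^esub> b') = tens A B a b \<oplus>\<^bsub>AB\<^esub> tens A B a b'"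
        using a relations_in_ideal[OF tensor_relationsI(2)[OF a]]
        unfolding tens_def
        by (simp add: add del: Poly_Mapping.single_add)
          (rule coset_eqI, simp_all add: add_closed diff_diff_eq)
    next
      fix b c assume "b \<in> carrier B"
      then show "tens A B a (c \<odot>\<^bsub>B\<^esub> b) = c \<odot>\<^bsub>AB\<^esub> tens A B a b"
        using a relations_in_ideal[OF tensor_relationsI(4)[OF a]]
        unfolding tens_def
        by (simp add: scale) (rule coset_eqI, simp_all)
    qed (use a in auto) }
  { fix b assume b: "b \<in> carrier B"
    show "lin_map A AB (\<lambda>a. tens A B a b)"
      unfolding lin_map_def
    proof (intro conjI ballI allI)
      fix a a' assume a: "a \<in> carrier A" "a' \<in> carrier A"
      then show "tens A B (a \<oplus>\<^bsub>A\<^esub> a') b = tens A B a b \<oplus>\<^bsub>AB\<^esub> tens A B a' b"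
        using b relations_in_ideal[OF tensor_relationsI(1)[OF a b]]
        unfolding tens_def
        by (simp add: add del: Poly_Mapping.single_add)
          (rule coset_eqI, simp_all add: add_closed diff_diff_eq)
    next
      fix a c assume a: "a \<in> carrier A"
      then show "tens A B (c \<odot>\<^bsub>A\<^esub> a) b = c \<odot>\<^bsub>AB\<^esub> tens A B a b"
        using b relations_in_ideal[OF tensor_relationsI(3)[OF a b]]
        unfolding tens_def
        by (simp add: scale) (rule coset_eqI, simp_all)
    qed (use b in auto) }
qed

lemmas tens_bilin = bilin_mapD(2-5)[OF bilin_tens]

lemma tens_zero [simp]:
  "b \<in> carrier B \<Longrightarrow> tens A B \<zero>\<^bsub>A\<^esub> b = \<zero>\<^bsub>AB\<^esub>" "a \<in> carrier A \<Longrightarrow> tens A B a \<zero>\<^bsub>B\<^esub> = \<zero>\<^bsub>AB\<^esub>"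
  using tens_bilin(3)[of "\<zero>\<^bsub>A\<^esub>" b 0] tens_bilin(4)[of a "\<zero>\<^bsub>B\<^esub>" 0] by simp_all

lemma tens_mult:
  "\<lbrakk>a \<in> carrier A; a' \<in> carrier A; b \<in> carrier B; b' \<in> carrier B\<rbrakk> \<Longrightarrow>
     tens A B a b \<otimes>\<^bsub>AB\<^esub> tens A B a' b' = tens A B (a \<otimes>\<^bsub>A\<^esub> a') (b \<otimes>\<^bsub>B\<^esub> b')"
  unfolding tens_def
  using star_homD(2)[OF proj_hom, of "del a b" "del a' b'"] by (simp add: pre_simps(6))

lemma tens_star:
  "\<lbrakk>a \<in> carrier A; b \<in> carrier B\<rbrakk> \<Longrightarrow> star AB (tens A B a b) = tens A B (star A a) (star B b)"
  unfolding tens_def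
  using star_homD(6)[OF proj_hom, of "del a b"] by (simp add: pre_simps(7))

lemma tens_one: "tens A B \<one>\<^bsub>A\<^esub> \<one>\<^bsub>B\<^esub> = \<one>\<^bsub>AB\<^esub>"
  unfolding tens_def using star_homD(4)[OF proj_hom] by (simp add: pre_simps(2))

lemma carrier_tensor: "carrier AB = (+>\<^bsub>pre\<^esub>) I ` carrier pre"
  unfolding tensor_algebra_def by (rule I.quotient_simps(1))

text \<open>Coefficients are absorbed into the first leg, and zero is itself an elementary tensor,
  so two cases suffice.\<close>

lemma tensor_induct [consumes 1, case_names tens add]:
  assumes "t \<in> carrier AB"
    and tens: "\<And>a b. \<lbrakk>a \<in> carrier A; b \<in> carrier B\<rbrakk> \<Longrightarrow> P (tens A B a b)"
    and add: "\<And>s t. \<lbrakk>s \<in> carrier AB; t \<in> carrier AB; P s; P t\<rbrakk> \<Longrightarrow> P (s \<oplus>\<^bsub>AB\<^esub> t)"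
  shows "P t"
proof -
  obtain f where f: "f \<in> carrier pre" "t = I +>\<^bsub>pre\<^esub> f" using assms(1) by (auto simp: carrier_tensor)
  have "Poly_Mapping.keys f \<subseteq> carrier A \<times> carrier B" using f by (simp add: pre_simps)
  hence "P (I +>\<^bsub>pre\<^esub> f)"
  proof (induction rule: poly_mapping_keys_induct)
    case zero
    have "\<zero>\<^bsub>AB\<^esub> = I +>\<^bsub>pre\<^esub> 0"
      using star_hom_zero[OF pre.unital_star_algebra_axioms AB.unital_star_algebra_axioms proj_hom]
      by (simp add: pre_simps)
    thus ?case using tens[of "\<zero>\<^bsub>A\<^esub>" "\<zero>\<^bsub>B\<^esub>"] by simp
  next
    case (single k c)
    then obtain a b where k: "k = (a, b)" "a \<in> carrier A" "b \<in> carrier B" by auto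
    have "I +>\<^bsub>pre\<^esub> Poly_Mapping.single k c = tens A B (c \<odot>\<^bsub>A\<^esub> a) b"
      using star_homD(5)[OF proj_hom, of "del a b" c] k
      by (simp add: tens_bilin(3)) (simp add: pre_simps tens_def)
    thus ?case using tens[of "c \<odot>\<^bsub>A\<^esub> a" b] k by simp
  next
    case (add f g)
    have "I +>\<^bsub>pre\<^esub> (f + g) = (I +>\<^bsub>pre\<^esub> f) \<oplus>\<^bsub>AB\<^esub> (I +>\<^bsub>pre\<^esub> g)"
      using star_homD(3)[OF proj_hom, of f g] add by (simp add: pre_simps)
    moreover have "I +>\<^bsub>pre\<^esub> f \<in> carrier AB" "I +>\<^bsub>pre\<^esub> g \<in> carrier AB"
      using add by (auto simp: carrier_tensor pre_simps)
    ultimately show ?case using assms(3) add by simp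
  qed
  thus ?thesis using f by simp
qed

text \<open>The kernel \<open>?K\<close> of the linear extension is a subspace containing the
  bilinearity relations, hence the whole tensor ideal. The extension is therefore constant on each
  coset, its image of a coset is a singleton, and \<open>the_elem\<close> reads off the
  value.\<close>

lemma tensor_lift_coset:
  assumes E: "unital_star_algebra E" and f: "bilin_map A B E f" and t: "t \<in> carrier pre"
  shows "tensor_lift E f (I +>\<^bsub>pre\<^esub> t) = lin_ext E (\<lambda>p. f (fst p) (snd p)) t"
proof -
  interpret E: unital_star_algebra E by fact
  let ?h = "\<lambda>p. f (fst p) (snd p)" and ?S = "carrier A \<times> carrier B"
  have h: "?h \<in> ?S \<rightarrow> carrier E" using bilin_mapD(1)[OF f] by auto
  have add: "lin_ext E ?h (x + y) = lin_ext E ?h x \<oplus>\<^bsub>E\<^esub> lin_ext E ?h y"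
    if "x \<in> carrier pre" "y \<in> carrier pre" for x y
    using E.lin_ext_add[OF h] that by (simp add: pre_simps)
  have single: "lin_ext E ?h (Poly_Mapping.single (a, b) c) = c \<odot>\<^bsub>E\<^esub> f a b"
    if "a \<in> carrier A" "b \<in> carrier B" for a b c
    using E.lin_ext_single[of ?h "(a, b)"] bilin_mapD(1)[OF f that] by simp
  have diff: "lin_ext E ?h (x - y) = lin_ext E ?h x \<ominus>\<^bsub>E\<^esub> lin_ext E ?h y"
    if "x \<in> carrier pre" "y \<in> carrier pre" for x y
    using E.lin_ext_diff[OF h] that by (simp add: pre_simps)
  let ?K = "{x \<in> carrier pre. lin_ext E ?h x = \<zero>\<^bsub>E\<^esub>}"
  have "submodule ?K complex_algebra pre"
    unfolding pre.submodule_iff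
  proof (intro conjI allI ballI)
    fix c x assume x: "x \<in> ?K"
    have "lin_ext E ?h (c \<odot>\<^bsub>pre\<^esub> x) = c \<odot>\<^bsub>E\<^esub> lin_ext E ?h x"
      using E.lin_ext_scale[OF h, of x c] x by (simp add: pre_simps)
    thus "c \<odot>\<^bsub>pre\<^esub> x \<in> ?K" using x by simp
  next
    fix x y assume "x \<in> ?K" "y \<in> ?K"
    hence "lin_ext E ?h (x \<oplus>\<^bsub>pre\<^esub> y) = \<zero>\<^bsub>E\<^esub>" using add[of x y] by (simp add: pre_simps(4))
    thus "x \<oplus>\<^bsub>pre\<^esub> y \<in> ?K" using \<open>x \<in> ?K\<close> \<open>y \<in> ?K\<close> by simp
  qed (auto simp: pre_simps)
  moreover have "tensor_relations A B \<subseteq> ?K"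
  proof
    fix r assume r: "r \<in> tensor_relations A B"
    hence "lin_ext E ?h r = \<zero>\<^bsub>E\<^esub>"
    proof (cases rule: tensor_relations_cases)
      case (add_left a a' b)
      thus ?thesis using bilin_mapD[OF f]
        by (simp add: diff pre_diff_closed single E.minus_eq E.a_ac E.r_neg E.minus_add E.r_neg1 E.r_neg2)
    next
      case (add_right a b b')
      thus ?thesis using bilin_mapD[OF f]
        by (simp add: diff pre_diff_closed single E.minus_eq E.a_ac E.r_neg E.minus_add E.r_neg1 E.r_neg2)
    next
      case (scale_left c a b)
      thus ?thesis using bilin_mapD[OF f] by (simp add: diff single E.minus_eq E.r_neg)
    next
      case (scale_right c a b)
      thus ?thesis using bilin_mapD[OF f] by (simp add: diff single E.minus_eq E.r_neg)
    qed
    thus "r \<in> ?K" using r tensor_relations_closed by auto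
  qed
  ultimately have K: "I \<subseteq> ?K"
    unfolding tensor_ideal_def by (rule pre.lin_span_minimal)
  have "lin_ext E ?h ` (I +>\<^bsub>pre\<^esub> t) = {lin_ext E ?h t}"
  proof (intro equalityI subsetI)
    fix v assume "v \<in> lin_ext E ?h ` (I +>\<^bsub>pre\<^esub> t)"
    then obtain i where i: "i \<in> I" "v = lin_ext E ?h (i + t)"
      by (auto simp: a_r_coset_def' pre_simps)
    have "lin_ext E ?h t \<in> carrier E"
      using h t by (auto simp: pre_simps intro!: E.lin_ext_closed)
    thus "v \<in> {lin_ext E ?h t}" using i K t add[of i t] by auto
  next
    have "t \<in> I +>\<^bsub>pre\<^esub> t" using t I.a_rcos_self by blast
    thus "v \<in> lin_ext E ?h ` (I +>\<^bsub>pre\<^esub> t)" if "v \<in> {lin_ext E ?h t}" for v using that by auto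
  qed
  thus ?thesis unfolding tensor_lift_def lin_ext_def by simp
qed

lemma tensor_lift_tens:
  assumes E: "unital_star_algebra E" and f: "bilin_map A B E f"
    and ab: "a \<in> carrier A" "b \<in> carrier B"
  shows "tensor_lift E f (tens A B a b) = f a b"
proof -
  interpret E: unital_star_algebra E by fact
  show ?thesis
    using ab bilin_mapD(1)[OF f] by (simp add: tens_def tensor_lift_coset[OF E f] E.lin_ext_single)
qed

lemma lin_map_tensor_lift:
  assumes E: "unital_star_algebra E" and f: "bilin_map A B E f"
  shows "lin_map AB E (tensor_lift E f)"
proof -
  interpret E: unital_star_algebra E by fact
  let ?h = "\<lambda>p. f (fst p) (snd p)"
  have h: "?h \<in> carrier A \<times> carrier B \<rightarrow> carrier E" using bilin_mapD(1)[OF f] by auto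
  have 1: "tensor_lift E f (I +>\<^bsub>pre\<^esub> x) \<in> carrier E" if "x \<in> carrier pre" for x
    using that h by (auto simp: tensor_lift_coset[OF E f that] pre_simps intro!: E.lin_ext_closed)
  have 2: "tensor_lift E f ((I +>\<^bsub>pre\<^esub> x) \<oplus>\<^bsub>AB\<^esub> (I +>\<^bsub>pre\<^esub> y)) =
      tensor_lift E f (I +>\<^bsub>pre\<^esub> x) \<oplus>\<^bsub>E\<^esub> tensor_lift E f (I +>\<^bsub>pre\<^esub> y)"
    if "x \<in> carrier pre" "y \<in> carrier pre" for x y
    using that E.lin_ext_add[OF h, of x y] star_homD(3)[OF proj_hom that, symmetric]
    by (simp add: tensor_lift_coset[OF E f]) (simp add: pre_simps)
  have 3: "tensor_lift E f (c \<odot>\<^bsub>AB\<^esub> (I +>\<^bsub>pre\<^esub> x)) = c \<odot>\<^bsub>E\<^esub> tensor_lift E f (I +>\<^bsub>pre\<^esub> x)"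
    if "x \<in> carrier pre" for x c
    using that E.lin_ext_scale[OF h, of x c] star_homD(5)[OF proj_hom that, symmetric]
    by (simp add: tensor_lift_coset[OF E f]) (simp add: pre_simps)
  show ?thesis using 1 2 3 by (auto simp: lin_map_def carrier_tensor)
qed

lemma tensor_lift_star_hom:
  assumes E: "unital_star_algebra E" and f: "bilin_map A B E f"
    and mult: "\<And>a a' b b'. \<lbrakk>a \<in> carrier A; a' \<in> carrier A; b \<in> carrier B; b' \<in> carrier B\<rbrakk> \<Longrightarrow>
      f (a \<otimes>\<^bsub>A\<^esub> a') (b \<otimes>\<^bsub>B\<^esub> b') = f a b \<otimes>\<^bsub>E\<^esub> f a' b'"
    and one: "f \<one>\<^bsub>A\<^esub> \<one>\<^bsub>B\<^esub> = \<one>\<^bsub>E\<^esub>"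
    and star: "\<And>a b. \<lbrakk>a \<in> carrier A; b \<in> carrier B\<rbrakk> \<Longrightarrow> f (star A a) (star B b) = star E (f a b)"
  shows "tensor_lift E f \<in> star_hom AB E"
proof -
  interpret E: unital_star_algebra E by fact
  let ?F = "tensor_lift E f"
  note lin = lin_mapD[OF lin_map_tensor_lift[OF E f]]
  note F = tensor_lift_tens[OF E f]
  note fc = bilin_mapD(1)[OF f]
  show ?thesis
  proof (rule star_homI)
    fix s t assume s: "s \<in> carrier AB" and t: "t \<in> carrier AB"
    show "?F (s \<otimes>\<^bsub>AB\<^esub> t) = ?F s \<otimes>\<^bsub>E\<^esub> ?F t"
      using s
    proof (induction rule: tensor_induct)
      case (tens a b)
      show ?case using t
      proof (induction rule: tensor_induct)
        case (tens a' b')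
        thus ?case using \<open>a \<in> carrier A\<close> \<open>b \<in> carrier B\<close> by (simp add: tens_mult F mult)
      next
        case (add t t')
        thus ?case using tens by (simp add: AB.r_distr lin E.r_distr)
      qed
    next
      case (add s s')
      thus ?case using t by (simp add: AB.l_distr lin E.l_distr)
    qed
  next
    fix t assume "t \<in> carrier AB"
    thus "?F (star AB t) = star E (?F t)"
    proof (induction rule: tensor_induct)
      case (tens a b)
      thus ?case by (simp add: tens_star F star)
    next
      case (add s t)
      thus ?case by (simp add: AB.star_add lin E.star_add)
    qed
  next
    show "?F \<one>\<^bsub>AB\<^esub> = \<one>\<^bsub>E\<^esub>" using F[of "\<one>\<^bsub>A\<^esub>" "\<one>\<^bsub>B\<^esub>"] one by (simp add: tens_one)
  qed (use lin in auto)
qed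

end

lemma tensor_pairI: "\<lbrakk>unital_star_algebra A; unital_star_algebra B\<rbrakk> \<Longrightarrow> tensor_pair A B"
  by (rule tensor_pair.intro)

lemma unital_star_algebra_tensor:
  "\<lbrakk>unital_star_algebra A; unital_star_algebra B\<rbrakk> \<Longrightarrow> unital_star_algebra (tensor_algebra A B)"
  by (rule tensor_pair.unital_star_algebra_tensor[OF tensor_pairI])

lemma tensor_map_star_hom:
  assumes "unital_star_algebra A" "unital_star_algebra B" "unital_star_algebra C"
    "unital_star_algebra D" "f \<in> star_hom A C" "g \<in> star_hom B D"
  shows "tensor_map C D f g \<in> star_hom (tensor_algebra A B) (tensor_algebra C D)"
    "\<And>a b. \<lbrakk>a \<in> carrier A; b \<in> carrier B\<rbrakk> \<Longrightarrow> tensor_map C D f g (tens A B a b) = tens C D (f a) (g b)"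
proof -
  interpret AB: tensor_pair A B using assms by (intro tensor_pairI)
  interpret CD: tensor_pair C D using assms by (intro tensor_pairI)
  note f = star_homD[OF assms(5)] and g = star_homD[OF assms(6)]
  have bil: "bilin_map A B CD.AB (\<lambda>a b. tens C D (f a) (g b))"
    by (rule bilin_map_comp[OF CD.bilin_tens]) (use assms in \<open>auto intro: star_hom_lin_map\<close>)
  show "tensor_map C D f g \<in> star_hom (tensor_algebra A B) (tensor_algebra C D)"
    unfolding tensor_map_def
    by (rule AB.tensor_lift_star_hom[OF CD.AB.unital_star_algebra_axioms bil])
      (simp_all add: f g CD.tens_mult CD.tens_star CD.tens_one)
  show "tensor_map C D f g (tens A B a b) = tens C D (f a) (g b)"
    if "a \<in> carrier A" "b \<in> carrier B" for a b
    unfolding tensor_map_def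
    by (rule AB.tensor_lift_tens[OF CD.AB.unital_star_algebra_axioms bil that])
qed

section \<open>Monotone closures\<close>

text \<open>\<open>chain_sup\<close> says that \<infinity> contributes no gap: a member of the chain
  above all finite c_N is the identity. This admits both strictly increasing chains and the chain of
  the scalars, which is constant from index 1 on.\<close>

locale mono_star_algebra = unital_star_algebra D
  for D :: "('a, 'm) mono_algebra_scheme" (structure) +
  assumes level_subalgebra: "star_subalgebra D (level D m)"
    and chain_closed [simp]: "chain D i \<in> carrier D"
    and chain_mult: "chain D i \<otimes> chain D j = chain D (min i j)"
    and chain_star: "star D (chain D i) = chain D i"
    and chain_zero: "chain D 0 = \<zero>"
    and chain_top: "chain D \<infinity> = \<one>"
    and chain_sup: "(\<And>N. chain D (enat N) \<otimes> chain D j = chain D (enat N)) \<Longrightarrow> chain D j = \<one>"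
begin

abbreviation "c N \<equiv> chain D (enat N)"
abbreviation "P \<equiv> range (chain D)"

lemma P_closed [simp]: "e \<in> P \<Longrightarrow> e \<in> carrier D"
  by auto

lemma P_mult: "\<lbrakk>e \<in> P; f \<in> P\<rbrakk> \<Longrightarrow> e \<otimes> f \<in> P"
  by (auto simp: chain_mult)

lemma P_comm: "\<lbrakk>e \<in> P; f \<in> P\<rbrakk> \<Longrightarrow> e \<otimes> f = f \<otimes> e"
  by (auto simp: chain_mult min.commute)

lemma P_idem: "e \<in> P \<Longrightarrow> e \<otimes> e = e"
  by (auto simp: chain_mult)

lemma P_one: "\<one> \<in> P"
  by (metis chain_top rangeI)

lemma c_in_P [simp]: "c N \<in> P"
  by simp

text \<open>
  If the chain reaches \<open>\<one>\<close> at a finite index, as that of \<^const>\<open>complex_mono\<close> does, an MSDD avoiding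
  \<open>\<one>\<close> would be bounded by the projection preceding the first such index.
\<close>

lemma msdd_cofinal:
  assumes "msdd D e" shows "\<forall>\<^sub>F m in sequentially. c N \<otimes> e m = c N"
proof -
  have e: "\<And>m. m \<ge> 1 \<Longrightarrow> e m \<in> P" "\<And>m n. \<lbrakk>1 \<le> m; m \<le> n\<rbrakk> \<Longrightarrow> e m \<otimes> e n = e m"
    and sup: "\<And>j. (\<And>m. m \<ge> 1 \<Longrightarrow> e m \<otimes> chain D j = e m) \<Longrightarrow> chain D j = \<one>"
    using assms by (auto simp: msdd_def proj_le_def)
  have "\<exists>m\<ge>1. c N \<otimes> e m = c N"
  proof (rule ccontr)
    assume neg: "\<not> ?thesis"
    \<comment> \<open>The chain is totally ordered, so an \<open>e m\<close> that does not dominate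
      \<open>c N\<close> lies below it.\<close>
    have le: "e m \<otimes> c M = e m" if "m \<ge> 1" "c M = \<one> \<or> M = N" for m M
    proof (cases "c M = \<one>")
      case True thus ?thesis using e(1)[OF that(1)] by simp
    next
      case False
      obtain i where i: "e m = chain D i" using e(1)[OF \<open>m \<ge> 1\<close>] by auto
      have "c N \<otimes> e m \<noteq> c N" using neg that by auto
      thus ?thesis using that False
        by (auto simp: i chain_mult min_def split: if_splits)
    qed
    have "c N = \<one>" by (rule sup) (use le in auto)
    define M where "M = (LEAST M. c M = \<one>)"
    have M: "c M = \<one>" unfolding M_def by (rule LeastI[of _ N]) fact
    have least: "c K \<noteq> \<one>" if "K < M" for K using not_less_Least that unfolding M_def by blast
    show False
    proof (cases M)
      case 0
      hence "\<one> = \<zero>" using M chain_zero by (simp add: zero_enat_def)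
      moreover have "e 1 = \<one> \<otimes> e 1" using e(1)[of 1] by simp
      ultimately have "c N \<otimes> e 1 = c N" using e(1)[of 1] \<open>c N = \<one>\<close> by auto
      thus False using neg by auto
    next
      case (Suc K)
      have "e m \<otimes> c K = e m" if "m \<ge> 1" for m
      proof -
        obtain i where i: "e m = chain D i" using e(1)[OF \<open>m \<ge> 1\<close>] by auto
        have "\<not> enat M \<le> i"
        proof
          assume "enat M \<le> i"
          hence "c M \<otimes> e m = c M" by (simp add: i chain_mult min_def)
          hence "e m = \<one>" using M e(1)[OF that] by simp
          hence "c N \<otimes> e m = c N" by simp
          thus False using neg that by auto
        qed
        hence "i \<le> enat K" using Suc by (cases i) auto
        thus ?thesis by (simp add: i chain_mult min_def)
      qed
      hence "c K = \<one>" by (rule sup)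
      thus False using least[of K] Suc by simp
    qed
  qed
  then obtain m where m: "m \<ge> 1" "c N \<otimes> e m = c N" by auto
  have "c N \<otimes> e n = c N" if "n \<ge> m" for n
  proof -
    have "c N \<otimes> e n = c N \<otimes> (e m \<otimes> e n)"
      using m that e(1)[of m] e(1)[of n] by (simp add: m_assoc[symmetric])
    thus ?thesis using m that e(2)[of m n] by simp
  qed
  thus ?thesis by (auto simp: eventually_sequentially)
qed

text \<open>Converse of the cofinality statement: a bound h of all \<open>e m\<close> also dominates
  every \<open>c N\<close>, because \<open>c N\<close> lies below some \<open>e m\<close>; then
  \<open>chain_sup\<close> gives h = 1.\<close>

lemma msddI:
  assumes "\<And>m. m \<ge> 1 \<Longrightarrow> e m \<in> P" "\<And>m n. \<lbrakk>1 \<le> m; m \<le> n\<rbrakk> \<Longrightarrow> e m \<otimes> e n = e m"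
    "\<And>N. \<forall>\<^sub>F m in sequentially. c N \<otimes> e m = c N"
  shows "msdd D e"
  unfolding msdd_def proj_le_def
proof (intro conjI allI impI ballI)
  fix h assume h: "h \<in> P" "\<forall>m\<ge>1. e m \<otimes> h = e m"
  then obtain j where j: "h = chain D j" by auto
  have "c N \<otimes> h = c N" for N
  proof -
    have "\<forall>\<^sub>F m in sequentially. m \<ge> 1 \<and> c N \<otimes> e m = c N"
      using assms(3)[of N] eventually_ge_at_top[of 1] by eventually_elim auto
    then obtain m where m: "m \<ge> 1" "c N \<otimes> e m = c N"
      using eventually_happens by force
    have "c N \<otimes> h = c N \<otimes> (e m \<otimes> h)"
      using m assms(1)[of m] h(1) by (simp add: m_assoc[symmetric])
    thus ?thesis using m h by simp
  qed
  hence "h = \<one>" unfolding j by (rule chain_sup)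
  thus "\<one> \<otimes> h = \<one>" by simp
qed (use assms in auto)

lemma msddD:
  assumes "msdd D e"
  shows "m \<ge> 1 \<Longrightarrow> e m \<in> P" "\<lbrakk>1 \<le> m; m \<le> n\<rbrakk> \<Longrightarrow> e m \<otimes> e n = e m"
  using assms by (auto simp: msdd_def proj_le_def)

text \<open>Through cofinality, the claim that the meets still have supremum 1 becomes the
  conjunction of two eventual conditions for each N.\<close>

lemma msdd_mult:
  assumes e: "msdd D e" and f: "msdd D f" shows "msdd D (\<lambda>m. e m \<otimes> f m)"
proof (rule msddI)
  fix m n :: nat assume mn: "1 \<le> m" "m \<le> n"
  note P = msddD(1)[OF e, of m] msddD(1)[OF f, of m] msddD(1)[OF e, of n] msddD(1)[OF f, of n]
  have "(e m \<otimes> f m) \<otimes> (e n \<otimes> f n) = e m \<otimes> (f m \<otimes> e n) \<otimes> f n"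
    using P mn by (simp add: m_assoc)
  also have "f m \<otimes> e n = e n \<otimes> f m" using P mn by (simp add: P_comm)
  also have "e m \<otimes> (e n \<otimes> f m) \<otimes> f n = (e m \<otimes> e n) \<otimes> (f m \<otimes> f n)"
    using P mn by (simp add: m_assoc)
  finally show "(e m \<otimes> f m) \<otimes> (e n \<otimes> f n) = e m \<otimes> f m"
    using mn by (simp add: msddD(2)[OF e] msddD(2)[OF f])
next
  fix N
  show "\<forall>\<^sub>F m in sequentially. c N \<otimes> (e m \<otimes> f m) = c N"
    using msdd_cofinal[OF e, of N] msdd_cofinal[OF f, of N] eventually_ge_at_top[of 1]
  proof eventually_elim
    case (elim m)
    thus ?case
      using msddD(1)[OF e, of m] msddD(1)[OF f, of m] by (simp add: m_assoc[symmetric])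
  qed
qed (use msddD(1)[OF e] msddD(1)[OF f] P_mult in auto)

lemma msdd_c: "msdd D c"
proof (rule msddI)
  fix N
  show "\<forall>\<^sub>F m in sequentially. c N \<otimes> c m = c N"
    using eventually_ge_at_top[of N] by eventually_elim (simp add: chain_mult min_def)
qed (auto simp: chain_mult min_def)

lemma msdd_one: "msdd D (\<lambda>_. \<one>)"
  by (rule msddI) (auto simp: P_one)

lemma owmcI:
  assumes "\<And>m. m \<ge> 1 \<Longrightarrow> x m \<in> level D m" "msdd D e"
    "\<And>m n. \<lbrakk>1 \<le> m; m < n\<rbrakk> \<Longrightarrow> x n \<otimes> e m = x m \<otimes> e m"
    "\<And>m n. \<lbrakk>1 \<le> m; m < n\<rbrakk> \<Longrightarrow> star D (x n) \<otimes> e m = star D (x m) \<otimes> e m"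
  shows "(x, e) \<in> owmc D"
  using assms by (auto simp: owmc_def)

lemma owmcD:
  assumes "(x, e) \<in> owmc D"
  shows "m \<ge> 1 \<Longrightarrow> x m \<in> level D m" "m \<ge> 1 \<Longrightarrow> x m \<in> carrier D" "msdd D e"
    "m \<ge> 1 \<Longrightarrow> e m \<in> P"
    "\<lbrakk>1 \<le> m; m \<le> n\<rbrakk> \<Longrightarrow> x n \<otimes> e m = x m \<otimes> e m"
    "\<lbrakk>1 \<le> m; m \<le> n\<rbrakk> \<Longrightarrow> star D (x n) \<otimes> e m = star D (x m) \<otimes> e m"
proof -
  show 1: "m \<ge> 1 \<Longrightarrow> x m \<in> level D m" "msdd D e" for m using assms by (auto simp: owmc_def)
  show "m \<ge> 1 \<Longrightarrow> x m \<in> carrier D" using 1(1)[of m] star_subalgebraD(1)[OF level_subalgebra] by auto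
  show "m \<ge> 1 \<Longrightarrow> e m \<in> P" using msddD(1)[OF 1(2)] .
  show "\<lbrakk>1 \<le> m; m \<le> n\<rbrakk> \<Longrightarrow> x n \<otimes> e m = x m \<otimes> e m"
    "\<lbrakk>1 \<le> m; m \<le> n\<rbrakk> \<Longrightarrow> star D (x n) \<otimes> e m = star D (x m) \<otimes> e m"
    using assms by (cases "m = n"; auto simp: owmc_def)+
qed

lemma owmc_star:
  assumes "(x, e) \<in> owmc D" shows "(\<lambda>m. star D (x m), e) \<in> owmc D"
proof (rule owmcI)
  fix m n :: nat assume mn: "1 \<le> m" "m < n"
  show "star D (x n) \<otimes> e m = star D (x m) \<otimes> e m" using owmcD(6)[OF assms, of m n] mn by simp
  show "star D (star D (x n)) \<otimes> e m = star D (star D (x m)) \<otimes> e m"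
    using owmcD(5)[OF assms, of m n] owmcD(2)[OF assms, of m] owmcD(2)[OF assms, of n] mn by simp
qed (use owmcD(1,3)[OF assms] star_subalgebraD(7)[OF level_subalgebra] in auto)

text \<open>Stability on \<open>e m\<close> extends to anything whose range lies under
  \<open>e m\<close>. In a product the role of h is played by elements such as y_m c_N, which are
  not projections.\<close>

lemma owmc_stable:
  assumes x: "(x, e) \<in> owmc D" and mn: "1 \<le> m" "m \<le> n" and h: "h \<in> carrier D" "e m \<otimes> h = h"
  shows "x n \<otimes> h = x m \<otimes> h"
proof -
  have C: "x n \<in> carrier D" "x m \<in> carrier D" "e m \<in> carrier D"
    using owmcD(2)[OF x] owmcD(4)[OF x mn(1)] mn by auto
  have "x n \<otimes> h = (x n \<otimes> e m) \<otimes> h" using C h by (simp add: m_assoc)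
  also have "\<dots> = x m \<otimes> h" unfolding owmcD(5)[OF x mn] using C h by (simp add: m_assoc)
  finally show ?thesis .
qed

section \<open>Equality of classes through finite truncations\<close>

definition seq_eq :: "(nat \<Rightarrow> 'a) \<Rightarrow> (nat \<Rightarrow> 'a) \<Rightarrow> bool" where
  "seq_eq x y \<longleftrightarrow> (\<forall>N. \<forall>\<^sub>F m in sequentially.
     x m \<otimes> c N = y m \<otimes> c N \<and> star D (x m) \<otimes> c N = star D (y m) \<otimes> c N)"

lemma seq_eqD:
  assumes "seq_eq x y"
  shows "\<forall>\<^sub>F m in sequentially. x m \<otimes> c N = y m \<otimes> c N"
    "\<forall>\<^sub>F m in sequentially. star D (x m) \<otimes> c N = star D (y m) \<otimes> c N"
  using assms by (auto simp: seq_eq_def eventually_conj_iff)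

lemma seq_eqI:
  assumes "\<And>m. m \<ge> 1 \<Longrightarrow> x m = y m" shows "seq_eq x y"
  unfolding seq_eq_def
  by (intro allI eventually_mono[OF eventually_ge_at_top[of 1]]) (simp add: assms)

lemma seq_eq_sym: "seq_eq x y \<Longrightarrow> seq_eq y x"
  by (simp add: seq_eq_def eq_commute)

lemma seq_eq_trans:
  assumes "seq_eq x y" "seq_eq y z" shows "seq_eq x z"
  unfolding seq_eq_def
proof
  fix N
  show "\<forall>\<^sub>F m in sequentially. x m \<otimes> c N = z m \<otimes> c N \<and> star D (x m) \<otimes> c N = star D (z m) \<otimes> c N"
    using seq_eqD[OF assms(1), of N] seq_eqD[OF assms(2), of N] by eventually_elim simp
qed

text \<open>From some index on \<open>g m\<close> dominates \<open>c N\<close>; multiplying the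
  equation on \<open>g m\<close> by \<open>c N\<close> then gives the truncated equation.\<close>

lemma msdd_imp_c:
  assumes g: "msdd D g" and x: "\<And>m. m \<ge> 1 \<Longrightarrow> x m \<in> carrier D \<and> y m \<in> carrier D"
    and eq: "\<And>m. m \<ge> 1 \<Longrightarrow> x m \<otimes> g m = y m \<otimes> g m"
  shows "\<forall>\<^sub>F m in sequentially. x m \<otimes> c N = y m \<otimes> c N"
  using msdd_cofinal[OF g, of N] eventually_ge_at_top[of 1]
proof eventually_elim
  case (elim m)
  have gm: "g m \<in> P" using msddD(1)[OF g] elim by simp
  have c: "c N = g m \<otimes> c N" using elim P_comm[OF gm, of "c N"] by simp
  have "x m \<otimes> c N = (x m \<otimes> g m) \<otimes> c N"
    using x[of m] gm elim c by (simp add: m_assoc)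
  also have "\<dots> = y m \<otimes> c N"
    using x[of m] gm elim c eq by (simp add: m_assoc)
  finally show ?case .
qed

text \<open>The hypothesis speaks about large n, the conclusion about the index m. Below e_m and f_m
  both sequences are frozen from m on, so x_m and y_m may be replaced there by x_n and y_n, and
  these agree below c_m.\<close>

lemma c_imp_msdd:
  assumes x: "(x, e) \<in> owmc D" and y: "(y, f) \<in> owmc D" and m: "m \<ge> 1"
    and ev: "\<forall>\<^sub>F n in sequentially. x n \<otimes> c m = y n \<otimes> c m"
  shows "x m \<otimes> (e m \<otimes> f m \<otimes> c m) = y m \<otimes> (e m \<otimes> f m \<otimes> c m)"
proof -
  let ?g = "e m \<otimes> f m \<otimes> c m"
  note ef = owmcD(4)[OF x m] owmcD(4)[OF y m]
  have g: "?g \<in> P" using ef by (intro P_mult) auto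
  obtain i j where ij: "e m = chain D i" "f m = chain D j" using ef by auto
  have eg: "e m \<otimes> ?g = ?g" and fg: "f m \<otimes> ?g = ?g" and cg: "c m \<otimes> ?g = ?g"
    by (simp_all add: ij chain_mult ac_simps)
  have "\<forall>\<^sub>F n in sequentially. x n \<otimes> c m = y n \<otimes> c m \<and> n \<ge> m"
    using ev eventually_ge_at_top[of m] by eventually_elim simp
  then obtain n where n: "x n \<otimes> c m = y n \<otimes> c m" "n \<ge> m" using eventually_happens by force
  have xy: "x n \<in> carrier D" "y n \<in> carrier D" "?g \<in> carrier D"
    using owmcD(2)[OF x] owmcD(2)[OF y] n m g by auto
  have "x m \<otimes> ?g = x n \<otimes> ?g" using owmc_stable[OF x m n(2) xy(3) eg] by simp
  also have "\<dots> = (x n \<otimes> c m) \<otimes> ?g" using xy cg by (simp add: m_assoc[OF xy(1) _ xy(3)])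
  also have "\<dots> = y n \<otimes> ?g" using n xy cg by (simp add: m_assoc[OF xy(2) _ xy(3)])
  also have "\<dots> = y m \<otimes> ?g" by (rule owmc_stable[OF y m n(2) xy(3) fg])
  finally show ?thesis .
qed

lemma owmc_equiv_iff:
  "((x, e), (y, f)) \<in> owmc_equiv D \<longleftrightarrow> (x, e) \<in> owmc D \<and> (y, f) \<in> owmc D \<and> seq_eq x y"
proof
  assume l: "((x, e), (y, f)) \<in> owmc_equiv D"
  then obtain g where g: "msdd D g" "\<And>m. m \<ge> 1 \<Longrightarrow> x m \<otimes> g m = y m \<otimes> g m"
     "\<And>m. m \<ge> 1 \<Longrightarrow> star D (x m) \<otimes> g m = star D (y m) \<otimes> g m"
    and xy: "(x, e) \<in> owmc D" "(y, f) \<in> owmc D" by (auto simp: owmc_equiv_def)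
  have "seq_eq x y"
    unfolding seq_eq_def eventually_conj_iff
    using msdd_imp_c[OF g(1) _ g(2)] msdd_imp_c[OF g(1) _ g(3)] owmcD(2)[OF xy(1)] owmcD(2)[OF xy(2)]
    by blast
  thus "(x, e) \<in> owmc D \<and> (y, f) \<in> owmc D \<and> seq_eq x y" using xy by simp
next
  assume r: "(x, e) \<in> owmc D \<and> (y, f) \<in> owmc D \<and> seq_eq x y"
  hence x: "(x, e) \<in> owmc D" and y: "(y, f) \<in> owmc D" and eq: "seq_eq x y" by auto
  \<comment> \<open>Agreement is known on each fixed truncation only after an index depending on the
    truncation. The factor \<open>c m\<close> selects the truncation N = m, while \<open>e m\<close>
    and \<open>f m\<close> carry the agreement back to index m.\<close>
  have "msdd D (\<lambda>m. e m \<otimes> f m \<otimes> c m)"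
    by (intro msdd_mult msdd_c owmcD(3)[OF x] owmcD(3)[OF y])
  moreover have "x m \<otimes> (e m \<otimes> f m \<otimes> c m) = y m \<otimes> (e m \<otimes> f m \<otimes> c m)" if "m \<ge> 1" for m
    by (rule c_imp_msdd[OF x y that seq_eqD(1)[OF eq]])
  moreover have "star D (x m) \<otimes> (e m \<otimes> f m \<otimes> c m) = star D (y m) \<otimes> (e m \<otimes> f m \<otimes> c m)"
    if "m \<ge> 1" for m
    by (rule c_imp_msdd[OF owmc_star[OF x] owmc_star[OF y] that seq_eqD(2)[OF eq]])
  ultimately have "\<exists>g. msdd D g \<and> (\<forall>m\<ge>1. x m \<otimes> g m = y m \<otimes> g m \<and>
      star D (x m) \<otimes> g m = star D (y m) \<otimes> g m)"
    by (intro exI[of _ "\<lambda>m. e m \<otimes> f m \<otimes> c m"]) auto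
  thus "((x, e), (y, f)) \<in> owmc_equiv D" using x y by (simp add: owmc_equiv_def)
qed

lemma equiv_owmc: "equiv (owmc D) (owmc_equiv D)"
proof (rule equivI)
  show "owmc_equiv D \<subseteq> owmc D \<times> owmc D" by (auto simp: owmc_equiv_iff)
  show "refl_on (owmc D) (owmc_equiv D)" by (auto simp: refl_on_def owmc_equiv_iff seq_eqI)
  show "sym (owmc_equiv D)" by (auto simp: sym_def owmc_equiv_iff seq_eq_sym)
  show "trans (owmc_equiv D)" by (auto simp: trans_def owmc_equiv_iff intro: seq_eq_trans)
qed

lemma mem_mco_class:
  "(y, f) \<in> mco_class D x e \<longleftrightarrow> (x, e) \<in> owmc D \<and> (y, f) \<in> owmc D \<and> seq_eq x y"
  by (simp add: mco_class_def owmc_equiv_iff)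

lemma mco_class_eq:
  "\<lbrakk>(x, e) \<in> owmc D; (y, f) \<in> owmc D\<rbrakk> \<Longrightarrow> mco_class D x e = mco_class D y f \<longleftrightarrow> seq_eq x y"
  unfolding mco_class_def using eq_equiv_class_iff[OF equiv_owmc] by (simp add: owmc_equiv_iff)

lemma mco_class_cong:
  "\<lbrakk>(x, e) \<in> owmc D; (y, f) \<in> owmc D; \<And>m. m \<ge> 1 \<Longrightarrow> x m = y m\<rbrakk>
     \<Longrightarrow> mco_class D x e = mco_class D y f"
  by (simp add: mco_class_eq seq_eqI)

lemma mclosure_carrier: "carrier (mclosure D) = {mco_class D x e | x e. (x, e) \<in> owmc D}"
  by (force simp: mclosure_def quotient_def mco_class_def)

text \<open>A union of a constant family over a nonempty class collapses to the constant.
  Well-definedness of every operation on classes is reduced in this way to compatibility with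
  \<open>seq_eq\<close>.\<close>

lemma UN_mco_class:
  assumes "(x, e) \<in> owmc D" "\<And>y f. \<lbrakk>(y, f) \<in> owmc D; seq_eq x y\<rbrakk> \<Longrightarrow> F y f = C"
  shows "(\<Union>(y, f)\<in>mco_class D x e. F y f) = C"
proof -
  have "(x, e) \<in> mco_class D x e" using assms(1) by (simp add: mem_mco_class seq_eqI)
  moreover have "F y f = C" if "(y, f) \<in> mco_class D x e" for y f
    using that assms(2) by (simp add: mem_mco_class)
  ultimately show ?thesis by fastforce
qed

end

section \<open>Lifting homomorphisms to classes\<close>

definition mono_hom ::
  "('a, 'm) mono_algebra_scheme \<Rightarrow> ('b, 'n) mono_algebra_scheme \<Rightarrow> ('a \<Rightarrow> 'b) set" where
  "mono_hom D E = {f \<in> star_hom D E. (\<forall>m. f ` level D m \<subseteq> level E m) \<and>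
     (\<forall>i. f (chain D i) = chain E i)}"

lemma mono_homD:
  assumes "f \<in> mono_hom D E"
  shows "f \<in> star_hom D E" "x \<in> level D m \<Longrightarrow> f x \<in> level E m" "f (chain D i) = chain E i"
  using assms by (auto simp: mono_hom_def)

locale mono_pair = D: mono_star_algebra D + E: mono_star_algebra E
  for D :: "('a, 'm) mono_algebra_scheme" and E :: "('b, 'n) mono_algebra_scheme"
begin

text \<open>A homomorphism need not respect suprema. Cofinality is an equation c_N e_m = c_N between
  chain elements, and such an equation is transported by \<open>f\<close>.\<close>

lemma mono_hom_msdd:
  assumes f: "f \<in> mono_hom D E" and e: "msdd D e" shows "msdd E (f \<circ> e)"
proof (rule E.msddI)
  note h = star_homD[OF mono_homD(1)[OF f]]
  note c = mono_homD(3)[OF f]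
  show "(f \<circ> e) m \<in> E.P" if "m \<ge> 1" for m
    using D.msddD(1)[OF e that] c by auto
  show "(f \<circ> e) m \<otimes>\<^bsub>E\<^esub> (f \<circ> e) n = (f \<circ> e) m" if "1 \<le> m" "m \<le> n" for m n
    using D.msddD(2)[OF e that] D.msddD(1)[OF e, of m] D.msddD(1)[OF e, of n] that
    by (simp add: h(2)[symmetric])
  show "\<forall>\<^sub>F m in sequentially. E.c N \<otimes>\<^bsub>E\<^esub> (f \<circ> e) m = E.c N" for N
    using D.msdd_cofinal[OF e, of N] eventually_ge_at_top[of 1]
  proof eventually_elim
    case (elim m)
    have "E.c N \<otimes>\<^bsub>E\<^esub> (f \<circ> e) m = f (D.c N \<otimes>\<^bsub>D\<^esub> e m)"
      using D.msddD(1)[OF e elim(2)] by (simp add: h(2) c)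
    thus ?case using elim c by simp
  qed
qed

lemma mono_hom_owmc:
  assumes f: "f \<in> mono_hom D E" and x: "(x, e) \<in> owmc D" shows "(f \<circ> x, f \<circ> e) \<in> owmc E"
proof (rule E.owmcI)
  note h = star_homD[OF mono_homD(1)[OF f]]
  note c = mono_homD(3)[OF f]
  show "msdd E (f \<circ> e)" by (rule mono_hom_msdd[OF f D.owmcD(3)[OF x]])
  show "(f \<circ> x) m \<in> level E m" if "m \<ge> 1" for m
    using mono_homD(2)[OF f] D.owmcD(1)[OF x that] by simp
  fix m n :: nat assume mn: "1 \<le> m" "m < n"
  note cl = D.owmcD(2,4)[OF x, of m] D.owmcD(2)[OF x, of n]
  show "(f \<circ> x) n \<otimes>\<^bsub>E\<^esub> (f \<circ> e) m = (f \<circ> x) m \<otimes>\<^bsub>E\<^esub> (f \<circ> e) m"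
    using mn cl D.owmcD(5)[OF x, of m n] by (simp add: h(2)[symmetric])
  show "star E ((f \<circ> x) n) \<otimes>\<^bsub>E\<^esub> (f \<circ> e) m = star E ((f \<circ> x) m) \<otimes>\<^bsub>E\<^esub> (f \<circ> e) m"
    using mn cl D.owmcD(6)[OF x, of m n] by (simp add: h(2)[symmetric] h(6)[symmetric])
qed

lemma mono_hom_seq_eq:
  assumes f: "f \<in> mono_hom D E" and x: "(x, e) \<in> owmc D" and y: "(y, e') \<in> owmc D"
    and eq: "D.seq_eq x y"
  shows "E.seq_eq (f \<circ> x) (f \<circ> y)"
  unfolding E.seq_eq_def
proof
  note h = star_homD[OF mono_homD(1)[OF f]]
  note c = mono_homD(3)[OF f, symmetric]
  fix N
  show "\<forall>\<^sub>F m in sequentially. (f \<circ> x) m \<otimes>\<^bsub>E\<^esub> E.c N = (f \<circ> y) m \<otimes>\<^bsub>E\<^esub> E.c N \<and>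
      star E ((f \<circ> x) m) \<otimes>\<^bsub>E\<^esub> E.c N = star E ((f \<circ> y) m) \<otimes>\<^bsub>E\<^esub> E.c N"
    using D.seq_eqD[OF eq, of N] eventually_ge_at_top[of 1]
  proof eventually_elim
    case (elim m)
    thus ?case using D.owmcD(2)[OF x, of m] D.owmcD(2)[OF y, of m]
      by (simp add: h(2)[symmetric] h(6)[symmetric] c)
  qed
qed

lemma mlift_mco_class:
  assumes f: "f \<in> mono_hom D E" and x: "(x, e) \<in> owmc D"
  shows "mlift E f (mco_class D x e) = mco_class E (f \<circ> x) (f \<circ> e)"
  unfolding mlift_def
proof (rule D.UN_mco_class[OF x])
  fix y e' assume y: "(y, e') \<in> owmc D" "D.seq_eq x y"
  show "mco_class E (f \<circ> y) (f \<circ> e') = mco_class E (f \<circ> x) (f \<circ> e)"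
    using mono_hom_seq_eq[OF f x y] mono_hom_owmc[OF f x] mono_hom_owmc[OF f y(1)]
    by (simp add: E.mco_class_eq E.seq_eq_sym)
qed

lemma mono_hom_well_defined: "f \<in> mono_hom D E \<Longrightarrow> mlift_well_defined D E f"
  unfolding mlift_well_defined_def using mono_hom_owmc mlift_mco_class by fastforce

end

section \<open>Products of operators with monotone closure\<close>

locale closable_algebra = mono_star_algebra D for D :: "('a, 'm) mono_algebra_scheme" (structure) +
  assumes faithful: "\<lbrakk>x \<in> carrier D; \<And>N. x \<otimes> c N = \<zero>\<rbrakk> \<Longrightarrow> x = \<zero>"
    and approx: "x \<in> carrier D \<Longrightarrow> \<exists>K. c K \<otimes> (x \<otimes> c N) = x \<otimes> c N"
begin

text \<open>The indices i with e x c_i = x c_i form a down-set S. If S contains all finite indices,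
  faithfulness applied to e x - x gives e x = x and the identity is the largest solution. Otherwise
  S is a nonempty finite initial segment, 0 being in it because c_0 = 0, and its maximum gives the
  answer.\<close>

lemma largest_preimage:
  assumes x: "x \<in> carrier D" and e: "e \<in> P"
  shows "\<exists>g\<in>P. e \<otimes> x \<otimes> g = x \<otimes> g \<and> (\<forall>h\<in>P. e \<otimes> x \<otimes> h = x \<otimes> h \<longrightarrow> h \<otimes> g = h)"
proof -
  define S where "S = {i. e \<otimes> x \<otimes> chain D i = x \<otimes> chain D i}"
  have ec: "e \<in> carrier D" using e by simp
  show ?thesis
  proof (cases "\<forall>N. enat N \<in> S")
    case True
    have "e \<otimes> x \<ominus> x = \<zero>"
    proof (rule faithful)
      fix N
      have "(e \<otimes> x \<ominus> x) \<otimes> c N = e \<otimes> x \<otimes> c N \<ominus> x \<otimes> c N"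
        using x ec by (simp add: minus_eq l_distr l_minus)
      thus "(e \<otimes> x \<ominus> x) \<otimes> c N = \<zero>" using True x by (simp add: S_def minus_eq r_neg)
    qed (use x ec in simp)
    hence "e \<otimes> x = x" using x ec by simp
    hence "e \<otimes> x \<otimes> \<one> = x \<otimes> \<one>" by simp
    thus ?thesis using P_one by (intro bexI[of _ \<one>]) auto
  next
    case False
    then obtain N where N: "enat N \<notin> S" by auto
    have down: "i \<in> S" if "j \<in> S" "i \<le> j" for i j
    proof -
      have i: "chain D i = chain D j \<otimes> chain D i" using that by (simp add: chain_mult min_def)
      have "e \<otimes> x \<otimes> chain D i = (e \<otimes> x \<otimes> chain D j) \<otimes> chain D i"
        using i x ec by (simp add: m_assoc)
      also have "\<dots> = x \<otimes> (chain D j \<otimes> chain D i)" using that x by (simp add: S_def m_assoc)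
      finally show ?thesis using i by (simp add: S_def)
    qed
    have bound: "i < enat N" if "i \<in> S" for i using down[OF that, of "enat N"] N by force
    have "finite {n. enat n \<in> S}"
      by (rule finite_subset[of _ "{..N}"]) (use bound in force)+
    moreover have "0 \<in> {n. enat n \<in> S}"
      using x ec chain_zero by (simp add: S_def zero_enat_def)
    ultimately have k: "enat (Max {n. enat n \<in> S}) \<in> S" "\<And>n. enat n \<in> S \<Longrightarrow> n \<le> Max {n. enat n \<in> S}"
      using Max_in[of "{n. enat n \<in> S}"] by auto
    define k where "k = Max {n. enat n \<in> S}"
    show ?thesis
    proof (intro bexI[of _ "c k"] conjI ballI impI)
      show "e \<otimes> x \<otimes> c k = x \<otimes> c k" using k by (simp add: S_def k_def)
      fix h assume h: "h \<in> P" "e \<otimes> x \<otimes> h = x \<otimes> h"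
      then obtain j where j: "h = chain D j" by auto
      hence jS: "j \<in> S" using h by (simp add: S_def)
      then obtain n where n: "j = enat n" using bound[of j] by (cases j) auto
      show "h \<otimes> c k = h" using k(2)[of n] jS n by (simp add: j chain_mult k_def min_def)
    qed simp
  qed
qed

text \<open>Members of the chain commute, so two largest solutions, each below the other, are equal;
  this makes the \<open>THE\<close> in the definition meaningful.\<close>

lemma proj_preimage:
  assumes x: "x \<in> carrier D" and e: "e \<in> P"
  shows "proj_preimage D x e \<in> P" (is "?g \<in> P")
    "e \<otimes> x \<otimes> proj_preimage D x e = x \<otimes> proj_preimage D x e"
    "\<lbrakk>h \<in> P; e \<otimes> x \<otimes> h = x \<otimes> h\<rbrakk> \<Longrightarrow> h \<otimes> proj_preimage D x e = h"
proof -
  let ?ok = "\<lambda>g. g \<in> P \<and> e \<otimes> x \<otimes> g = x \<otimes> g"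
  obtain g where g: "?ok g" "\<And>h. ?ok h \<Longrightarrow> h \<otimes> g = h"
    using largest_preimage[OF x e] by blast
  have "\<exists>!g. ?ok g \<and> (\<forall>h. ?ok h \<longrightarrow> proj_le D h g)"
  proof (rule ex1I[of _ g])
    show "?ok g \<and> (\<forall>h. ?ok h \<longrightarrow> proj_le D h g)" using g by (auto simp: proj_le_def)
    fix g' assume g': "?ok g' \<and> (\<forall>h. ?ok h \<longrightarrow> proj_le D h g')"
    hence "g' \<otimes> g = g'" "g \<otimes> g' = g" using g by (auto simp: proj_le_def)
    thus "g' = g" using P_comm[of g g'] g g' by simp
  qed
  from theI'[OF this] have "?ok ?g \<and> (\<forall>h. ?ok h \<longrightarrow> proj_le D h ?g)"
    unfolding proj_preimage_def Let_def .
  thus "?g \<in> P" "e \<otimes> x \<otimes> ?g = x \<otimes> ?g" "\<lbrakk>h \<in> P; e \<otimes> x \<otimes> h = x \<otimes> h\<rbrakk> \<Longrightarrow> h \<otimes> ?g = h"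
    by (auto simp: proj_le_def)
qed

text \<open>One half of the domain of a product: below g_m the factor y is frozen and y_m maps into
  the range of e_m, where x is frozen. Since \<open>g\<close> only involves the pair in this order,
  the half governing the adjoint arises by applying the lemma to the adjoint sequences in reverse
  order.\<close>

lemma domain_piece:
  assumes x: "(x, e) \<in> owmc D" and y: "(y, f) \<in> owmc D"
  assumes g_def: "g = (\<lambda>m. f m \<otimes> proj_preimage D (y m) (e m))"
  shows "msdd D g" "m \<ge> 1 \<Longrightarrow> f m \<otimes> g m = g m" "m \<ge> 1 \<Longrightarrow> e m \<otimes> (y m \<otimes> g m) = y m \<otimes> g m"
proof -
  let ?p = "\<lambda>m. proj_preimage D (y m) (e m)"
  have p: "?p m \<in> P" "e m \<otimes> y m \<otimes> ?p m = y m \<otimes> ?p m"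
    "\<And>h. \<lbrakk>h \<in> P; e m \<otimes> y m \<otimes> h = y m \<otimes> h\<rbrakk> \<Longrightarrow> h \<otimes> ?p m = h" if "m \<ge> 1" for m
    using proj_preimage[OF owmcD(2)[OF y that] owmcD(4)[OF x that]] by auto
  have cl: "y m \<in> carrier D" "e m \<in> P" "f m \<in> P" "e m \<in> carrier D" "f m \<in> carrier D"
    "?p m \<in> carrier D" if "m \<ge> 1" for m
    using owmcD(2)[OF y that] owmcD(4)[OF x that] owmcD(4)[OF y that] p(1)[OF that] by auto
  have gP: "g m \<in> P" if "m \<ge> 1" for m unfolding g_def using cl p that by (intro P_mult) auto
  show fg: "f m \<otimes> g m = g m" if "m \<ge> 1" for m
    using cl[OF that] by (simp add: g_def m_assoc[symmetric] P_idem)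
  show eg: "e m \<otimes> (y m \<otimes> g m) = y m \<otimes> g m" if "m \<ge> 1" for m
  proof -
    have g: "g m = ?p m \<otimes> f m" unfolding g_def using cl[OF that] p[OF that] by (simp add: P_comm)
    have "e m \<otimes> (y m \<otimes> g m) = (e m \<otimes> y m \<otimes> ?p m) \<otimes> f m"
      unfolding g using cl[OF that] by (simp add: m_assoc)
    thus ?thesis unfolding p(2)[OF that] g using cl[OF that] by (simp add: m_assoc)
  qed
  show "msdd D g"
  proof (rule msddI)
    fix m n :: nat assume mn: "1 \<le> m" "m \<le> n"
    hence n: "n \<ge> 1" by simp
    note C = cl[OF mn(1)] cl[OF n] gP[OF mn(1)] P_closed[OF gP[OF mn(1)]]
    \<comment> \<open>Monotonicity: \<open>g m\<close> solves the equation that defines the preimage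
      at n, since \<open>y n\<close> agrees with \<open>y m\<close> on it and \<open>e n\<close>
      dominates \<open>e m\<close>. Maximality puts it below that preimage.\<close>
    have "y n \<otimes> g m = y m \<otimes> g m" using owmc_stable[OF y mn _ fg] C mn by simp
    moreover have "e n \<otimes> (y m \<otimes> g m) = y m \<otimes> g m"
    proof -
      have "e n \<otimes> e m = e m" using msddD(2)[OF owmcD(3)[OF x] mn] P_comm[of "e n" "e m"] C by simp
      moreover have "e n \<otimes> (e m \<otimes> (y m \<otimes> g m)) = (e n \<otimes> e m) \<otimes> (y m \<otimes> g m)"
        using C by (simp add: m_assoc)
      ultimately show ?thesis using eg[OF mn(1)] by simp
    qed
    ultimately have "e n \<otimes> y n \<otimes> g m = y n \<otimes> g m" using C by (simp add: m_assoc)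
    hence 1: "g m \<otimes> ?p n = g m" using p(3)[OF n gP[OF mn(1)]] by simp
    have "f n \<otimes> f m = f m" using msddD(2)[OF owmcD(3)[OF y] mn] P_comm[of "f n" "f m"] C by simp
    moreover have "f n \<otimes> (f m \<otimes> g m) = (f n \<otimes> f m) \<otimes> g m" using C by (simp add: m_assoc)
    ultimately have "f n \<otimes> g m = g m" using fg[OF mn(1)] by simp
    hence 2: "g m \<otimes> f n = g m" using P_comm[of "g m" "f n"] C by simp
    have "g n = f n \<otimes> ?p n" by (simp add: g_def)
    thus "g m \<otimes> g n = g m"
      using C 1 2 m_assoc[of "g m" "f n" "?p n"] by simp
  next
    fix N
    \<comment> \<open>Cofinality: from \<open>m0\<close> on, y_m c_N is one fixed element. Its range
      lies below some c_K with K independent of m, and \<open>e m\<close> eventually dominates that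
      c_K.\<close>
    have "\<forall>\<^sub>F m in sequentially. c N \<otimes> f m = c N \<and> m \<ge> 1"
      using msdd_cofinal[OF owmcD(3)[OF y], of N] eventually_ge_at_top[of 1] by eventually_elim simp
    then obtain m0 where m0: "c N \<otimes> f m0 = c N" "m0 \<ge> 1" using eventually_happens by force
    obtain K where K: "c K \<otimes> (y m0 \<otimes> c N) = y m0 \<otimes> c N" using approx[OF cl(1)[OF m0(2)]] by blast
    show "\<forall>\<^sub>F m in sequentially. c N \<otimes> g m = c N"
      using msdd_cofinal[OF owmcD(3)[OF y], of N] msdd_cofinal[OF owmcD(3)[OF x], of K]
        eventually_ge_at_top[of m0]
    proof eventually_elim
      case (elim m)
      hence m: "m \<ge> 1" using m0 by simp
      note C = cl[OF m] cl[OF m0(2)]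
      have "y m \<otimes> c N = y m0 \<otimes> c N"
        using owmc_stable[OF y m0(2) elim(3), of "c N"] m0 P_comm[of "f m0" "c N"] C by simp
      moreover have "e m \<otimes> (y m0 \<otimes> c N) = y m0 \<otimes> c N"
      proof -
        have "e m \<otimes> c K = c K" using elim P_comm[of "e m" "c K"] C by simp
        moreover have "e m \<otimes> (c K \<otimes> (y m0 \<otimes> c N)) = (e m \<otimes> c K) \<otimes> (y m0 \<otimes> c N)"
          using C by (simp add: m_assoc)
        ultimately show ?thesis using K by simp
      qed
      ultimately have "e m \<otimes> y m \<otimes> c N = y m \<otimes> c N" using C by (simp add: m_assoc)
      hence "c N \<otimes> ?p m = c N" using p(3)[OF m] by simp
      thus ?case using elim C m_assoc[of "c N" "f m" "?p m"] by (simp add: g_def)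
    qed
  qed (rule gP)
qed

text \<open>Two freezings in succession: y is frozen on h because h lies under f_m, and x is frozen
  on y_m h because y_m h lies under e_m.\<close>

lemma prod_stable:
  assumes x: "(x, e) \<in> owmc D" and y: "(y, f) \<in> owmc D" and mn: "1 \<le> m" "m \<le> n"
    and h: "h \<in> carrier D" "f m \<otimes> h = h" "e m \<otimes> (y m \<otimes> h) = y m \<otimes> h"
  shows "x n \<otimes> y n \<otimes> h = x m \<otimes> y m \<otimes> h"
proof -
  have C: "x n \<in> carrier D" "x m \<in> carrier D" "y m \<in> carrier D" "y n \<in> carrier D"
    using owmcD(2)[OF x] owmcD(2)[OF y] mn by auto
  have "x n \<otimes> y n \<otimes> h = x n \<otimes> (y m \<otimes> h)"
    using owmc_stable[OF y mn h(1,2)] C h(1) by (simp add: m_assoc)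
  also have "\<dots> = x m \<otimes> (y m \<otimes> h)"
    by (rule owmc_stable[OF x mn _ h(3)]) (use C h in simp)
  finally show ?thesis using C h by (simp add: m_assoc)
qed

text \<open>The four factors of \<open>mult_domain\<close> regroup into two domain pieces. The piece
  g makes the products x_m y_m stable, the piece g' makes their adjoints stable, and everything
  remains true on the meet.\<close>

lemma owmc_mult:
  assumes x: "(x, e) \<in> owmc D" and y: "(y, f) \<in> owmc D"
  shows "(\<lambda>m. x m \<otimes> y m, mult_domain D (x, e) (y, f)) \<in> owmc D"
proof -
  note x' = owmc_star[OF x] and y' = owmc_star[OF y]
  define g where "g = (\<lambda>m. f m \<otimes> proj_preimage D (y m) (e m))"
  define g' where "g' = (\<lambda>m. e m \<otimes> proj_preimage D (star D (x m)) (f m))"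
  note G = domain_piece[OF x y g_def] and G' = domain_piece[OF y' x' g'_def]
  have PP: "g m \<in> P" "g' m \<in> P" if "m \<ge> 1" for m
    using msddD(1)[OF G(1) that] msddD(1)[OF G'(1) that] .
  have k: "mult_domain D (x, e) (y, f) m = g m \<otimes> g' m" if "m \<ge> 1" for m
    unfolding mult_domain_def g_def g'_def
    using owmcD(2,4)[OF x that] owmcD(2,4)[OF y that] that
      proj_preimage(1)[OF owmcD(2)[OF y that] owmcD(4)[OF x that]]
      proj_preimage(1)[OF owmcD(2)[OF x' that] owmcD(4)[OF y that]]
    by (simp add: m_assoc)
  have sub: "f m \<otimes> (g m \<otimes> g' m) = g m \<otimes> g' m" "e m \<otimes> (g m \<otimes> g' m) = g m \<otimes> g' m"
    "e m \<otimes> (y m \<otimes> (g m \<otimes> g' m)) = y m \<otimes> (g m \<otimes> g' m)"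
    "f m \<otimes> (star D (x m) \<otimes> (g m \<otimes> g' m)) = star D (x m) \<otimes> (g m \<otimes> g' m)" if "m \<ge> 1" for m
  proof -
    note C = owmcD(2,4)[OF x that] owmcD(2,4)[OF y that] PP[OF that]
      owmcD(4)[OF x that, THEN P_closed] owmcD(4)[OF y that, THEN P_closed] PP[OF that, THEN P_closed]
    have comm: "g m \<otimes> g' m = g' m \<otimes> g m" using C by (simp add: P_comm)
    show "f m \<otimes> (g m \<otimes> g' m) = g m \<otimes> g' m" using C G(2)[OF that] by (simp add: m_assoc[symmetric])
    show "e m \<otimes> (g m \<otimes> g' m) = g m \<otimes> g' m"
      unfolding comm using C G'(2)[OF that] by (simp add: m_assoc[symmetric])
    have "e m \<otimes> (y m \<otimes> g m) \<otimes> g' m = y m \<otimes> g m \<otimes> g' m" using G(3)[OF that] by simp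
    thus "e m \<otimes> (y m \<otimes> (g m \<otimes> g' m)) = y m \<otimes> (g m \<otimes> g' m)" using C by (simp add: m_assoc)
    have "f m \<otimes> (star D (x m) \<otimes> g' m) \<otimes> g m = star D (x m) \<otimes> g' m \<otimes> g m"
      using G'(3)[OF that] by simp
    thus "f m \<otimes> (star D (x m) \<otimes> (g m \<otimes> g' m)) = star D (x m) \<otimes> (g m \<otimes> g' m)"
      unfolding comm using C by (simp add: m_assoc)
  qed
  show ?thesis
  proof (rule owmcI)
    fix m :: nat assume "m \<ge> 1"
    thus "x m \<otimes> y m \<in> level D m"
      using owmcD(1)[OF x] owmcD(1)[OF y] star_subalgebraD(5)[OF level_subalgebra] by auto
  next
    have "msdd D (\<lambda>m. g m \<otimes> g' m)" by (rule msdd_mult[OF G(1) G'(1)])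
    thus "msdd D (mult_domain D (x, e) (y, f))" by (simp add: msdd_def k)
  next
    fix m n :: nat assume mn: "1 \<le> m" "m < n"
    have h: "g m \<otimes> g' m \<in> carrier D" using PP[OF mn(1)] by simp
    show "x n \<otimes> y n \<otimes> mult_domain D (x, e) (y, f) m = x m \<otimes> y m \<otimes> mult_domain D (x, e) (y, f) m"
      unfolding k[OF mn(1)]
      by (rule prod_stable[OF x y mn(1) _ h]) (use mn sub in auto)
    have "star D (y n) \<otimes> star D (x n) \<otimes> (g m \<otimes> g' m) = star D (y m) \<otimes> star D (x m) \<otimes> (g m \<otimes> g' m)"
      by (rule prod_stable[OF y' x' mn(1) _ h]) (use mn sub in auto)
    thus "star D (x n \<otimes> y n) \<otimes> mult_domain D (x, e) (y, f) m =
        star D (x m \<otimes> y m) \<otimes> mult_domain D (x, e) (y, f) m"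
      unfolding k[OF mn(1)] using mn owmcD(2)[OF x] owmcD(2)[OF y] by (simp add: star_mult)
  qed
qed

text \<open>Agreement of x with x' on truncations can be used only behind a truncation, while in x_m
  y_m c_N it stands behind y_m. The approximation property inserts c_K between the two; K depends on
  N alone, because y_m c_N is constant from \<open>m0\<close> on.\<close>

lemma seq_mult_ev:
  assumes x: "(x, e) \<in> owmc D" "(x', e') \<in> owmc D" and y: "(y, f) \<in> owmc D" "(y', f') \<in> owmc D"
    and xe: "\<And>N. \<forall>\<^sub>F m in sequentially. x m \<otimes> c N = x' m \<otimes> c N"
    and ye: "\<And>N. \<forall>\<^sub>F m in sequentially. y m \<otimes> c N = y' m \<otimes> c N"
  shows "\<forall>\<^sub>F m in sequentially. x m \<otimes> y m \<otimes> c N = x' m \<otimes> y' m \<otimes> c N"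
proof -
  have "\<forall>\<^sub>F m in sequentially. c N \<otimes> f m = c N \<and> m \<ge> 1"
    using msdd_cofinal[OF owmcD(3)[OF y(1)], of N] eventually_ge_at_top[of 1] by eventually_elim simp
  then obtain m0 where m0: "c N \<otimes> f m0 = c N" "m0 \<ge> 1" using eventually_happens by force
  have m0c: "y m0 \<in> carrier D" using owmcD(2)[OF y(1) m0(2)] .
  obtain K where K: "c K \<otimes> (y m0 \<otimes> c N) = y m0 \<otimes> c N" using approx[OF m0c] by blast
  show ?thesis
    using xe[of K] ye[of N] eventually_ge_at_top[of m0]
  proof eventually_elim
    case (elim m)
    hence m: "m \<ge> 1" using m0 by simp
    have C: "x m \<in> carrier D" "x' m \<in> carrier D" "y m \<in> carrier D" "y' m \<in> carrier D"
      using m owmcD(2)[OF x(1)] owmcD(2)[OF x(2)] owmcD(2)[OF y(1)] owmcD(2)[OF y(2)] by auto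
    have y0: "y m \<otimes> c N = y m0 \<otimes> c N"
      using owmc_stable[OF y(1) m0(2) elim(3), of "c N"] m0 P_comm[of "f m0" "c N"]
        owmcD(4)[OF y(1) m0(2)] by simp
    have "x m \<otimes> y m \<otimes> c N = x m \<otimes> (c K \<otimes> (y m0 \<otimes> c N))" using C y0 K by (simp add: m_assoc)
    also have "\<dots> = (x m \<otimes> c K) \<otimes> (y m0 \<otimes> c N)" using C m0c by (simp add: m_assoc)
    also have "\<dots> = x' m \<otimes> (c K \<otimes> (y m0 \<otimes> c N))" using C m0c elim by (simp add: m_assoc)
    also have "\<dots> = x' m \<otimes> y' m \<otimes> c N" using C K y0 elim by (simp add: m_assoc)
    finally show ?case .
  qed
qed

lemma seq_eq_mult:
  assumes x: "(x, e) \<in> owmc D" "(x', e') \<in> owmc D" and y: "(y, f) \<in> owmc D" "(y', f') \<in> owmc D"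
    and xe: "seq_eq x x'" and ye: "seq_eq y y'"
  shows "seq_eq (\<lambda>m. x m \<otimes> y m) (\<lambda>m. x' m \<otimes> y' m)"
  unfolding seq_eq_def
proof
  fix N
  show "\<forall>\<^sub>F m in sequentially. x m \<otimes> y m \<otimes> c N = x' m \<otimes> y' m \<otimes> c N \<and>
      star D (x m \<otimes> y m) \<otimes> c N = star D (x' m \<otimes> y' m) \<otimes> c N"
    using seq_mult_ev[OF x y seq_eqD(1)[OF xe] seq_eqD(1)[OF ye], of N]
      seq_mult_ev[OF owmc_star[OF y(1)] owmc_star[OF y(2)] owmc_star[OF x(1)] owmc_star[OF x(2)]
        seq_eqD(2)[OF ye] seq_eqD(2)[OF xe], of N] eventually_ge_at_top[of 1]
  proof eventually_elim
    case (elim m)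
    thus ?case using owmcD(2)[OF x(1)] owmcD(2)[OF x(2)] owmcD(2)[OF y(1)] owmcD(2)[OF y(2)]
      by (simp add: star_mult)
  qed
qed

lemma seq_eq_add:
  assumes x: "(x, e) \<in> owmc D" "(x', e') \<in> owmc D" and y: "(y, f) \<in> owmc D" "(y', f') \<in> owmc D"
    and xe: "seq_eq x x'" and ye: "seq_eq y y'"
  shows "seq_eq (\<lambda>m. x m \<oplus> y m) (\<lambda>m. x' m \<oplus> y' m)"
  unfolding seq_eq_def
proof
  fix N
  show "\<forall>\<^sub>F m in sequentially. (x m \<oplus> y m) \<otimes> c N = (x' m \<oplus> y' m) \<otimes> c N \<and>
      star D (x m \<oplus> y m) \<otimes> c N = star D (x' m \<oplus> y' m) \<otimes> c N"
    using seq_eqD[OF xe, of N] seq_eqD[OF ye, of N] eventually_ge_at_top[of 1]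
  proof eventually_elim
    case (elim m)
    thus ?case using owmcD(2)[OF x(1)] owmcD(2)[OF x(2)] owmcD(2)[OF y(1)] owmcD(2)[OF y(2)]
      by (simp add: star_add l_distr)
  qed
qed

lemma seq_eq_scale:
  assumes x: "(x, e) \<in> owmc D" "(x', e') \<in> owmc D" and xe: "seq_eq x x'"
  shows "seq_eq (\<lambda>m. a \<odot> x m) (\<lambda>m. a \<odot> x' m)"
  unfolding seq_eq_def
proof
  fix N
  show "\<forall>\<^sub>F m in sequentially. a \<odot> x m \<otimes> c N = a \<odot> x' m \<otimes> c N \<and>
      star D (a \<odot> x m) \<otimes> c N = star D (a \<odot> x' m) \<otimes> c N"
    using seq_eqD[OF xe, of N] eventually_ge_at_top[of 1]
  proof eventually_elim
    case (elim m)
    thus ?case using owmcD(2)[OF x(1)] owmcD(2)[OF x(2)]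
      by (simp add: star_smult smult_mult_left)
  qed
qed

lemma seq_eq_star:
  assumes x: "(x, e) \<in> owmc D" "(x', e') \<in> owmc D" and xe: "seq_eq x x'"
  shows "seq_eq (\<lambda>m. star D (x m)) (\<lambda>m. star D (x' m))"
  unfolding seq_eq_def
proof
  fix N
  show "\<forall>\<^sub>F m in sequentially. star D (x m) \<otimes> c N = star D (x' m) \<otimes> c N \<and>
      star D (star D (x m)) \<otimes> c N = star D (star D (x' m)) \<otimes> c N"
    using seq_eqD[OF xe, of N] eventually_ge_at_top[of 1]
  proof eventually_elim
    case (elim m)
    thus ?case using owmcD(2)[OF x(1)] owmcD(2)[OF x(2)] by simp
  qed
qed

section \<open>The algebra of classes\<close>

lemma owmc_add:
  assumes x: "(x, e) \<in> owmc D" and y: "(y, f) \<in> owmc D"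
  shows "(\<lambda>m. x m \<oplus> y m, \<lambda>m. e m \<otimes> f m) \<in> owmc D"
proof -
  have stable: "(x n \<oplus> y n) \<otimes> (e m \<otimes> f m) = (x m \<oplus> y m) \<otimes> (e m \<otimes> f m)"
    if x: "(x, e) \<in> owmc D" and y: "(y, f) \<in> owmc D" and mn: "1 \<le> m" "m < n" for x y m n
  proof -
    have C: "x n \<in> carrier D" "x m \<in> carrier D" "y m \<in> carrier D" "y n \<in> carrier D" "e m \<in> P" "f m \<in> P"
      using owmcD(2,4)[OF x] owmcD(2,4)[OF y] mn by auto
    have "e m \<otimes> (e m \<otimes> f m) = e m \<otimes> f m" using C P_idem[of "e m"] by (simp add: m_assoc[symmetric])
    moreover have "f m \<otimes> (e m \<otimes> f m) = e m \<otimes> f m"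
      using C P_idem[of "f m"] P_comm[of "e m" "f m"] by (simp add: m_assoc[symmetric])
    ultimately show ?thesis
      using owmc_stable[OF x mn(1), of n "e m \<otimes> f m"] owmc_stable[OF y mn(1), of n "e m \<otimes> f m"] C mn
      by (simp add: l_distr)
  qed
  show ?thesis
  proof (rule owmcI)
    show "msdd D (\<lambda>m. e m \<otimes> f m)" by (rule msdd_mult[OF owmcD(3)[OF x] owmcD(3)[OF y]])
    fix m :: nat assume m: "m \<ge> 1"
    show "x m \<oplus> y m \<in> level D m"
      using owmcD(1)[OF x m] owmcD(1)[OF y m] star_subalgebraD(4)[OF level_subalgebra] by auto
    fix n :: nat assume n: "m < n"
    show "(x n \<oplus> y n) \<otimes> (e m \<otimes> f m) = (x m \<oplus> y m) \<otimes> (e m \<otimes> f m)" by (rule stable[OF x y m n])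
    show "star D (x n \<oplus> y n) \<otimes> (e m \<otimes> f m) = star D (x m \<oplus> y m) \<otimes> (e m \<otimes> f m)"
      using stable[OF owmc_star[OF x] owmc_star[OF y] m n] owmcD(2)[OF x] owmcD(2)[OF y] m n
      by (simp add: star_add)
  qed
qed

lemma owmc_scale:
  assumes x: "(x, e) \<in> owmc D" shows "(\<lambda>m. a \<odot> x m, e) \<in> owmc D"
proof (rule owmcI)
  fix m n :: nat assume mn: "1 \<le> m" "m < n"
  show "a \<odot> x n \<otimes> e m = a \<odot> x m \<otimes> e m" "star D (a \<odot> x n) \<otimes> e m = star D (a \<odot> x m) \<otimes> e m"
    using owmcD(2)[OF x, of n] owmcD(2,4)[OF x, of m] owmcD(5,6)[OF x, of m n] mn
    by (simp_all add: smult_mult_left star_smult)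
qed (use owmcD[OF x] star_subalgebraD(6)[OF level_subalgebra] in auto)

lemma owmc_const: "x \<in> {\<zero>, \<one>} \<Longrightarrow> (\<lambda>_. x, \<lambda>_. \<one>) \<in> owmc D"
  using star_subalgebraD(2,3)[OF level_subalgebra] by (intro owmcI msdd_one) auto

lemma mclosure_ops:
  assumes x: "(x, e) \<in> owmc D"
  shows "star (mclosure D) (mco_class D x e) = mco_class D (\<lambda>m. star D (x m)) e"
    "a \<odot>\<^bsub>mclosure D\<^esub> mco_class D x e = mco_class D (\<lambda>m. a \<odot> x m) e"
    "(y, f) \<in> owmc D \<Longrightarrow> mco_class D x e \<oplus>\<^bsub>mclosure D\<^esub> mco_class D y f =
       mco_class D (\<lambda>m. x m \<oplus> y m) (\<lambda>m. e m \<otimes> f m)"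
    "(y, f) \<in> owmc D \<Longrightarrow> mco_class D x e \<otimes>\<^bsub>mclosure D\<^esub> mco_class D y f =
       mco_class D (\<lambda>m. x m \<otimes> y m) (mult_domain D (x, e) (y, f))"
proof -
  show "star (mclosure D) (mco_class D x e) = mco_class D (\<lambda>m. star D (x m)) e"
    unfolding mclosure_def star_algebra.simps
    by (intro UN_mco_class x) (simp add: mco_class_eq owmc_star x seq_eq_star[OF _ x] seq_eq_sym)
  show "a \<odot>\<^bsub>mclosure D\<^esub> mco_class D x e = mco_class D (\<lambda>m. a \<odot> x m) e"
    unfolding mclosure_def module.simps
    by (intro UN_mco_class x) (simp add: mco_class_eq owmc_scale x seq_eq_scale[OF _ x] seq_eq_sym)
  assume y: "(y, f) \<in> owmc D"
  show "mco_class D x e \<oplus>\<^bsub>mclosure D\<^esub> mco_class D y f =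
      mco_class D (\<lambda>m. x m \<oplus> y m) (\<lambda>m. e m \<otimes> f m)"
    unfolding mclosure_def ring.simps
    by (intro UN_mco_class x y)
      (simp add: mco_class_eq owmc_add x y seq_eq_add[OF _ x _ y] seq_eq_sym)
  show "mco_class D x e \<otimes>\<^bsub>mclosure D\<^esub> mco_class D y f =
      mco_class D (\<lambda>m. x m \<otimes> y m) (mult_domain D (x, e) (y, f))"
    unfolding mclosure_def monoid.simps
    by (intro UN_mco_class x y)
      (simp add: mco_class_eq owmc_mult x y seq_eq_mult[OF _ x _ y] seq_eq_sym)
qed

lemma mclosure_consts:
  "\<one>\<^bsub>mclosure D\<^esub> = mco_class D (\<lambda>_. \<one>) (\<lambda>_. \<one>)" "\<zero>\<^bsub>mclosure D\<^esub> = mco_class D (\<lambda>_. \<zero>) (\<lambda>_. \<one>)"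
  by (simp_all add: mclosure_def)

lemma mco_class_closed: "(x, e) \<in> owmc D \<Longrightarrow> mco_class D x e \<in> carrier (mclosure D)"
  by (auto simp: mclosure_carrier)

text \<open>In most laws the two sides are represented with different domains, for instance in
  associativity and distributivity. Once both sides are operators with monotone closure,
  \<open>mco_class_cong\<close> asks only for equality of the terms, and this is the corresponding
  law of \<open>D\<close>.\<close>

lemma unital_star_algebra_mclosure: "unital_star_algebra (mclosure D)"
proof -
  note ops = mclosure_ops mclosure_consts owmc_add owmc_mult owmc_scale owmc_star owmc_const
    mco_class_closed
  note cl = owmcD(2)
  show ?thesis
  proof (rule unital_star_algebraI)
    fix U V assume "U \<in> carrier (mclosure D)" "V \<in> carrier (mclosure D)"
    then obtain x e y f where U: "U = mco_class D x e" "V = mco_class D y f"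
      and x: "(x, e) \<in> owmc D" and y: "(y, f) \<in> owmc D" by (auto simp: mclosure_carrier)
    show "U \<oplus>\<^bsub>mclosure D\<^esub> V \<in> carrier (mclosure D)" "U \<otimes>\<^bsub>mclosure D\<^esub> V \<in> carrier (mclosure D)"
      unfolding U by (simp_all add: ops x y)
    show "U \<oplus>\<^bsub>mclosure D\<^esub> V = V \<oplus>\<^bsub>mclosure D\<^esub> U"
      unfolding U by (simp add: ops x y)
        (intro mco_class_cong owmc_add x y, simp add: cl[OF x] cl[OF y] a_comm)
    show "star (mclosure D) (U \<oplus>\<^bsub>mclosure D\<^esub> V) = star (mclosure D) U \<oplus>\<^bsub>mclosure D\<^esub> star (mclosure D) V"
      unfolding U by (simp add: ops x y)
        (intro mco_class_cong owmc_add owmc_star x y, simp add: cl[OF x] cl[OF y] star_add)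
    show "star (mclosure D) (U \<otimes>\<^bsub>mclosure D\<^esub> V) = star (mclosure D) V \<otimes>\<^bsub>mclosure D\<^esub> star (mclosure D) U"
      unfolding U by (simp add: ops x y)
        (intro mco_class_cong owmc_mult owmc_star x y, simp add: cl[OF x] cl[OF y] star_mult)
    fix a
    show "a \<odot>\<^bsub>mclosure D\<^esub> (U \<oplus>\<^bsub>mclosure D\<^esub> V) = a \<odot>\<^bsub>mclosure D\<^esub> U \<oplus>\<^bsub>mclosure D\<^esub> a \<odot>\<^bsub>mclosure D\<^esub> V"
      unfolding U by (simp add: ops x y)
        (intro mco_class_cong owmc_add owmc_scale x y, simp add: cl[OF x] cl[OF y] scale_add_right)
    show "(a \<odot>\<^bsub>mclosure D\<^esub> U) \<otimes>\<^bsub>mclosure D\<^esub> V = a \<odot>\<^bsub>mclosure D\<^esub> (U \<otimes>\<^bsub>mclosure D\<^esub> V)"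
      unfolding U by (simp add: ops x y)
        (intro mco_class_cong owmc_mult owmc_scale x y, simp add: cl[OF x] cl[OF y] smult_mult_left)
    show "U \<otimes>\<^bsub>mclosure D\<^esub> (a \<odot>\<^bsub>mclosure D\<^esub> V) = a \<odot>\<^bsub>mclosure D\<^esub> (U \<otimes>\<^bsub>mclosure D\<^esub> V)"
      unfolding U by (simp add: ops x y)
        (intro mco_class_cong owmc_mult owmc_scale x y, simp add: cl[OF x] cl[OF y] smult_mult_right)
    fix W assume "W \<in> carrier (mclosure D)"
    then obtain z g where W: "W = mco_class D z g" and z: "(z, g) \<in> owmc D"
      by (auto simp: mclosure_carrier)
    show "(U \<oplus>\<^bsub>mclosure D\<^esub> V) \<oplus>\<^bsub>mclosure D\<^esub> W = U \<oplus>\<^bsub>mclosure D\<^esub> (V \<oplus>\<^bsub>mclosure D\<^esub> W)"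
      unfolding U W by (simp add: ops x y z)
        (intro mco_class_cong owmc_add x y z, simp add: cl[OF x] cl[OF y] cl[OF z] a_assoc)
    show "(U \<otimes>\<^bsub>mclosure D\<^esub> V) \<otimes>\<^bsub>mclosure D\<^esub> W = U \<otimes>\<^bsub>mclosure D\<^esub> (V \<otimes>\<^bsub>mclosure D\<^esub> W)"
      unfolding U W by (simp add: ops x y z)
        (intro mco_class_cong owmc_mult x y z, simp add: cl[OF x] cl[OF y] cl[OF z] m_assoc)
    show "(U \<oplus>\<^bsub>mclosure D\<^esub> V) \<otimes>\<^bsub>mclosure D\<^esub> W = U \<otimes>\<^bsub>mclosure D\<^esub> W \<oplus>\<^bsub>mclosure D\<^esub> V \<otimes>\<^bsub>mclosure D\<^esub> W"
      unfolding U W by (simp add: ops x y z)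
        (intro mco_class_cong owmc_add owmc_mult x y z, simp add: cl[OF x] cl[OF y] cl[OF z] l_distr)
    show "W \<otimes>\<^bsub>mclosure D\<^esub> (U \<oplus>\<^bsub>mclosure D\<^esub> V) = W \<otimes>\<^bsub>mclosure D\<^esub> U \<oplus>\<^bsub>mclosure D\<^esub> W \<otimes>\<^bsub>mclosure D\<^esub> V"
      unfolding U W by (simp add: ops x y z)
        (intro mco_class_cong owmc_add owmc_mult x y z, simp add: cl[OF x] cl[OF y] cl[OF z] r_distr)
  next
    fix U assume "U \<in> carrier (mclosure D)"
    then obtain x e where U: "U = mco_class D x e" and x: "(x, e) \<in> owmc D"
      by (auto simp: mclosure_carrier)
    have o: "(\<lambda>_. \<zero>, \<lambda>_. \<one>) \<in> owmc D" "(\<lambda>_. \<one>, \<lambda>_. \<one>) \<in> owmc D" by (simp_all add: owmc_const)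
    show "\<zero>\<^bsub>mclosure D\<^esub> \<oplus>\<^bsub>mclosure D\<^esub> U = U"
      unfolding U by (simp add: ops x) (intro mco_class_cong owmc_add o x, simp add: cl[OF x])
    show "\<one>\<^bsub>mclosure D\<^esub> \<otimes>\<^bsub>mclosure D\<^esub> U = U"
      unfolding U by (simp add: ops x) (intro mco_class_cong owmc_mult o x, simp add: cl[OF x])
    show "U \<otimes>\<^bsub>mclosure D\<^esub> \<one>\<^bsub>mclosure D\<^esub> = U"
      unfolding U by (simp add: ops x) (intro mco_class_cong owmc_mult o x, simp add: cl[OF x])
    show "star (mclosure D) U \<in> carrier (mclosure D)" unfolding U by (simp add: ops x)
    show "star (mclosure D) (star (mclosure D) U) = U"
      unfolding U by (simp add: ops x) (intro mco_class_cong owmc_star x, simp add: cl[OF x])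
    show "1 \<odot>\<^bsub>mclosure D\<^esub> U = U"
      unfolding U by (simp add: ops x) (intro mco_class_cong owmc_scale x, simp add: cl[OF x])
    show "0 \<odot>\<^bsub>mclosure D\<^esub> U = \<zero>\<^bsub>mclosure D\<^esub>"
      unfolding U by (simp add: ops x) (intro mco_class_cong owmc_scale o x, simp add: cl[OF x])
    fix a b
    show "a \<odot>\<^bsub>mclosure D\<^esub> U \<in> carrier (mclosure D)" unfolding U by (simp add: ops x)
    show "(a + b) \<odot>\<^bsub>mclosure D\<^esub> U = a \<odot>\<^bsub>mclosure D\<^esub> U \<oplus>\<^bsub>mclosure D\<^esub> b \<odot>\<^bsub>mclosure D\<^esub> U"
      unfolding U by (simp add: ops x)
        (intro mco_class_cong owmc_add owmc_scale x, simp add: cl[OF x] scale_add_left)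
    show "(a * b) \<odot>\<^bsub>mclosure D\<^esub> U = a \<odot>\<^bsub>mclosure D\<^esub> (b \<odot>\<^bsub>mclosure D\<^esub> U)"
      unfolding U by (simp add: ops x)
        (intro mco_class_cong owmc_scale x, simp add: cl[OF x] scale_scale)
    show "star (mclosure D) (a \<odot>\<^bsub>mclosure D\<^esub> U) = cnj a \<odot>\<^bsub>mclosure D\<^esub> star (mclosure D) U"
      unfolding U by (simp add: ops x)
        (intro mco_class_cong owmc_scale owmc_star x, simp add: cl[OF x] star_smult)
  qed (simp_all add: ops)
qed

end

locale closable_pair = D: closable_algebra D + E: closable_algebra E
  for D :: "('a, 'm) mono_algebra_scheme" and E :: "('b, 'n) mono_algebra_scheme"
begin

sublocale mono_pair D E ..

text \<open>A homomorphism need not carry a largest preimage projection to a largest preimage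
  projection, so the domain of a product is in general not mapped to the domain of the product of
  the images. Multiplicativity is read off from the terms.\<close>

lemma mlift_star_hom:
  assumes f: "f \<in> mono_hom D E"
  shows "mlift E f \<in> star_hom (mclosure D) (mclosure E)"
proof -
  note h = star_homD[OF mono_homD(1)[OF f]]
  note m = mlift_mco_class[OF f] and o = mono_hom_owmc[OF f]
  note opsD = D.mclosure_ops D.mclosure_consts D.owmc_add D.owmc_mult D.owmc_scale D.owmc_star D.owmc_const
  note opsE = E.mclosure_ops E.mclosure_consts E.mco_class_closed
  note cl = D.owmcD(2)
  show ?thesis
  proof (rule star_homI)
    fix U V assume "U \<in> carrier (mclosure D)" "V \<in> carrier (mclosure D)"
    then obtain x e y e' where U: "U = mco_class D x e" "V = mco_class D y e'"
      and x: "(x, e) \<in> owmc D" and y: "(y, e') \<in> owmc D" by (auto simp: D.mclosure_carrier)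
    show "mlift E f (U \<otimes>\<^bsub>mclosure D\<^esub> V) = mlift E f U \<otimes>\<^bsub>mclosure E\<^esub> mlift E f V"
      unfolding U using o[OF D.owmc_mult[OF x y]] E.owmc_mult[OF o[OF x] o[OF y]]
      by (simp add: opsD x y m opsE o E.mco_class_eq)
        (intro E.seq_eqI, simp add: h cl[OF x] cl[OF y])
    show "mlift E f (U \<oplus>\<^bsub>mclosure D\<^esub> V) = mlift E f U \<oplus>\<^bsub>mclosure E\<^esub> mlift E f V"
      unfolding U using o[OF D.owmc_add[OF x y]] E.owmc_add[OF o[OF x] o[OF y]]
      by (simp add: opsD x y m opsE o E.mco_class_eq)
        (intro E.seq_eqI, simp add: h cl[OF x] cl[OF y])
  next
    fix U a assume "U \<in> carrier (mclosure D)"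
    then obtain x e where U: "U = mco_class D x e"
      and x: "(x, e) \<in> owmc D" by (auto simp: D.mclosure_carrier)
    show "mlift E f U \<in> carrier (mclosure E)" unfolding U by (simp add: m x opsE o)
    show "mlift E f (a \<odot>\<^bsub>mclosure D\<^esub> U) = a \<odot>\<^bsub>mclosure E\<^esub> mlift E f U"
      unfolding U using o[OF D.owmc_scale[OF x]] E.owmc_scale[OF o[OF x]]
      by (simp add: opsD x m opsE o E.mco_class_eq) (intro E.seq_eqI, simp add: h cl[OF x])
    show "mlift E f (star (mclosure D) U) = star (mclosure E) (mlift E f U)"
      unfolding U using o[OF D.owmc_star[OF x]] E.owmc_star[OF o[OF x]]
      by (simp add: opsD x m opsE o E.mco_class_eq) (intro E.seq_eqI, simp add: h cl[OF x])
  next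
    have one: "(\<lambda>_. \<one>\<^bsub>D\<^esub>, \<lambda>_. \<one>\<^bsub>D\<^esub>) \<in> owmc D" by (simp add: D.owmc_const)
    have "f \<circ> (\<lambda>_::nat. \<one>\<^bsub>D\<^esub>) = (\<lambda>_. \<one>\<^bsub>E\<^esub>)" using h(4) by auto
    thus "mlift E f \<one>\<^bsub>mclosure D\<^esub> = \<one>\<^bsub>mclosure E\<^esub>"
      using m[OF one] by (simp add: opsD opsE)
  qed
qed

end

section \<open>Monotone tensor products\<close>

lemma mtensor_simps:
  "carrier (D \<boxtimes> E) = carrier (tensor_algebra D E)" "mult (D \<boxtimes> E) = mult (tensor_algebra D E)"
  "one (D \<boxtimes> E) = one (tensor_algebra D E)" "zero (D \<boxtimes> E) = zero (tensor_algebra D E)"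
  "add (D \<boxtimes> E) = add (tensor_algebra D E)" "smult (D \<boxtimes> E) = smult (tensor_algebra D E)"
  "star (D \<boxtimes> E) = star (tensor_algebra D E)"
  "level (D \<boxtimes> E) m =
     lin_span (tensor_algebra D E) {tens D E a b | a b. a \<in> level D m \<and> b \<in> level E m}"
  "chain (D \<boxtimes> E) i = tens D E (chain D i) (chain E i)"
  by (simp_all add: mtensor_def star_algebra.extend_def mono_algebra.fields_def)

lemma star_hom_mtensor:
  "star_hom (D \<boxtimes> E) F = star_hom (tensor_algebra D E) F"
  "star_hom F (D \<boxtimes> E) = star_hom F (tensor_algebra D E)"
  by (simp_all add: star_hom_def ring_hom_def mtensor_simps)

lemma lin_map_mtensor:
  "lin_map (D \<boxtimes> E) F = lin_map (tensor_algebra D E) F"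
  "lin_map F' (D \<boxtimes> E) = lin_map F' (tensor_algebra D E)"
  by (simp_all add: lin_map_def mtensor_simps fun_eq_iff)

lemma unital_star_algebra_mtensor:
  assumes "unital_star_algebra D" "unital_star_algebra E"
  shows "unital_star_algebra (D \<boxtimes> E)"
proof -
  interpret tensor_pair D E using assms by (rule tensor_pairI)
  have "id \<in> star_hom AB (D \<boxtimes> E)"
    by (rule star_homI) (simp_all add: mtensor_simps)
  thus ?thesis
    by (rule unital_star_algebra_image[OF unital_star_algebra_tensor, rotated]) (simp_all add: mtensor_simps)
qed

text \<open>The levels of a tensor product are spans of elementary tensors; this reduces level
  preservation to those generators.\<close>

lemma lin_map_image_lin_span:
  assumes "unital_star_algebra A" "unital_star_algebra B" "lin_map A B f" "X \<subseteq> carrier A"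
    "submodule V complex_algebra B" "\<And>x. x \<in> X \<Longrightarrow> f x \<in> V"
  shows "f ` lin_span A X \<subseteq> V"
proof -
  interpret A: unital_star_algebra A by fact
  interpret B: unital_star_algebra B by fact
  note f = lin_mapD[OF assms(3)]
  have "lin_span A X \<subseteq> {x \<in> carrier A. f x \<in> V}"
  proof (rule A.lin_span_minimal)
    show "submodule {x \<in> carrier A. f x \<in> V} complex_algebra A"
      using assms(5) unfolding A.submodule_iff B.submodule_iff
      by (auto simp: f lin_map_zero[OF assms(1-3)])
  qed (use assms(4,6) in auto)
  thus ?thesis by auto
qed

lemma (in unital_star_algebra) star_subalgebra_submodule:
  "star_subalgebra A S \<Longrightarrow> submodule S complex_algebra A"
  using star_subalgebraD[of S] by (auto simp: submodule_iff)

lemma (in mono_star_algebra) level_closed: "a \<in> level D m \<Longrightarrow> a \<in> carrier D"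
  using star_subalgebraD(1)[OF level_subalgebra] by auto

locale mono_tensor = D: mono_star_algebra D + E: mono_star_algebra E
  for D :: "('a, 'm) mono_algebra_scheme" and E :: "('b, 'n) mono_algebra_scheme"
begin

sublocale tensor_pair D E ..

sublocale DE: unital_star_algebra "D \<boxtimes> E"
  by (rule unital_star_algebra_mtensor) unfold_locales

lemma level_gens: "{tens D E a b | a b. a \<in> level D m \<and> b \<in> level E m} \<subseteq> carrier (D \<boxtimes> E)"
  by (auto simp: mtensor_simps D.level_closed E.level_closed)

lemma level_tensor:
  "level (D \<boxtimes> E) m = lin_span (D \<boxtimes> E) {tens D E a b | a b. a \<in> level D m \<and> b \<in> level E m}"
  unfolding mtensor_simps(8) lin_span_def AB.submodule_iff DE.submodule_iff by (simp add: mtensor_simps)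

lemma tens_in_level: "\<lbrakk>a \<in> level D m; b \<in> level E m\<rbrakk> \<Longrightarrow> tens D E a b \<in> level (D \<boxtimes> E) m"
  unfolding level_tensor by (rule subsetD[OF DE.lin_span_superset]) auto

lemma level_subalgebra_tensor: "star_subalgebra (D \<boxtimes> E) (level (D \<boxtimes> E) m)"
  unfolding level_tensor
proof (rule DE.star_subalgebra_lin_span[OF level_gens])
  let ?X = "{tens D E a b | a b. a \<in> level D m \<and> b \<in> level E m}"
  note LD = D.star_subalgebraD[OF D.level_subalgebra] and LE = E.star_subalgebraD[OF E.level_subalgebra]
  show "\<one>\<^bsub>D \<boxtimes> E\<^esub> \<in> ?X" using tens_one LD(2) LE(2) by (force simp: mtensor_simps)
  fix x assume "x \<in> ?X"
  then obtain a b where x: "x = tens D E a b" "a \<in> level D m" "b \<in> level E m" by auto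
  hence C: "a \<in> carrier D" "b \<in> carrier E" by (simp_all add: D.level_closed E.level_closed)
  show "star (D \<boxtimes> E) x \<in> ?X"
    using LD(7)[OF x(2)] LE(7)[OF x(3)] tens_star[OF C] unfolding x(1) mtensor_simps by blast
  fix y assume "y \<in> ?X"
  then obtain a' b' where y: "y = tens D E a' b'" "a' \<in> level D m" "b' \<in> level E m" by auto
  hence C': "a' \<in> carrier D" "b' \<in> carrier E" by (simp_all add: D.level_closed E.level_closed)
  show "x \<otimes>\<^bsub>D \<boxtimes> E\<^esub> y \<in> ?X"
    using LD(5)[OF x(2) y(2)] LE(5)[OF x(3) y(3)] tens_mult[OF C(1) C'(1) C(2) C'(2)]
    unfolding x(1) y(1) mtensor_simps by blast
qed

text \<open>In the tensor product the hypothesis of the supremum axiom only yields c_{min(N,j)} =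
  c_N for the tensor chain. Injectivity turns this into N \<le> j for all N, hence j =
  \<infinity>.\<close>

lemma mono_star_algebra_tensor:
  assumes inj: "inj (chain (D \<boxtimes> E))" shows "mono_star_algebra (D \<boxtimes> E)"
proof
  show "star_subalgebra (D \<boxtimes> E) (level (D \<boxtimes> E) m)" for m by (rule level_subalgebra_tensor)
  show "chain (D \<boxtimes> E) i \<in> carrier (D \<boxtimes> E)" for i by (simp add: mtensor_simps)
  show mult: "chain (D \<boxtimes> E) i \<otimes>\<^bsub>D \<boxtimes> E\<^esub> chain (D \<boxtimes> E) j = chain (D \<boxtimes> E) (min i j)" for i j
    by (simp add: mtensor_simps tens_mult D.chain_mult E.chain_mult)
  show "star (D \<boxtimes> E) (chain (D \<boxtimes> E) i) = chain (D \<boxtimes> E) i" for i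
    by (simp add: mtensor_simps tens_star D.chain_star E.chain_star)
  show "chain (D \<boxtimes> E) 0 = \<zero>\<^bsub>D \<boxtimes> E\<^esub>" by (simp add: mtensor_simps D.chain_zero)
  show top: "chain (D \<boxtimes> E) \<infinity> = \<one>\<^bsub>D \<boxtimes> E\<^esub>" by (simp add: mtensor_simps D.chain_top E.chain_top tens_one)
  fix j assume "\<And>N. chain (D \<boxtimes> E) (enat N) \<otimes>\<^bsub>D \<boxtimes> E\<^esub> chain (D \<boxtimes> E) j = chain (D \<boxtimes> E) (enat N)"
  hence "min (enat N) j = enat N" for N using inj by (simp add: mult inj_eq)
  hence "enat N \<le> j" for N by (metis min.cobounded2)
  hence "j = \<infinity>" by (metis Suc_ile_eq enat.exhaust less_irrefl)
  thus "chain (D \<boxtimes> E) j = \<one>\<^bsub>D \<boxtimes> E\<^esub>" by (simp add: top)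
qed

text \<open>A functional sending \<open>c\<^sub>i\<close> to \<open>1\<close> for \<open>i > 0\<close> on one leg recovers the chain of the other leg.\<close>

lemma inj_chain_left:
  assumes \<phi>: "lin_map D complex_algebra \<phi>" "\<And>i. i \<noteq> 0 \<Longrightarrow> \<phi> (chain D i) = 1"
    and inj: "inj (chain E)"
  shows "inj (chain (D \<boxtimes> E))"
proof -
  let ?F = "tensor_lift E (\<lambda>a b. \<phi> a \<odot>\<^bsub>E\<^esub> b)"
  have bil: "bilin_map D E E (\<lambda>a b. \<phi> a \<odot>\<^bsub>E\<^esub> b)"
    using lin_mapD[OF \<phi>(1)]
    by (auto simp: bilin_map_def lin_map_def E.scale_add_left E.scale_add_right E.scale_scale mult.commute)
  have "?F (chain (D \<boxtimes> E) i) = \<phi> (chain D i) \<odot>\<^bsub>E\<^esub> chain E i" for i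
    unfolding mtensor_simps
    by (rule tensor_lift_tens[OF E.unital_star_algebra_axioms bil]) simp_all
  hence "?F (chain (D \<boxtimes> E) i) = chain E i" for i
    using \<phi>(2)[of i] lin_mapD(1)[OF \<phi>(1)] by (cases "i = 0") (simp_all add: E.chain_zero)
  hence "?F \<circ> chain (D \<boxtimes> E) = chain E" by auto
  thus ?thesis using inj by (metis inj_on_imageI2)
qed

lemma inj_chain_right:
  assumes \<phi>: "lin_map E complex_algebra \<phi>" "\<And>i. i \<noteq> 0 \<Longrightarrow> \<phi> (chain E i) = 1"
    and inj: "inj (chain D)"
  shows "inj (chain (D \<boxtimes> E))"
proof -
  let ?F = "tensor_lift D (\<lambda>a b. \<phi> b \<odot>\<^bsub>D\<^esub> a)"
  have bil: "bilin_map D E D (\<lambda>a b. \<phi> b \<odot>\<^bsub>D\<^esub> a)"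
    using lin_mapD[OF \<phi>(1)]
    by (auto simp: bilin_map_def lin_map_def D.scale_add_left D.scale_add_right D.scale_scale mult.commute)
  have "?F (chain (D \<boxtimes> E) i) = \<phi> (chain E i) \<odot>\<^bsub>D\<^esub> chain D i" for i
    unfolding mtensor_simps
    by (rule tensor_lift_tens[OF D.unital_star_algebra_axioms bil]) simp_all
  hence "?F (chain (D \<boxtimes> E) i) = chain D i" for i
    using \<phi>(2)[of i] lin_mapD(1)[OF \<phi>(1)] by (cases "i = 0") (simp_all add: D.chain_zero)
  hence "?F \<circ> chain (D \<boxtimes> E) = chain D" by auto
  thus ?thesis using inj by (metis inj_on_imageI2)
qed

end

text \<open>Unlike faithfulness of the chain itself, these conditions pass faithfulness to tensor products.\<close>

locale ample_algebra = mono_star_algebra D for D :: "('a, 'm) mono_algebra_scheme" (structure) +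
  assumes asymptotic_scalar: "x \<in> carrier D \<Longrightarrow> \<exists>a N. x \<otimes> (\<one> \<ominus> c N) = a \<odot> (\<one> \<ominus> c N)"
    and separating: "\<exists>\<phi>. lin_map D complex_algebra \<phi> \<and> \<phi> (c (Suc N) \<ominus> c N) \<noteq> 0"
begin

lemma compl_mult: "N \<le> M \<Longrightarrow> (\<one> \<ominus> c N) \<otimes> (\<one> \<ominus> c M) = \<one> \<ominus> c M"
proof -
  assume "N \<le> M"
  hence "c N \<otimes> (\<one> \<ominus> c M) = \<zero>"
    by (simp add: minus_eq r_distr r_minus chain_mult min_def r_neg)
  thus ?thesis by (simp add: minus_eq l_distr l_minus)
qed

lemma compl_mult_c: "(\<one> \<ominus> c N) \<otimes> c (Suc N) = c (Suc N) \<ominus> c N"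
  by (simp add: minus_eq l_distr l_minus chain_mult min_def)

lemma compl_add: "(\<one> \<ominus> c N) \<oplus> c N = \<one>"
  by (simp add: minus_eq a_assoc l_neg)

text \<open>If all truncations of x vanish, then x equals its part at infinity a (1 - c_N).
  Multiplying by the next projection isolates a (c_{N+1} - c_N) = 0, and the functional forces a =
  0.\<close>

lemma faithful_c:
  assumes x: "x \<in> carrier D" and 0: "\<And>N. x \<otimes> c N = \<zero>" shows "x = \<zero>"
proof -
  obtain a N where aN: "x \<otimes> (\<one> \<ominus> c N) = a \<odot> (\<one> \<ominus> c N)" using asymptotic_scalar[OF x] by blast
  obtain \<phi> where \<phi>: "lin_map D complex_algebra \<phi>" "\<phi> (c (Suc N) \<ominus> c N) \<noteq> 0" using separating by blast
  have x1: "x = a \<odot> (\<one> \<ominus> c N)"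
  proof -
    have "x = x \<otimes> ((\<one> \<ominus> c N) \<oplus> c N)" unfolding compl_add using x by simp
    also have "\<dots> = x \<otimes> (\<one> \<ominus> c N) \<oplus> x \<otimes> c N" using x by (simp add: r_distr)
    finally show ?thesis using aN 0 by simp
  qed
  have "a \<odot> (c (Suc N) \<ominus> c N) = x \<otimes> c (Suc N)"
    unfolding x1 by (simp add: smult_mult_left compl_mult_c)
  hence "a \<odot> (c (Suc N) \<ominus> c N) = \<zero>" using 0 by simp
  moreover have "\<phi> \<zero> = 0"
    using lin_map_zero[OF unital_star_algebra_axioms unital_star_algebra_complex \<phi>(1)] by simp
  ultimately have "a * \<phi> (c (Suc N) \<ominus> c N) = 0"
    using lin_mapD(3)[OF \<phi>(1), of "c (Suc N) \<ominus> c N" a] by simp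
  hence "a = 0" using \<phi>(2) by simp
  thus ?thesis using x1 by simp
qed

end

locale ample_tensor = D: ample_algebra D + E: ample_algebra E
  for D :: "('a, 'm) mono_algebra_scheme" and E :: "('b, 'n) mono_algebra_scheme"
begin

sublocale mono_tensor D E ..

text \<open>The argument for a single algebra with the scalar at infinity replaced by an element of
  the first leg: z agrees with a \<otimes> (1 - c_N) for some a. Multiplication by 1 \<otimes>
  c_{N+1}, followed by slicing the second leg with a separating functional, yields a multiple of a
  by a nonzero scalar.\<close>

lemma faithful_right:
  assumes z: "z \<in> carrier AB" and 0: "\<And>n. z \<otimes>\<^bsub>AB\<^esub> tens D E \<one>\<^bsub>D\<^esub> (E.c n) = \<zero>\<^bsub>AB\<^esub>"
  shows "z = \<zero>\<^bsub>AB\<^esub>"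
proof -
  let ?e = "\<lambda>N. \<one>\<^bsub>E\<^esub> \<ominus>\<^bsub>E\<^esub> E.c N"
  \<comment> \<open>The coefficient a at infinity is unchanged when N grows, so the two summands of
    a sum can be brought to a common threshold.\<close>
  have mono: "z \<otimes>\<^bsub>AB\<^esub> tens D E \<one>\<^bsub>D\<^esub> (?e M) = tens D E a (?e M)"
    if "z \<in> carrier AB" "a \<in> carrier D" "z \<otimes>\<^bsub>AB\<^esub> tens D E \<one>\<^bsub>D\<^esub> (?e N) = tens D E a (?e N)" "N \<le> M" for z a N M
  proof -
    have "(z \<otimes>\<^bsub>AB\<^esub> tens D E \<one>\<^bsub>D\<^esub> (?e N)) \<otimes>\<^bsub>AB\<^esub> tens D E \<one>\<^bsub>D\<^esub> (?e M) = tens D E a (?e M)"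
      unfolding that(3) using that by (simp add: tens_mult E.compl_mult)
    thus ?thesis using that(1,2,4) by (simp add: AB.m_assoc tens_mult E.compl_mult)
  qed
  have "\<exists>a\<in>carrier D. \<exists>N. z \<otimes>\<^bsub>AB\<^esub> tens D E \<one>\<^bsub>D\<^esub> (?e N) = tens D E a (?e N)"
    using z
  proof (induction rule: tensor_induct)
    case (tens a b)
    obtain s N where "b \<otimes>\<^bsub>E\<^esub> ?e N = s \<odot>\<^bsub>E\<^esub> ?e N" using E.asymptotic_scalar tens by blast
    hence "tens D E a b \<otimes>\<^bsub>AB\<^esub> tens D E \<one>\<^bsub>D\<^esub> (?e N) = tens D E (s \<odot>\<^bsub>D\<^esub> a) (?e N)"
      using tens by (simp add: tens_mult tens_bilin)
    thus ?case using tens by (intro bexI[of _ "s \<odot>\<^bsub>D\<^esub> a"] exI[of _ N]) auto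
  next
    case (add s t)
    then obtain a N b M where a: "a \<in> carrier D" "s \<otimes>\<^bsub>AB\<^esub> tens D E \<one>\<^bsub>D\<^esub> (?e N) = tens D E a (?e N)"
      and b: "b \<in> carrier D" "t \<otimes>\<^bsub>AB\<^esub> tens D E \<one>\<^bsub>D\<^esub> (?e M) = tens D E b (?e M)" by blast
    have "(s \<oplus>\<^bsub>AB\<^esub> t) \<otimes>\<^bsub>AB\<^esub> tens D E \<one>\<^bsub>D\<^esub> (?e (max N M)) = tens D E (a \<oplus>\<^bsub>D\<^esub> b) (?e (max N M))"
      using mono[OF add(1) a, of "max N M"] mono[OF add(2) b, of "max N M"] add(1,2) a(1) b(1)
      by (simp add: AB.l_distr tens_bilin)
    thus ?case using a b by (intro bexI[of _ "a \<oplus>\<^bsub>D\<^esub> b"] exI[of _ "max N M"]) auto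
  qed
  then obtain a N where a: "a \<in> carrier D" "z \<otimes>\<^bsub>AB\<^esub> tens D E \<one>\<^bsub>D\<^esub> (?e N) = tens D E a (?e N)" by blast
  have split: "z \<otimes>\<^bsub>AB\<^esub> tens D E \<one>\<^bsub>D\<^esub> (?e N) = z"
  proof -
    have "z = z \<otimes>\<^bsub>AB\<^esub> tens D E \<one>\<^bsub>D\<^esub> (?e N \<oplus>\<^bsub>E\<^esub> E.c N)" unfolding E.compl_add using z by (simp add: tens_one)
    also have "\<dots> = z \<otimes>\<^bsub>AB\<^esub> tens D E \<one>\<^bsub>D\<^esub> (?e N) \<oplus>\<^bsub>AB\<^esub> z \<otimes>\<^bsub>AB\<^esub> tens D E \<one>\<^bsub>D\<^esub> (E.c N)"
      using z by (simp add: tens_bilin AB.r_distr)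
    finally show ?thesis using 0 z by simp
  qed
  obtain \<phi> where \<phi>: "lin_map E complex_algebra \<phi>" "\<phi> (E.c (Suc N) \<ominus>\<^bsub>E\<^esub> E.c N) \<noteq> 0"
    using E.separating by blast
  let ?F = "tensor_lift D (\<lambda>a b. \<phi> b \<odot>\<^bsub>D\<^esub> a)"
  have bil: "bilin_map D E D (\<lambda>a b. \<phi> b \<odot>\<^bsub>D\<^esub> a)"
    using lin_mapD[OF \<phi>(1)]
    by (auto simp: bilin_map_def lin_map_def D.scale_add_left D.scale_add_right D.scale_scale mult.commute)
  have "tens D E a (E.c (Suc N) \<ominus>\<^bsub>E\<^esub> E.c N) = tens D E a (?e N) \<otimes>\<^bsub>AB\<^esub> tens D E \<one>\<^bsub>D\<^esub> (E.c (Suc N))"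
    using a by (simp add: tens_mult E.compl_mult_c)
  also have "\<dots> = \<zero>\<^bsub>AB\<^esub>" unfolding a(2)[symmetric] split by (rule 0)
  finally have "?F (tens D E a (E.c (Suc N) \<ominus>\<^bsub>E\<^esub> E.c N)) = \<zero>\<^bsub>D\<^esub>"
    using lin_map_zero[OF unital_star_algebra_tensor D.unital_star_algebra_axioms
      lin_map_tensor_lift[OF D.unital_star_algebra_axioms bil]] by simp
  hence "\<phi> (E.c (Suc N) \<ominus>\<^bsub>E\<^esub> E.c N) \<odot>\<^bsub>D\<^esub> a = \<zero>\<^bsub>D\<^esub>"
    using a by (simp add: tensor_lift_tens[OF D.unital_star_algebra_axioms bil])
  hence "a = \<zero>\<^bsub>D\<^esub>" using \<phi>(2) a(1) by (rule D.scale_eq_zero)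
  thus ?thesis using a(2) split by simp
qed

text \<open>The same slicing argument with the legs exchanged.\<close>

lemma faithful_left:
  assumes z: "z \<in> carrier AB" and 0: "\<And>n. z \<otimes>\<^bsub>AB\<^esub> tens D E (D.c n) \<one>\<^bsub>E\<^esub> = \<zero>\<^bsub>AB\<^esub>"
  shows "z = \<zero>\<^bsub>AB\<^esub>"
proof -
  let ?e = "\<lambda>N. \<one>\<^bsub>D\<^esub> \<ominus>\<^bsub>D\<^esub> D.c N"
  have mono: "z \<otimes>\<^bsub>AB\<^esub> tens D E (?e M) \<one>\<^bsub>E\<^esub> = tens D E (?e M) b"
    if "z \<in> carrier AB" "b \<in> carrier E" "z \<otimes>\<^bsub>AB\<^esub> tens D E (?e N) \<one>\<^bsub>E\<^esub> = tens D E (?e N) b" "N \<le> M" for z b N M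
  proof -
    have "(z \<otimes>\<^bsub>AB\<^esub> tens D E (?e N) \<one>\<^bsub>E\<^esub>) \<otimes>\<^bsub>AB\<^esub> tens D E (?e M) \<one>\<^bsub>E\<^esub> = tens D E (?e M) b"
      unfolding that(3) using that by (simp add: tens_mult D.compl_mult)
    thus ?thesis using that(1,2,4) by (simp add: AB.m_assoc tens_mult D.compl_mult)
  qed
  have "\<exists>b\<in>carrier E. \<exists>N. z \<otimes>\<^bsub>AB\<^esub> tens D E (?e N) \<one>\<^bsub>E\<^esub> = tens D E (?e N) b"
    using z
  proof (induction rule: tensor_induct)
    case (tens a b)
    obtain s N where "a \<otimes>\<^bsub>D\<^esub> ?e N = s \<odot>\<^bsub>D\<^esub> ?e N" using D.asymptotic_scalar tens by blast
    hence "tens D E a b \<otimes>\<^bsub>AB\<^esub> tens D E (?e N) \<one>\<^bsub>E\<^esub> = tens D E (?e N) (s \<odot>\<^bsub>E\<^esub> b)"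
      using tens by (simp add: tens_mult tens_bilin)
    thus ?case using tens by (intro bexI[of _ "s \<odot>\<^bsub>E\<^esub> b"] exI[of _ N]) auto
  next
    case (add s t)
    then obtain a N b M where a: "a \<in> carrier E" "s \<otimes>\<^bsub>AB\<^esub> tens D E (?e N) \<one>\<^bsub>E\<^esub> = tens D E (?e N) a"
      and b: "b \<in> carrier E" "t \<otimes>\<^bsub>AB\<^esub> tens D E (?e M) \<one>\<^bsub>E\<^esub> = tens D E (?e M) b" by blast
    have "(s \<oplus>\<^bsub>AB\<^esub> t) \<otimes>\<^bsub>AB\<^esub> tens D E (?e (max N M)) \<one>\<^bsub>E\<^esub> = tens D E (?e (max N M)) (a \<oplus>\<^bsub>E\<^esub> b)"
      using mono[OF add(1) a, of "max N M"] mono[OF add(2) b, of "max N M"] add(1,2) a(1) b(1)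
      by (simp add: AB.l_distr tens_bilin)
    thus ?case using a b by (intro bexI[of _ "a \<oplus>\<^bsub>E\<^esub> b"] exI[of _ "max N M"]) auto
  qed
  then obtain b N where b: "b \<in> carrier E" "z \<otimes>\<^bsub>AB\<^esub> tens D E (?e N) \<one>\<^bsub>E\<^esub> = tens D E (?e N) b" by blast
  have split: "z \<otimes>\<^bsub>AB\<^esub> tens D E (?e N) \<one>\<^bsub>E\<^esub> = z"
  proof -
    have "z = z \<otimes>\<^bsub>AB\<^esub> tens D E (?e N \<oplus>\<^bsub>D\<^esub> D.c N) \<one>\<^bsub>E\<^esub>" unfolding D.compl_add using z by (simp add: tens_one)
    also have "\<dots> = z \<otimes>\<^bsub>AB\<^esub> tens D E (?e N) \<one>\<^bsub>E\<^esub> \<oplus>\<^bsub>AB\<^esub> z \<otimes>\<^bsub>AB\<^esub> tens D E (D.c N) \<one>\<^bsub>E\<^esub>"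
      using z by (simp add: tens_bilin AB.r_distr)
    finally show ?thesis using 0 z by simp
  qed
  obtain \<phi> where \<phi>: "lin_map D complex_algebra \<phi>" "\<phi> (D.c (Suc N) \<ominus>\<^bsub>D\<^esub> D.c N) \<noteq> 0"
    using D.separating by blast
  let ?F = "tensor_lift E (\<lambda>a b. \<phi> a \<odot>\<^bsub>E\<^esub> b)"
  have bil: "bilin_map D E E (\<lambda>a b. \<phi> a \<odot>\<^bsub>E\<^esub> b)"
    using lin_mapD[OF \<phi>(1)]
    by (auto simp: bilin_map_def lin_map_def E.scale_add_left E.scale_add_right E.scale_scale mult.commute)
  have "tens D E (D.c (Suc N) \<ominus>\<^bsub>D\<^esub> D.c N) b = tens D E (?e N) b \<otimes>\<^bsub>AB\<^esub> tens D E (D.c (Suc N)) \<one>\<^bsub>E\<^esub>"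
    using b by (simp add: tens_mult D.compl_mult_c)
  also have "\<dots> = \<zero>\<^bsub>AB\<^esub>" unfolding b(2)[symmetric] split by (rule 0)
  finally have "?F (tens D E (D.c (Suc N) \<ominus>\<^bsub>D\<^esub> D.c N) b) = \<zero>\<^bsub>E\<^esub>"
    using lin_map_zero[OF unital_star_algebra_tensor E.unital_star_algebra_axioms
      lin_map_tensor_lift[OF E.unital_star_algebra_axioms bil]] by simp
  hence "\<phi> (D.c (Suc N) \<ominus>\<^bsub>D\<^esub> D.c N) \<odot>\<^bsub>E\<^esub> b = \<zero>\<^bsub>E\<^esub>"
    using b by (simp add: tensor_lift_tens[OF E.unital_star_algebra_axioms bil])
  hence "b = \<zero>\<^bsub>E\<^esub>" using \<phi>(2) b(1) by (rule E.scale_eq_zero)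
  thus ?thesis using b(2) split by simp
qed

text \<open>The chain contains only the diagonal projections, but c_m \<otimes> c_n lies below the
  diagonal one of index max(m,n). Hence z vanishes on all of them, and the two one-sided statements
  remove first the second leg, then the first.\<close>

lemma faithful_tensor:
  assumes z: "z \<in> carrier AB" and 0: "\<And>n. z \<otimes>\<^bsub>AB\<^esub> tens D E (D.c n) (E.c n) = \<zero>\<^bsub>AB\<^esub>"
  shows "z = \<zero>\<^bsub>AB\<^esub>"
proof (rule faithful_left[OF z])
  fix m
  show "z \<otimes>\<^bsub>AB\<^esub> tens D E (D.c m) \<one>\<^bsub>E\<^esub> = \<zero>\<^bsub>AB\<^esub>"
  proof (rule faithful_right)
    fix n
    have "(z \<otimes>\<^bsub>AB\<^esub> tens D E (D.c m) \<one>\<^bsub>E\<^esub>) \<otimes>\<^bsub>AB\<^esub> tens D E \<one>\<^bsub>D\<^esub> (E.c n) = z \<otimes>\<^bsub>AB\<^esub> tens D E (D.c m) (E.c n)"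
      using z by (simp add: AB.m_assoc tens_mult)
    also have "tens D E (D.c m) (E.c n) =
        tens D E (D.c (max m n)) (E.c (max m n)) \<otimes>\<^bsub>AB\<^esub> tens D E (D.c m) (E.c n)"
      by (simp add: tens_mult D.chain_mult E.chain_mult min_def)
    also have "z \<otimes>\<^bsub>AB\<^esub> (tens D E (D.c (max m n)) (E.c (max m n)) \<otimes>\<^bsub>AB\<^esub> tens D E (D.c m) (E.c n)) = \<zero>\<^bsub>AB\<^esub>"
      using z by (simp add: AB.m_assoc[symmetric] 0)
    finally show "(z \<otimes>\<^bsub>AB\<^esub> tens D E (D.c m) \<one>\<^bsub>E\<^esub>) \<otimes>\<^bsub>AB\<^esub> tens D E \<one>\<^bsub>D\<^esub> (E.c n) = \<zero>\<^bsub>AB\<^esub>" .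
  qed (use z in simp)
qed

end

locale closable_ample_algebra = ample_algebra D for D :: "('a, 'm) mono_algebra_scheme" (structure) +
  assumes approx_c: "x \<in> carrier D \<Longrightarrow> \<exists>K. c K \<otimes> (x \<otimes> c N) = x \<otimes> c N"
begin

sublocale closable_algebra D
  by unfold_locales (use faithful_c approx_c in auto)

lemma approx_mono:
  assumes "x \<in> carrier D" "c K \<otimes> (x \<otimes> c N) = x \<otimes> c N" "K \<le> M"
  shows "c M \<otimes> (x \<otimes> c N) = x \<otimes> c N"
proof -
  have "c M \<otimes> (c K \<otimes> (x \<otimes> c N)) = c K \<otimes> (x \<otimes> c N)"
    using assms(1,3) by (simp add: m_assoc[symmetric] chain_mult min_def)
  thus ?thesis using assms by simp
qed

end

text \<open>The property at infinity is itself lost in general: for c_1 \<otimes> 1 and N \<ge> 1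
  the part beyond c_N \<otimes> c_N is c_1 \<otimes> (1 - c_N), which need not be a scalar multiple
  of 1 - c_N \<otimes> c_N. Hence the conclusion is \<open>closable_algebra\<close>, with hypotheses
  at infinity placed on the legs.\<close>

lemma closable_algebra_tensor:
  assumes D: "closable_ample_algebra D" and E: "closable_ample_algebra E"
    and DE: "mono_star_algebra (D \<boxtimes> E)"
  shows "closable_algebra (D \<boxtimes> E)"
proof -
  interpret D: closable_ample_algebra D by fact
  interpret E: closable_ample_algebra E by fact
  interpret ample_tensor D E ..
  interpret T: mono_star_algebra "D \<boxtimes> E" by fact
  show ?thesis
  proof
    fix x assume "x \<in> carrier (D \<boxtimes> E)" "\<And>N. x \<otimes>\<^bsub>D \<boxtimes> E\<^esub> T.c N = \<zero>\<^bsub>D \<boxtimes> E\<^esub>"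
    thus "x = \<zero>\<^bsub>D \<boxtimes> E\<^esub>" unfolding mtensor_simps by (rule faithful_tensor)
  next
    fix x N assume "x \<in> carrier (D \<boxtimes> E)"
    hence "x \<in> carrier AB" by (simp add: mtensor_simps)
    thus "\<exists>K. T.c K \<otimes>\<^bsub>D \<boxtimes> E\<^esub> (x \<otimes>\<^bsub>D \<boxtimes> E\<^esub> T.c N) = x \<otimes>\<^bsub>D \<boxtimes> E\<^esub> T.c N"
    proof (induction rule: tensor_induct)
      case (tens a b)
      obtain K L where K: "D.c K \<otimes>\<^bsub>D\<^esub> (a \<otimes>\<^bsub>D\<^esub> D.c N) = a \<otimes>\<^bsub>D\<^esub> D.c N"
        and L: "E.c L \<otimes>\<^bsub>E\<^esub> (b \<otimes>\<^bsub>E\<^esub> E.c N) = b \<otimes>\<^bsub>E\<^esub> E.c N"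
        using D.approx_c[of a N] E.approx_c[of b N] tens by auto
      show ?case
        using D.approx_mono[OF tens(1) K, of "max K L"] E.approx_mono[OF tens(2) L, of "max K L"] tens
        by (intro exI[of _ "max K L"]) (simp add: mtensor_simps tens_mult)
    next
      case (add s t)
      then obtain K L where K: "T.c K \<otimes>\<^bsub>D \<boxtimes> E\<^esub> (s \<otimes>\<^bsub>D \<boxtimes> E\<^esub> T.c N) = s \<otimes>\<^bsub>D \<boxtimes> E\<^esub> T.c N"
        and L: "T.c L \<otimes>\<^bsub>D \<boxtimes> E\<^esub> (t \<otimes>\<^bsub>D \<boxtimes> E\<^esub> T.c N) = t \<otimes>\<^bsub>D \<boxtimes> E\<^esub> T.c N" by auto
      have st: "s \<in> carrier (D \<boxtimes> E)" "t \<in> carrier (D \<boxtimes> E)" using add by (simp_all add: mtensor_simps)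
      have mono: "T.c (max K L) \<otimes>\<^bsub>D \<boxtimes> E\<^esub> y = y" if "T.c M \<otimes>\<^bsub>D \<boxtimes> E\<^esub> y = y" "M \<le> max K L" "y \<in> carrier (D \<boxtimes> E)" for y M
      proof -
        have "T.c (max K L) \<otimes>\<^bsub>D \<boxtimes> E\<^esub> (T.c M \<otimes>\<^bsub>D \<boxtimes> E\<^esub> y) = T.c M \<otimes>\<^bsub>D \<boxtimes> E\<^esub> y"
          using that(2,3) by (simp add: DE.m_assoc[symmetric] T.chain_mult min.absorb2)
        thus ?thesis using that by simp
      qed
      have "T.c (max K L) \<otimes>\<^bsub>D \<boxtimes> E\<^esub> ((s \<oplus>\<^bsub>D \<boxtimes> E\<^esub> t) \<otimes>\<^bsub>D \<boxtimes> E\<^esub> T.c N) = (s \<oplus>\<^bsub>D \<boxtimes> E\<^esub> t) \<otimes>\<^bsub>D \<boxtimes> E\<^esub> T.c N"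
        using mono[OF K] mono[OF L] st by (simp add: DE.l_distr DE.r_distr)
      thus ?case by (auto simp: mtensor_simps)
    qed
  qed
qed

section \<open>The monotone closure of the complex numbers\<close>

lemma complex_mono_simps [simp]:
  "carrier complex_mono = UNIV" "mult complex_mono = (*)" "one complex_mono = 1"
  "zero complex_mono = 0" "add complex_mono = (+)" "smult complex_mono = (*)"
  "star complex_mono = cnj" "level complex_mono m = UNIV"
  "chain complex_mono i = (if i = 0 then 0 else 1)"
  by (simp_all add: complex_mono_def star_algebra.extend_def mono_algebra.fields_def)

text \<open>The chain has reached 1 at index 1, so the truncation by c_1 settles suprema,
  faithfulness and approximation at once.\<close>

lemma closable_algebra_complex: "closable_algebra complex_mono"
proof -
  interpret C: unital_star_algebra complex_mono
    by (rule unital_star_algebraI) (simp_all add: algebra_simps)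
  show ?thesis
  proof
    show "star_subalgebra complex_mono (level complex_mono m)" for m
      by (rule C.star_subalgebraI) auto
    fix j assume "\<And>N. chain complex_mono (enat N) \<otimes>\<^bsub>complex_mono\<^esub> chain complex_mono j = chain complex_mono (enat N)"
    from this[of 1] show "chain complex_mono j = \<one>\<^bsub>complex_mono\<^esub>"
      by (auto simp: zero_enat_def split: if_splits)
  next
    fix x assume "\<And>N. x \<otimes>\<^bsub>complex_mono\<^esub> chain complex_mono (enat N) = \<zero>\<^bsub>complex_mono\<^esub>"
    from this[of 1] show "x = \<zero>\<^bsub>complex_mono\<^esub>" by (simp add: zero_enat_def)
  next
    show "\<exists>K. chain complex_mono (enat K) \<otimes>\<^bsub>complex_mono\<^esub> (x \<otimes>\<^bsub>complex_mono\<^esub> chain complex_mono (enat N)) =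
        x \<otimes>\<^bsub>complex_mono\<^esub> chain complex_mono (enat N)" for x N
      by (rule exI[of _ 1]) (simp add: zero_enat_def)
  qed (auto simp: min_def)
qed

lemma star_hom_complex_mono: "star_hom A complex_mono = star_hom A complex_algebra"
  by (simp add: star_hom_def ring_hom_def)

text \<open>Since c_1 = 1, agreement on truncations is plain eventual agreement; all representatives
  share the same eventual value and the \<open>THE\<close> is determined.\<close>

lemma eventual_value_mco_class:
  assumes "(x, e) \<in> owmc complex_mono" "\<forall>\<^sub>F m in sequentially. x m = l"
  shows "eventual_value (mco_class complex_mono x e) = l"
proof -
  interpret C: closable_algebra complex_mono by (rule closable_algebra_complex)
  have ev: "\<forall>\<^sub>F m in sequentially. y m = l" if "(y, f) \<in> mco_class complex_mono x e" for y f
  proof -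
    have "C.seq_eq x y" using that by (simp add: C.mem_mco_class)
    from C.seq_eqD(1)[OF this, of 1] assms(2) show ?thesis
      by eventually_elim (simp add: zero_enat_def)
  qed
  have xe: "(x, e) \<in> mco_class complex_mono x e" using assms(1) by (simp add: C.mem_mco_class C.seq_eqI)
  show ?thesis
    unfolding eventual_value_def
  proof (rule the_equality)
    show "\<forall>(y, f)\<in>mco_class complex_mono x e. \<forall>\<^sub>F m in sequentially. y m = l" using ev by auto
    fix l' assume "\<forall>(y, f)\<in>mco_class complex_mono x e. \<forall>\<^sub>F m in sequentially. y m = l'"
    hence "\<forall>\<^sub>F m in sequentially. x m = l'" using xe by auto
    with assms(2) have "\<forall>\<^sub>F m :: nat in sequentially. l' = l" by eventually_elim simp
    thus "l' = l" by simp
  qed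
qed

text \<open>By cofinality over c_1 = 1 some \<open>e m\<close> equals 1, and stability on it makes x
  constant from there on.\<close>

lemma owmc_complex_eventually_const:
  assumes "(x, e) \<in> owmc complex_mono" obtains l where "\<forall>\<^sub>F m in sequentially. x m = l"
proof -
  interpret C: closable_algebra complex_mono by (rule closable_algebra_complex)
  have "\<forall>\<^sub>F m in sequentially. C.c 1 \<otimes>\<^bsub>complex_mono\<^esub> e m = C.c 1 \<and> m \<ge> 1"
    using C.msdd_cofinal[OF C.owmcD(3)[OF assms], of 1] eventually_ge_at_top[of 1]
    by eventually_elim simp
  then obtain m where m: "e m = 1" "m \<ge> 1"
    using eventually_happens by (force simp: zero_enat_def)
  have "x n = x m" if "n \<ge> m" for n using C.owmcD(5)[OF assms m(2) that] m by simp
  hence "\<forall>\<^sub>F n in sequentially. x n = x m"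
    unfolding eventually_sequentially by blast
  thus ?thesis by (rule that)
qed

lemma eventual_value_star_hom: "eventual_value \<in> star_hom (mclosure complex_mono) complex_algebra"
proof -
  interpret C: closable_algebra complex_mono by (rule closable_algebra_complex)
  note ops = C.mclosure_ops C.mclosure_consts
  have E: "\<exists>x e l. U = mco_class complex_mono x e \<and> (x, e) \<in> owmc complex_mono \<and>
      (\<forall>\<^sub>F m in sequentially. x m = l)" if "U \<in> carrier (mclosure complex_mono)" for U
    using that owmc_complex_eventually_const unfolding C.mclosure_carrier by blast
  show ?thesis
  proof (rule star_homI)
    fix U V assume "U \<in> carrier (mclosure complex_mono)" "V \<in> carrier (mclosure complex_mono)"
    then obtain x e l y f k where U: "U = mco_class complex_mono x e" "V = mco_class complex_mono y f"
      and x: "(x, e) \<in> owmc complex_mono" "\<forall>\<^sub>F m in sequentially. x m = l"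
      and y: "(y, f) \<in> owmc complex_mono" "\<forall>\<^sub>F m in sequentially. y m = k" using E by meson
    have mult: "\<forall>\<^sub>F m in sequentially. x m \<otimes>\<^bsub>complex_mono\<^esub> y m = l * k"
      using x(2) y(2) by eventually_elim simp
    have add: "\<forall>\<^sub>F m in sequentially. x m \<oplus>\<^bsub>complex_mono\<^esub> y m = l + k"
      using x(2) y(2) by eventually_elim simp
    show "eventual_value (U \<otimes>\<^bsub>mclosure complex_mono\<^esub> V) =
        eventual_value U \<otimes>\<^bsub>complex_algebra\<^esub> eventual_value V"
      unfolding U ops(4)[OF x(1) y(1)] eventual_value_mco_class[OF x] eventual_value_mco_class[OF y]
        eventual_value_mco_class[OF C.owmc_mult[OF x(1) y(1)] mult] by simp
    show "eventual_value (U \<oplus>\<^bsub>mclosure complex_mono\<^esub> V) =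
        eventual_value U \<oplus>\<^bsub>complex_algebra\<^esub> eventual_value V"
      unfolding U ops(3)[OF x(1) y(1)] eventual_value_mco_class[OF x] eventual_value_mco_class[OF y]
        eventual_value_mco_class[OF C.owmc_add[OF x(1) y(1)] add] by simp
  next
    fix U a assume "U \<in> carrier (mclosure complex_mono)"
    then obtain x e l where U: "U = mco_class complex_mono x e"
      and x: "(x, e) \<in> owmc complex_mono" "\<forall>\<^sub>F m in sequentially. x m = l" using E by meson
    have scale: "\<forall>\<^sub>F m in sequentially. a \<odot>\<^bsub>complex_mono\<^esub> x m = a * l"
      using x(2) by eventually_elim simp
    have star: "\<forall>\<^sub>F m in sequentially. star complex_mono (x m) = cnj l"
      using x(2) by eventually_elim simp
    show "eventual_value (a \<odot>\<^bsub>mclosure complex_mono\<^esub> U) = a \<odot>\<^bsub>complex_algebra\<^esub> eventual_value U"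
      unfolding U ops(2)[OF x(1)] eventual_value_mco_class[OF x]
        eventual_value_mco_class[OF C.owmc_scale[OF x(1)] scale] by simp
    show "eventual_value (star (mclosure complex_mono) U) = star complex_algebra (eventual_value U)"
      unfolding U ops(1)[OF x(1)] eventual_value_mco_class[OF x]
        eventual_value_mco_class[OF C.owmc_star[OF x(1)] star] by simp
  next
    have "(\<lambda>_. \<one>\<^bsub>complex_mono\<^esub>, \<lambda>_. \<one>\<^bsub>complex_mono\<^esub>) \<in> owmc complex_mono"
      by (rule C.owmc_const) simp
    from eventual_value_mco_class[OF this, of 1]
    show "eventual_value \<one>\<^bsub>mclosure complex_mono\<^esub> = \<one>\<^bsub>complex_algebra\<^esub>" by (simp add: ops)
  qed simp
qed

section \<open>Structural isomorphisms\<close>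

lemma (in mono_tensor) mono_hom_tensorI:
  assumes X: "mono_star_algebra X" and F: "F \<in> star_hom AB X"
    and level: "\<And>m a b. \<lbrakk>a \<in> level D m; b \<in> level E m\<rbrakk> \<Longrightarrow> F (tens D E a b) \<in> level X m"
    and chain: "\<And>i. F (tens D E (chain D i) (chain E i)) = chain X i"
  shows "F \<in> mono_hom (D \<boxtimes> E) X"
proof -
  interpret X: mono_star_algebra X by fact
  have hom: "F \<in> star_hom (D \<boxtimes> E) X" using F by (simp add: star_hom_mtensor)
  have "F ` level (D \<boxtimes> E) m \<subseteq> level X m" for m
    unfolding level_tensor
    by (rule lin_map_image_lin_span[OF DE.unital_star_algebra_axioms X.unital_star_algebra_axioms
      star_hom_lin_map[OF hom] level_gens X.star_subalgebra_submodule[OF X.level_subalgebra]])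
      (auto simp: level)
  thus ?thesis using hom chain by (simp add: mono_hom_def mtensor_simps)
qed

lemma id_mono_hom: "id \<in> mono_hom D D"
  by (simp add: mono_hom_def star_hom_def ring_hom_def)

lemma mono_hom_tensor_map:
  assumes "mono_star_algebra A" "mono_star_algebra B" "mono_star_algebra C" "mono_star_algebra D"
    and CD: "mono_star_algebra (C \<boxtimes> D)"
    and f: "f \<in> mono_hom A C" and g: "g \<in> mono_hom B D"
  shows "tensor_map C D f g \<in> mono_hom (A \<boxtimes> B) (C \<boxtimes> D)"
proof -
  interpret AB: mono_tensor A B using assms(1,2) by (rule mono_tensor.intro)
  interpret CD: mono_tensor C D using assms(3,4) by (rule mono_tensor.intro)
  note tm = tensor_map_star_hom[OF AB.D.unital_star_algebra_axioms AB.E.unital_star_algebra_axioms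
      CD.D.unital_star_algebra_axioms CD.E.unital_star_algebra_axioms mono_homD(1)[OF f] mono_homD(1)[OF g]]
  show ?thesis
  proof (rule AB.mono_hom_tensorI[OF CD])
    show "tensor_map C D f g \<in> star_hom AB.AB (C \<boxtimes> D)" using tm(1) by (simp add: star_hom_mtensor)
    show "tensor_map C D f g (tens A B a b) \<in> level (C \<boxtimes> D) m"
      if "a \<in> level A m" "b \<in> level B m" for a b m
      using that CD.tens_in_level mono_homD(2)[OF f] mono_homD(2)[OF g]
      by (simp add: tm(2) AB.D.level_closed AB.E.level_closed)
    show "tensor_map C D f g (tens A B (chain A i) (chain B i)) = chain (C \<boxtimes> D) i" for i
      by (simp add: tm(2) mono_homD(3)[OF f] mono_homD(3)[OF g] mtensor_simps)
  qed
qed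

lemma mono_hom_unit_left:
  assumes "mono_star_algebra D"
  shows "tensor_unit_left D \<in> mono_hom (complex_mono \<boxtimes> D) D"
    "\<And>a b. b \<in> carrier D \<Longrightarrow> tensor_unit_left D (tens complex_mono D a b) = a \<odot>\<^bsub>D\<^esub> b"
proof -
  interpret D: mono_star_algebra D by fact
  interpret C: closable_algebra complex_mono by (rule closable_algebra_complex)
  interpret CD: mono_tensor complex_mono D ..
  have bil: "bilin_map complex_mono D D (\<lambda>c a. c \<odot>\<^bsub>D\<^esub> a)"
    by (auto simp: bilin_map_def lin_map_def D.scale_add_left D.scale_add_right D.scale_scale mult.commute)
  show tens: "tensor_unit_left D (tens complex_mono D a b) = a \<odot>\<^bsub>D\<^esub> b" if "b \<in> carrier D" for a b
    unfolding tensor_unit_left_def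
    by (rule CD.tensor_lift_tens[OF D.unital_star_algebra_axioms bil _ that]) simp
  show "tensor_unit_left D \<in> mono_hom (complex_mono \<boxtimes> D) D"
  proof (rule CD.mono_hom_tensorI[OF assms])
    show "tensor_unit_left D \<in> star_hom CD.AB D"
      unfolding tensor_unit_left_def
      by (rule CD.tensor_lift_star_hom[OF D.unital_star_algebra_axioms bil])
        (simp_all add: D.smult_mult_left D.smult_mult_right D.scale_scale D.star_smult mult.commute)
    show "tensor_unit_left D (tens complex_mono D a b) \<in> level D m"
      if "a \<in> level complex_mono m" "b \<in> level D m" for a b m
      using that by (simp only: tens D.level_closed D.star_subalgebraD(6)[OF D.level_subalgebra])
    show "tensor_unit_left D (tens complex_mono D (chain complex_mono i) (chain D i)) = chain D i" for i
      unfolding tens[OF D.chain_closed] by (simp add: D.chain_zero)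
  qed
qed

lemma mono_hom_unit_right:
  assumes "mono_star_algebra D"
  shows "tensor_unit_right D \<in> mono_hom (D \<boxtimes> complex_mono) D"
    "\<And>a b. a \<in> carrier D \<Longrightarrow> tensor_unit_right D (tens D complex_mono a b) = b \<odot>\<^bsub>D\<^esub> a"
proof -
  interpret D: mono_star_algebra D by fact
  interpret C: closable_algebra complex_mono by (rule closable_algebra_complex)
  interpret DC: mono_tensor D complex_mono ..
  have bil: "bilin_map D complex_mono D (\<lambda>a c. c \<odot>\<^bsub>D\<^esub> a)"
    by (auto simp: bilin_map_def lin_map_def D.scale_add_left D.scale_add_right D.scale_scale mult.commute)
  show tens: "tensor_unit_right D (tens D complex_mono a b) = b \<odot>\<^bsub>D\<^esub> a" if "a \<in> carrier D" for a b
    unfolding tensor_unit_right_def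
    by (rule DC.tensor_lift_tens[OF D.unital_star_algebra_axioms bil that]) simp
  show "tensor_unit_right D \<in> mono_hom (D \<boxtimes> complex_mono) D"
  proof (rule DC.mono_hom_tensorI[OF assms])
    show "tensor_unit_right D \<in> star_hom DC.AB D"
      unfolding tensor_unit_right_def
      by (rule DC.tensor_lift_star_hom[OF D.unital_star_algebra_axioms bil])
        (simp_all add: D.smult_mult_left D.smult_mult_right D.scale_scale D.star_smult mult.commute)
    show "tensor_unit_right D (tens D complex_mono a b) \<in> level D m"
      if "a \<in> level D m" "b \<in> level complex_mono m" for a b m
      using that by (simp only: tens D.level_closed D.star_subalgebraD(6)[OF D.level_subalgebra])
    show "tensor_unit_right D (tens D complex_mono (chain D i) (chain complex_mono i)) = chain D i" for i
      unfolding tens[OF D.chain_closed] by (simp add: D.chain_zero)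
  qed
qed

text \<open>\<open>tensor_assoc\<close> is a lift of a lift: for fixed c the inner one is linear in
  t, but linearity in c is not built in. It is proved by induction on t, as are multiplicativity and
  compatibility with the involution, before the outer lift can be applied.\<close>

lemma mono_hom_tensor_assoc:
  fixes D :: "('a, 'm) mono_algebra_scheme"
  assumes D: "mono_star_algebra D" and DD: "mono_star_algebra (D \<boxtimes> D)"
    and D_DD: "mono_star_algebra (D \<boxtimes> D \<boxtimes> D)"
  shows "tensor_assoc D \<in> mono_hom ((D \<boxtimes> D) \<boxtimes> D) (D \<boxtimes> D \<boxtimes> D)"
    "\<And>a b c. \<lbrakk>a \<in> carrier D; b \<in> carrier D; c \<in> carrier D\<rbrakk> \<Longrightarrow>
       tensor_assoc D (tens (D \<boxtimes> D) D (tens D D a b) c) = tens D (D \<boxtimes> D) a (tens D D b c)"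
proof -
  interpret D: mono_star_algebra D by fact
  interpret DD: mono_star_algebra "D \<boxtimes> D" by fact
  interpret X: mono_star_algebra "D \<boxtimes> D \<boxtimes> D" by fact
  interpret T: mono_tensor D D ..
  interpret L: mono_tensor "D \<boxtimes> D" D ..
  interpret R: mono_tensor D "D \<boxtimes> D" ..
  let ?X = "D \<boxtimes> D \<boxtimes> D"
  let ?g = "\<lambda>c a b. tens D (D \<boxtimes> D) a (tens D D b c)"
  let ?f = "\<lambda>t c. tensor_lift ?X (?g c) t"
  note Xu = X.unital_star_algebra_axioms
  note DDs = mtensor_simps(1-7)[of D D]
  have cl: "tens D D a b \<in> carrier (D \<boxtimes> D)" if "a \<in> carrier D" "b \<in> carrier D" for a b
    using that by (simp add: DDs)
  have Xs: "?g c a b \<in> carrier ?X" if "a \<in> carrier D" "b \<in> carrier D" "c \<in> carrier D" for a b c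
    using that cl by (simp add: mtensor_simps(1)[of D "D \<boxtimes> D"])
  have bilR: "bilin_map D (D \<boxtimes> D) ?X (tens D (D \<boxtimes> D))"
    using R.bilin_tens by (simp add: bilin_map_def lin_map_mtensor)
  have bilg: "bilin_map D D ?X (?g c)" if c: "c \<in> carrier D" for c
  proof (rule bilin_map_comp[OF bilR])
    show "lin_map D D (\<lambda>a. a)" by (simp add: lin_map_def)
    show "lin_map D (D \<boxtimes> D) (\<lambda>b. tens D D b c)"
      using T.bilin_tens c by (simp add: bilin_map_def lin_map_mtensor)
  qed
  have f_tens: "?f (tens D D a b) c = ?g c a b"
    if "a \<in> carrier D" "b \<in> carrier D" "c \<in> carrier D" for a b c
    by (rule T.tensor_lift_tens[OF Xu bilg]) (use that in auto)
  have f_lin: "lin_map T.AB ?X (\<lambda>t. ?f t c)" if "c \<in> carrier D" for c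
    using T.lin_map_tensor_lift[OF Xu bilg[OF that]] by simp
  note fl = lin_mapD[OF f_lin]
  have f_add: "?f t (c \<oplus>\<^bsub>D\<^esub> d) = ?f t c \<oplus>\<^bsub>?X\<^esub> ?f t d"
    if t: "t \<in> carrier T.AB" and cd: "c \<in> carrier D" "d \<in> carrier D" for t c d
    using t
  proof (induction rule: T.tensor_induct)
    case (tens a b)
    have "tens D D b (c \<oplus>\<^bsub>D\<^esub> d) = tens D D b c \<oplus>\<^bsub>D \<boxtimes> D\<^esub> tens D D b d"
      using tens cd by (simp add: T.tens_bilin DDs)
    thus ?case using tens cd cl bilin_mapD(3)[OF bilR] by (simp add: f_tens)
  next
    case (add s t)
    thus ?case using cd by (simp add: fl X.a_ac)
  qed
  have f_scale: "?f t (r \<odot>\<^bsub>D\<^esub> c) = r \<odot>\<^bsub>?X\<^esub> ?f t c"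
    if t: "t \<in> carrier T.AB" and c: "c \<in> carrier D" for t c r
    using t
  proof (induction rule: T.tensor_induct)
    case (tens a b)
    have "tens D D b (r \<odot>\<^bsub>D\<^esub> c) = r \<odot>\<^bsub>D \<boxtimes> D\<^esub> tens D D b c"
      using tens c by (simp add: T.tens_bilin DDs)
    thus ?case using tens c cl bilin_mapD(5)[OF bilR] by (simp add: f_tens)
  next
    case (add s t)
    thus ?case using c by (simp add: fl X.scale_add_right)
  qed
  have bil: "bilin_map (D \<boxtimes> D) D ?X ?f"
  proof (rule bilin_mapI)
    show "lin_map D ?X (?f t)" if "t \<in> carrier (D \<boxtimes> D)" for t
      using that f_add f_scale fl by (simp add: lin_map_def DDs)
    show "lin_map (D \<boxtimes> D) ?X (\<lambda>t. ?f t c)" if "c \<in> carrier D" for c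
      using f_lin[OF that] by (simp add: lin_map_mtensor)
  qed
  have g_mult: "?g (c \<otimes>\<^bsub>D\<^esub> c') (a \<otimes>\<^bsub>D\<^esub> a') (b \<otimes>\<^bsub>D\<^esub> b') = ?g c a b \<otimes>\<^bsub>?X\<^esub> ?g c' a' b'"
    if "a \<in> carrier D" "a' \<in> carrier D" "b \<in> carrier D" "b' \<in> carrier D" "c \<in> carrier D" "c' \<in> carrier D"
    for a a' b b' c c'
  proof -
    have "tens D D (b \<otimes>\<^bsub>D\<^esub> b') (c \<otimes>\<^bsub>D\<^esub> c') = tens D D b c \<otimes>\<^bsub>D \<boxtimes> D\<^esub> tens D D b' c'"
      using that by (simp add: T.tens_mult DDs)
    thus ?thesis using that cl by (simp add: mtensor_simps(2)[of D "D \<boxtimes> D"] R.tens_mult)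
  qed
  have f_mult: "?f (s \<otimes>\<^bsub>T.AB\<^esub> t) (c \<otimes>\<^bsub>D\<^esub> d) = ?f s c \<otimes>\<^bsub>?X\<^esub> ?f t d"
    if s: "s \<in> carrier T.AB" and t: "t \<in> carrier T.AB" and cd: "c \<in> carrier D" "d \<in> carrier D" for s t c d
    using s
  proof (induction rule: T.tensor_induct)
    case (tens a b)
    show ?case using t
    proof (induction rule: T.tensor_induct)
      case (tens a' b')
      thus ?case using \<open>a \<in> carrier D\<close> \<open>b \<in> carrier D\<close> cd by (simp add: T.tens_mult f_tens g_mult)
    next
      case (add t t')
      thus ?case using tens cd by (simp add: T.AB.r_distr fl X.r_distr)
    qed
  next
    case (add s s')
    thus ?case using cd t by (simp add: T.AB.l_distr fl X.l_distr)
  qed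
  have f_star: "?f (star T.AB t) (star D c) = star ?X (?f t c)"
    if t: "t \<in> carrier T.AB" and c: "c \<in> carrier D" for t c
    using t
  proof (induction rule: T.tensor_induct)
    case (tens a b)
    have "tens D D (star D b) (star D c) = star (D \<boxtimes> D) (tens D D b c)"
      using tens c by (simp add: T.tens_star DDs)
    thus ?case using tens c cl
      by (simp add: T.tens_star f_tens mtensor_simps(7)[of D "D \<boxtimes> D"] R.tens_star)
  next
    case (add s t)
    thus ?case using c by (simp add: T.AB.star_add fl X.star_add)
  qed
  have f_one: "?f \<one>\<^bsub>T.AB\<^esub> \<one>\<^bsub>D\<^esub> = \<one>\<^bsub>?X\<^esub>"
    using f_tens[of "\<one>\<^bsub>D\<^esub>" "\<one>\<^bsub>D\<^esub>" "\<one>\<^bsub>D\<^esub>"] T.tens_one R.tens_one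
    by (simp add: DDs mtensor_simps(3)[of D "D \<boxtimes> D"])
  show tens: "tensor_assoc D (tens (D \<boxtimes> D) D (tens D D a b) c) = ?g c a b"
    if "a \<in> carrier D" "b \<in> carrier D" "c \<in> carrier D" for a b c
    unfolding tensor_assoc_def
    using L.tensor_lift_tens[OF Xu bil cl[OF that(1,2)] that(3)] f_tens[OF that] by simp
  show "tensor_assoc D \<in> mono_hom ((D \<boxtimes> D) \<boxtimes> D) ?X"
  proof (rule L.mono_hom_tensorI[OF D_DD])
    show "tensor_assoc D \<in> star_hom L.AB ?X"
      unfolding tensor_assoc_def
      by (rule L.tensor_lift_star_hom[OF Xu bil]) (use f_mult f_star f_one in \<open>simp_all add: DDs\<close>)
    show "tensor_assoc D (tens (D \<boxtimes> D) D (chain (D \<boxtimes> D) i) (chain D i)) = chain ?X i" for i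
      unfolding mtensor_simps(9)[of D D] mtensor_simps(9)[of D "D \<boxtimes> D"]
      by (rule tens) simp_all
    fix m s c assume s: "s \<in> level (D \<boxtimes> D) m" and c: "c \<in> level D m"
    have cc: "c \<in> carrier D" using c by (rule D.level_closed)
    \<comment> \<open>An element of the inner level is a sum of elementary tensors in general, so c
      is frozen and the span argument is applied to the remaining variable.\<close>
    have "(\<lambda>t. ?f t c) ` level (D \<boxtimes> D) m \<subseteq> level ?X m"
      unfolding T.level_tensor
    proof (rule lin_map_image_lin_span[OF DD.unital_star_algebra_axioms Xu _ T.level_gens
        X.star_subalgebra_submodule[OF X.level_subalgebra]])
      show "lin_map (D \<boxtimes> D) ?X (\<lambda>t. ?f t c)" using f_lin[OF cc] by (simp add: lin_map_mtensor)
      fix x assume "x \<in> {tens D D a b |a b. a \<in> level D m \<and> b \<in> level D m}"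
      then obtain a b where ab: "x = tens D D a b" "a \<in> level D m" "b \<in> level D m" by auto
      show "?f x c \<in> level ?X m"
        unfolding ab(1) f_tens[OF D.level_closed[OF ab(2)] D.level_closed[OF ab(3)] cc]
        by (intro R.tens_in_level T.tens_in_level ab c)
    qed
    moreover have "tensor_assoc D (tens (D \<boxtimes> D) D s c) = ?f s c"
      unfolding tensor_assoc_def
      by (rule L.tensor_lift_tens[OF Xu bil DD.level_closed[OF s] cc])
    ultimately show "tensor_assoc D (tens (D \<boxtimes> D) D s c) \<in> level ?X m" using s by auto
  qed
qed

section \<open>The bialgebra generated by a set\<close>

lemma F0_simps:
  "carrier (F0 G) = carrier (F0_algebra G)" "mult (F0 G) = mult (F0_algebra G)"
  "one (F0 G) = one (F0_algebra G)" "zero (F0 G) = zero (F0_algebra G)"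
  "add (F0 G) = add (F0_algebra G)" "smult (F0 G) = smult (F0_algebra G)"
  "star (F0 G) = star (F0_algebra G)" "level (F0 G) = F0_level G" "chain (F0 G) = F0_q G"
  by (simp_all add: F0_def star_algebra.extend_def mono_algebra.fields_def)

section \<open>The presentation by generators and relations\<close>

context
  fixes G :: "'g set"
begin

private abbreviation (input) "word_monoid \<equiv> \<lparr>carrier = lists (fgens G \<times> (UNIV :: bool set)), mult = (@), one = []\<rparr>"
private abbreviation (input) "word_star \<equiv> (\<lambda>w :: 'g fword. rev (map (\<lambda>(g, b). (g, \<not> b)) w))"
private abbreviation (input) "FA \<equiv> free_star_algebra G"
private abbreviation (input) "FI \<equiv> F0_ideal G"

lemma star_monoid_words: "star_monoid word_monoid word_star"
proof -
  have [simp]: "(case case p of (g, b) \<Rightarrow> (g, \<not> b) of (g, b) \<Rightarrow> (g, \<not> b)) = p" for p :: "'g fgen \<times> bool"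
    by (cases p) simp
  have "monoid word_monoid" by (rule monoidI) (auto simp: lists_eq_set)
  thus ?thesis
    by (intro star_monoid.intro star_monoid_axioms.intro)
      (auto simp: lists_eq_set rev_map comp_def)
qed

lemma unital_star_algebra_free: "unital_star_algebra FA"
  unfolding free_star_algebra_def
  by (rule star_monoid.unital_star_algebra_monoid_algebra[OF star_monoid_words])

interpretation FA: unital_star_algebra FA
  by (rule unital_star_algebra_free)

lemma free_simps:
  "\<one>\<^bsub>FA\<^esub> = Poly_Mapping.single [] 1" "zero FA = 0" "add FA = (+)"
  "smult FA = (\<lambda>c. Poly_Mapping.map ((*) c))"
  "Poly_Mapping.single u a \<otimes>\<^bsub>FA\<^esub> Poly_Mapping.single v b = Poly_Mapping.single (u @ v) (a * b)"
  "star FA (letter g t) = letter g (\<not> t)"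
  by (simp_all add: free_star_algebra_def monoid_algebra_simps monoid_algebra_mult_single
      monoid_algebra_star_single letter_def)

lemma free_minus: "\<lbrakk>x \<in> carrier FA; y \<in> carrier FA\<rbrakk> \<Longrightarrow> x \<ominus>\<^bsub>FA\<^esub> y = x - y"
  by (simp add: FA.minus_eq FA.uminus_eq_scale)
    (auto simp: free_simps lookup_add lookup_minus intro!: poly_mapping_eqI)

lemma letter_closed [simp]: "g \<in> fgens G \<Longrightarrow> letter g b \<in> carrier FA"
  by (simp add: letter_def free_star_algebra_def monoid_algebra_simps)

lemma fgens_simps [simp]:
  "Xp X k \<in> fgens G \<longleftrightarrow> X \<in> G \<and> 1 \<le> k" "Xpp X k \<in> fgens G \<longleftrightarrow> X \<in> G \<and> 1 \<le> k"
  "Pj k \<in> fgens G \<longleftrightarrow> 1 \<le> k"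
  by (auto simp: fgens_def)

lemma free_q_0: "free_q 0 = (0 :: 'g fword \<Rightarrow>\<^sub>0 complex)"
  by (simp add: free_q_def)

lemma free_q_Suc: "free_q (Suc m) = free_q m \<oplus>\<^bsub>FA\<^esub> letter (Pj (Suc m)) False"
  by (simp add: free_q_def free_simps)

lemma free_q_closed [simp]: "free_q m \<in> carrier FA"
proof (induction m)
  case 0 show ?case using FA.zero_closed by (simp add: free_q_0 free_simps)
next
  case (Suc m) thus ?case unfolding free_q_Suc by simp
qed

lemma free_star_subalgebra_eq:
  assumes S: "star_subalgebra FA S" and gens: "\<And>g. g \<in> fgens G \<Longrightarrow> letter g False \<in> S"
  shows "carrier FA \<subseteq> S"
proof
  note SD = FA.star_subalgebraD[OF S]
  have letters: "letter g b \<in> S" if "g \<in> fgens G" for g b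
    using gens[OF that] SD(7)[OF gens[OF that]] by (cases b) (simp_all add: free_simps)
  have words: "Poly_Mapping.single w 1 \<in> S" if "w \<in> lists (fgens G \<times> UNIV)" for w
    using that
  proof (induction w)
    case Nil show ?case using SD(2) by (simp add: free_simps)
  next
    case (Cons p w)
    obtain g b where p: "p = (g, b)" by (cases p)
    have "letter g b \<otimes>\<^bsub>FA\<^esub> Poly_Mapping.single w 1 \<in> S" using Cons p by (intro SD(5) letters) auto
    thus ?case by (simp add: letter_def free_simps p)
  qed
  fix f assume "f \<in> carrier FA"
  hence "f \<in> carrier (monoid_algebra word_monoid word_star)" by (simp add: free_star_algebra_def)
  thus "f \<in> S"
  proof (induction rule: monoid_algebra_induct)
    case zero show ?case using SD(3) by (simp add: free_simps)
  next
    case (single w c)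
    have "c \<odot>\<^bsub>FA\<^esub> Poly_Mapping.single w 1 \<in> S" using single by (intro SD(6) words) simp
    thus ?case by (simp add: free_simps)
  next
    case (add f g)
    thus ?case using SD(4)[of f g] by (simp add: free_simps)
  qed
qed

text \<open>Differences of formal sums are replaced by the subtraction of the ring
  \<open>FA\<close>, for which homomorphism and ideal rules are available; the two agree on the
  carrier.\<close>

lemma F0_relations_cases [consumes 1, case_names X1 PP PS Xp Xpp XX]:
  assumes "r \<in> F0_relations G"
  obtains X where "X \<in> G" "r = letter (Xpp X 1) False"
  | k l where "1 \<le> k" "1 \<le> l"
      "r = letter (Pj k) False \<otimes>\<^bsub>FA\<^esub> letter (Pj l) False \<ominus>\<^bsub>FA\<^esub> (if k = l then letter (Pj k) False else \<zero>\<^bsub>FA\<^esub>)"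
  | k where "1 \<le> k" "r = letter (Pj k) True \<ominus>\<^bsub>FA\<^esub> letter (Pj k) False"
  | X k m b where "X \<in> G" "1 \<le> k" "k < m" "r = (\<one>\<^bsub>FA\<^esub> \<ominus>\<^bsub>FA\<^esub> free_q m) \<otimes>\<^bsub>FA\<^esub> letter (Xp X k) b"
  | X k m b where "X \<in> G" "1 \<le> k" "k < m" "r = (\<one>\<^bsub>FA\<^esub> \<ominus>\<^bsub>FA\<^esub> free_q m) \<otimes>\<^bsub>FA\<^esub> letter (Xpp X k) b"
  | X k m b where "X \<in> G" "1 \<le> k" "m < k" "r = free_q m \<otimes>\<^bsub>FA\<^esub> (letter (Xp X k) b \<ominus>\<^bsub>FA\<^esub> letter (Xpp X k) b)"
proof -
  note T = that
  consider (1) X where "X \<in> G" "r = letter (Xpp X 1) False"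
  | (2) k l where "1 \<le> k" "1 \<le> l"
      "r = letter (Pj k) False \<otimes>\<^bsub>FA\<^esub> letter (Pj l) False - (if k = l then letter (Pj k) False else 0)"
  | (3) k where "1 \<le> k" "r = star FA (letter (Pj k) False) - letter (Pj k) False"
  | (4) X k m b where "X \<in> G" "1 \<le> k" "k < m" "r = (\<one>\<^bsub>FA\<^esub> - free_q m) \<otimes>\<^bsub>FA\<^esub> letter (Xp X k) b"
  | (5) X k m b where "X \<in> G" "1 \<le> k" "k < m" "r = (\<one>\<^bsub>FA\<^esub> - free_q m) \<otimes>\<^bsub>FA\<^esub> letter (Xpp X k) b"
  | (6) X k m b where "X \<in> G" "1 \<le> k" "m < k" "r = free_q m \<otimes>\<^bsub>FA\<^esub> (letter (Xp X k) b - letter (Xpp X k) b)"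
    using assms unfolding F0_relations_def Let_def by blast
  thus thesis
  proof cases
    case (1 X) thus ?thesis by (rule T(1))
  next
    case (2 k l)
    have c: "(if k = l then letter (Pj k) False else 0) \<in> carrier FA"
      using FA.zero_closed 2 by (simp add: free_simps(2))
    have "r = letter (Pj k) False \<otimes>\<^bsub>FA\<^esub> letter (Pj l) False \<ominus>\<^bsub>FA\<^esub> (if k = l then letter (Pj k) False else \<zero>\<^bsub>FA\<^esub>)"
      unfolding 2(3) free_simps(2) using 2 by (intro free_minus[symmetric] c) simp
    with 2 show ?thesis by (intro T(2))
  next
    case (3 k)
    thus ?thesis by (intro T(3)[of k]) (simp_all add: free_minus free_simps)
  next
    case (4 X k m b)
    thus ?thesis by (intro T(4)[of X k m b]) (simp_all add: free_minus)
  next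
    case (5 X k m b)
    thus ?thesis by (intro T(5)[of X k m b]) (simp_all add: free_minus)
  next
    case (6 X k m b)
    thus ?thesis by (intro T(6)[of X k m b]) (simp_all add: free_minus)
  qed
qed

lemma F0_relationsI:
  "X \<in> G \<Longrightarrow> letter (Xpp X 1) False \<in> F0_relations G"
  "\<lbrakk>1 \<le> k; 1 \<le> l\<rbrakk> \<Longrightarrow> letter (Pj k) False \<otimes>\<^bsub>FA\<^esub> letter (Pj l) False \<ominus>\<^bsub>FA\<^esub>
     (if k = l then letter (Pj k) False else \<zero>\<^bsub>FA\<^esub>) \<in> F0_relations G"
  "1 \<le> k \<Longrightarrow> letter (Pj k) True \<ominus>\<^bsub>FA\<^esub> letter (Pj k) False \<in> F0_relations G"
  "\<lbrakk>X \<in> G; 1 \<le> k; k < m\<rbrakk> \<Longrightarrow> (\<one>\<^bsub>FA\<^esub> \<ominus>\<^bsub>FA\<^esub> free_q m) \<otimes>\<^bsub>FA\<^esub> letter (Xp X k) b \<in> F0_relations G"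
  "\<lbrakk>X \<in> G; 1 \<le> k; k < m\<rbrakk> \<Longrightarrow> (\<one>\<^bsub>FA\<^esub> \<ominus>\<^bsub>FA\<^esub> free_q m) \<otimes>\<^bsub>FA\<^esub> letter (Xpp X k) b \<in> F0_relations G"
  "\<lbrakk>X \<in> G; 1 \<le> k; m < k\<rbrakk> \<Longrightarrow>
     free_q m \<otimes>\<^bsub>FA\<^esub> (letter (Xp X k) b \<ominus>\<^bsub>FA\<^esub> letter (Xpp X k) b) \<in> F0_relations G"
proof -
  show "X \<in> G \<Longrightarrow> letter (Xpp X 1) False \<in> F0_relations G"
    unfolding F0_relations_def Let_def by blast
  show "letter (Pj k) False \<otimes>\<^bsub>FA\<^esub> letter (Pj l) False \<ominus>\<^bsub>FA\<^esub>
     (if k = l then letter (Pj k) False else \<zero>\<^bsub>FA\<^esub>) \<in> F0_relations G" if kl: "1 \<le> k" "1 \<le> l"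
  proof -
    have "(if k = l then letter (Pj k) False else 0) \<in> carrier FA"
      using FA.zero_closed kl by (simp add: free_simps(2))
    hence "letter (Pj k) False \<otimes>\<^bsub>FA\<^esub> letter (Pj l) False \<ominus>\<^bsub>FA\<^esub> (if k = l then letter (Pj k) False else \<zero>\<^bsub>FA\<^esub>) =
      letter (Pj k) False \<otimes>\<^bsub>FA\<^esub> letter (Pj l) False - (if k = l then letter (Pj k) False else 0)"
      unfolding free_simps(2) using kl by (intro free_minus) simp_all
    thus ?thesis using kl unfolding F0_relations_def Let_def by blast
  qed
  show "letter (Pj k) True \<ominus>\<^bsub>FA\<^esub> letter (Pj k) False \<in> F0_relations G" if k: "1 \<le> k"
  proof -
    have "letter (Pj k) True \<ominus>\<^bsub>FA\<^esub> letter (Pj k) False = star FA (letter (Pj k) False) - letter (Pj k) False"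
      using k by (simp add: free_minus free_simps)
    thus ?thesis using k unfolding F0_relations_def Let_def by blast
  qed
  show "(\<one>\<^bsub>FA\<^esub> \<ominus>\<^bsub>FA\<^esub> free_q m) \<otimes>\<^bsub>FA\<^esub> letter (Xp X k) b \<in> F0_relations G"
    "(\<one>\<^bsub>FA\<^esub> \<ominus>\<^bsub>FA\<^esub> free_q m) \<otimes>\<^bsub>FA\<^esub> letter (Xpp X k) b \<in> F0_relations G" if "X \<in> G" "1 \<le> k" "k < m"
    using that unfolding free_minus[OF FA.one_closed free_q_closed] F0_relations_def Let_def by blast+
  show "free_q m \<otimes>\<^bsub>FA\<^esub> (letter (Xp X k) b \<ominus>\<^bsub>FA\<^esub> letter (Xpp X k) b) \<in> F0_relations G"
    if X: "X \<in> G" "1 \<le> k" "m < k"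
  proof -
    have eq: "letter (Xp X k) b \<ominus>\<^bsub>FA\<^esub> letter (Xpp X k) b = letter (Xp X k) b - letter (Xpp X k) b"
      using X by (simp add: free_minus)
    show ?thesis using X unfolding eq F0_relations_def Let_def by blast
  qed
qed

lemma F0_relations_closed: "r \<in> F0_relations G \<Longrightarrow> r \<in> carrier FA"
  by (cases rule: F0_relations_cases) auto

lemma F0_ideal_gens: "F0_relations G \<union> star FA ` F0_relations G \<subseteq> carrier FA"
  using F0_relations_closed by auto

lemma ideal_F0: "ideal FI FA"
  unfolding F0_ideal_def Let_def by (rule FA.genideal_ideal[OF F0_ideal_gens])

lemma F0_ideal_minimal: "\<lbrakk>ideal J FA; F0_relations G \<union> star FA ` F0_relations G \<subseteq> J\<rbrakk> \<Longrightarrow> FI \<subseteq> J"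
  unfolding F0_ideal_def Let_def by (rule FA.genideal_minimal)

lemma F0_relations_in_ideal: "F0_relations G \<union> star FA ` F0_relations G \<subseteq> FI"
  unfolding F0_ideal_def Let_def by (rule FA.genideal_self[OF F0_ideal_gens])

text \<open>The generating set was closed under adjoints by construction, and the elements whose
  adjoint lies in the ideal form an ideal containing it; minimality gives the claim.\<close>

lemma star_ideal_F0: "star_ideal FI FA"
proof (intro star_ideal.intro star_ideal_axioms.intro unital_star_algebra_free ideal_F0)
  interpret I: ideal FI FA by (rule ideal_F0)
  let ?J = "{x \<in> carrier FA. star FA x \<in> FI}"
  have neg: "a \<ominus>\<^bsub>FA\<^esub> b \<in> FI" if "a \<in> FI" "b \<in> FI" for a b
    using that by (simp add: FA.minus_eq)
  have "ideal ?J FA"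
  proof (rule idealI[OF FA.ring_axioms])
    have "submodule ?J complex_algebra FA"
      unfolding FA.submodule_iff
    proof (intro conjI ballI allI)
      fix c x assume x: "x \<in> ?J"
      have "cnj c \<odot>\<^bsub>FA\<^esub> star FA x = (cnj c \<odot>\<^bsub>FA\<^esub> \<one>\<^bsub>FA\<^esub>) \<otimes>\<^bsub>FA\<^esub> star FA x"
        using x by (simp add: FA.smult_mult_left)
      also have "\<dots> \<in> FI" using x by (intro I.I_l_closed) auto
      finally show "c \<odot>\<^bsub>FA\<^esub> x \<in> ?J" using x by (simp add: FA.star_smult)
    qed (auto simp: FA.star_add)
    thus "subgroup ?J (add_monoid FA)" by (rule submodule.axioms(1))
  qed (auto simp: FA.star_mult I.I_l_closed I.I_r_closed)
  moreover have "F0_relations G \<union> star FA ` F0_relations G \<subseteq> ?J"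
    using F0_relations_in_ideal F0_relations_closed by (auto simp: image_subset_iff)
  ultimately have "FI \<subseteq> ?J" by (rule F0_ideal_minimal)
  thus "star FA x \<in> FI" if "x \<in> FI" for x using that by auto
qed

interpretation I: star_ideal FI FA
  by (rule star_ideal_F0)

lemma unital_star_algebra_F0_algebra: "unital_star_algebra (F0_algebra G)"
  unfolding F0_algebra_def by (rule I.unital_star_algebra_quotient)

private abbreviation (input) "FD \<equiv> F0 G"
private abbreviation (input) "proj \<equiv> F0_class G"

lemma unital_star_algebra_F0: "unital_star_algebra FD"
proof -
  interpret unital_star_algebra "F0_algebra G" by (rule unital_star_algebra_F0_algebra)
  have "id \<in> star_hom (F0_algebra G) FD" by (rule star_homI) (simp_all add: F0_simps)
  thus ?thesis
    by (rule unital_star_algebra_image[OF unital_star_algebra_F0_algebra, rotated]) (simp_all add: F0_simps)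
qed

interpretation FD: unital_star_algebra FD
  by (rule unital_star_algebra_F0)

lemma F0_class_hom: "proj \<in> star_hom FA FD"
proof -
  have "proj = (+>\<^bsub>FA\<^esub>) FI" by (simp add: F0_class_def fun_eq_iff)
  thus ?thesis using I.quotient_hom by (simp add: star_hom_def ring_hom_def F0_simps F0_algebra_def)
qed

lemma F0_class_surj: "carrier FD = proj ` carrier FA"
  by (simp add: F0_simps F0_algebra_def I.quotient_simps F0_class_def image_def)

lemma F0_class_eq_zero: "x \<in> FI \<Longrightarrow> proj x = \<zero>\<^bsub>FD\<^esub>"
  using I.coset_eq_iff[of x "\<zero>\<^bsub>FA\<^esub>"] I.Icarr[of x]
    star_hom_zero[OF unital_star_algebra_free unital_star_algebra_F0 F0_class_hom]
  by (simp add: F0_class_def FA.minus_eq)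

lemma F0_class_relation: "r \<in> F0_relations G \<Longrightarrow> proj r = \<zero>\<^bsub>FD\<^esub>"
  using F0_relations_in_ideal by (intro F0_class_eq_zero) auto

lemmas F0_class_ops = star_homD[OF F0_class_hom]
  star_hom_minus[OF unital_star_algebra_free unital_star_algebra_F0 F0_class_hom]
  star_hom_zero[OF unital_star_algebra_free unital_star_algebra_F0 F0_class_hom]

lemma F0_gen_closed [simp]: "g \<in> fgens G \<Longrightarrow> F0_gen G g \<in> carrier FD"
  unfolding F0_gen_def by (rule F0_class_ops(1)) simp

lemma F0_class_letter:
  "g \<in> fgens G \<Longrightarrow> proj (letter g b) = (if b then star FD (F0_gen G g) else F0_gen G g)"
  using F0_class_ops(6)[of "letter g False"] by (simp add: F0_gen_def free_simps)

lemma F0_generated: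
  assumes S: "star_subalgebra FD S" and "\<And>g. g \<in> fgens G \<Longrightarrow> F0_gen G g \<in> S"
  shows "S = carrier FD"
proof -
  have "carrier FA \<subseteq> {f \<in> carrier FA. proj f \<in> S}"
    by (rule free_star_subalgebra_eq[OF star_subalgebra_vimage[OF unital_star_algebra_free
      unital_star_algebra_F0 F0_class_hom S]]) (use assms(2) in \<open>simp add: F0_gen_def\<close>)
  thus ?thesis using FD.star_subalgebraD(1)[OF S] unfolding F0_class_surj by auto
qed

section \<open>Calculation with projections and generators in the quotient\<close>

private abbreviation (input) "q n \<equiv> F0_q G (enat n)"
private abbreviation (input) "p k \<equiv> F0_gen G (Pj k)"
private abbreviation (input) "x' X k \<equiv> F0_gen G (Xp X k)"
private abbreviation (input) "x'' X k \<equiv> F0_gen G (Xpp X k)"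

lemma F0_q_finsum: "q n = (\<Oplus>\<^bsub>FD\<^esub>j\<in>{1..n}. p j)"
  by (simp add: F0_q_def finsum_def finprod_def F0_simps)

lemma F0_q_0: "q 0 = \<zero>\<^bsub>FD\<^esub>"
  by (simp add: F0_q_finsum)

lemma F0_q_Suc: "q (Suc n) = q n \<oplus>\<^bsub>FD\<^esub> p (Suc n)"
proof -
  have "{1..Suc n} = insert (Suc n) {1..n}" by auto
  moreover have "(\<lambda>j. p j) \<in> {1..n} \<rightarrow> carrier FD" by auto
  ultimately show ?thesis unfolding F0_q_finsum
    by (simp add: FD.finsum_insert FD.a_comm FD.finsum_closed)
qed

lemma F0_q_closed [simp]: "q n \<in> carrier FD"
  unfolding F0_q_finsum by (rule FD.finsum_closed) auto

lemma F0_class_free_q: "proj (free_q n) = q n"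
proof (induction n)
  case 0 show ?case using F0_class_ops(8) by (simp add: free_q_0 F0_q_0 free_simps)
next
  case (Suc n) thus ?case unfolding free_q_Suc F0_q_Suc by (simp add: F0_class_ops(3) F0_class_letter)
qed

lemma F0_p_mult: "\<lbrakk>1 \<le> k; 1 \<le> l\<rbrakk> \<Longrightarrow> p k \<otimes>\<^bsub>FD\<^esub> p l = (if k = l then p k else \<zero>\<^bsub>FD\<^esub>)"
  using F0_class_relation[OF F0_relationsI(2), of k l]
  by (simp add: F0_class_ops F0_class_letter split: if_splits)

lemma F0_p_star: "1 \<le> k \<Longrightarrow> star FD (p k) = p k"
  using F0_class_relation[OF F0_relationsI(3), of k] by (simp add: F0_class_ops F0_class_letter)

lemma F0_p_q_mult: "1 \<le> k \<Longrightarrow> p k \<otimes>\<^bsub>FD\<^esub> q m = (if k \<le> m then p k else \<zero>\<^bsub>FD\<^esub>)"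
proof (induction m)
  case (Suc m)
  have "p k \<otimes>\<^bsub>FD\<^esub> q (Suc m) = p k \<otimes>\<^bsub>FD\<^esub> q m \<oplus>\<^bsub>FD\<^esub> p k \<otimes>\<^bsub>FD\<^esub> p (Suc m)"
    using Suc.prems by (simp add: F0_q_Suc FD.r_distr)
  thus ?case
    using Suc by (cases "k \<le> m"; cases "k = Suc m") (simp_all add: F0_p_mult)
qed (simp add: F0_q_0)

lemma F0_q_mult: "q k \<otimes>\<^bsub>FD\<^esub> q m = q (min k m)"
proof (induction k)
  case 0 show ?case by (simp add: F0_q_0)
next
  case (Suc k)
  have "q (Suc k) \<otimes>\<^bsub>FD\<^esub> q m = q (min k m) \<oplus>\<^bsub>FD\<^esub> p (Suc k) \<otimes>\<^bsub>FD\<^esub> q m"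
    using Suc by (simp add: F0_q_Suc FD.l_distr)
  thus ?case
    by (cases "Suc k \<le> m") (simp_all add: F0_p_q_mult F0_q_Suc min.absorb1 min.absorb2)
qed

lemma F0_q_star: "star FD (q k) = q k"
  by (induction k) (simp_all add: F0_q_0 F0_q_Suc FD.star_add F0_p_star)

lemma F0_Xpp_1: "X \<in> G \<Longrightarrow> x'' X 1 = \<zero>\<^bsub>FD\<^esub>"
  using F0_class_relation[OF F0_relationsI(1), of X] by (simp add: F0_class_letter)

lemma F0_q_gen_mult:
  assumes "X \<in> G" "1 \<le> k" "k < m"
  shows "q m \<otimes>\<^bsub>FD\<^esub> x' X k = x' X k" "q m \<otimes>\<^bsub>FD\<^esub> x'' X k = x'' X k"
    "q m \<otimes>\<^bsub>FD\<^esub> star FD (x' X k) = star FD (x' X k)" "q m \<otimes>\<^bsub>FD\<^esub> star FD (x'' X k) = star FD (x'' X k)"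
proof -
  have *: "q m \<otimes>\<^bsub>FD\<^esub> y = y" if y: "y \<in> carrier FD" "(\<one>\<^bsub>FD\<^esub> \<ominus>\<^bsub>FD\<^esub> q m) \<otimes>\<^bsub>FD\<^esub> y = \<zero>\<^bsub>FD\<^esub>" for y
  proof -
    have "y \<ominus>\<^bsub>FD\<^esub> q m \<otimes>\<^bsub>FD\<^esub> y = \<zero>\<^bsub>FD\<^esub>"
      using y by (simp add: FD.minus_eq FD.l_distr FD.l_minus)
    thus ?thesis using y(1) by simp
  qed
  have "(\<one>\<^bsub>FD\<^esub> \<ominus>\<^bsub>FD\<^esub> q m) \<otimes>\<^bsub>FD\<^esub> proj (letter (Xp X k) b) = \<zero>\<^bsub>FD\<^esub>"
    "(\<one>\<^bsub>FD\<^esub> \<ominus>\<^bsub>FD\<^esub> q m) \<otimes>\<^bsub>FD\<^esub> proj (letter (Xpp X k) b) = \<zero>\<^bsub>FD\<^esub>" for b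
    using F0_class_relation[OF F0_relationsI(4)[OF assms, of b]] F0_class_relation[OF F0_relationsI(5)[OF assms, of b]] assms
    by (simp_all add: F0_class_ops F0_class_free_q)
  from this[of False] this[of True] show
    "q m \<otimes>\<^bsub>FD\<^esub> x' X k = x' X k" "q m \<otimes>\<^bsub>FD\<^esub> x'' X k = x'' X k"
    "q m \<otimes>\<^bsub>FD\<^esub> star FD (x' X k) = star FD (x' X k)" "q m \<otimes>\<^bsub>FD\<^esub> star FD (x'' X k) = star FD (x'' X k)"
    using assms by (simp_all add: F0_class_letter *)
qed

lemma F0_q_gen_mult_eq:
  assumes "X \<in> G" "1 \<le> k" "m < k"
  shows "q m \<otimes>\<^bsub>FD\<^esub> x' X k = q m \<otimes>\<^bsub>FD\<^esub> x'' X k"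
    "q m \<otimes>\<^bsub>FD\<^esub> star FD (x' X k) = q m \<otimes>\<^bsub>FD\<^esub> star FD (x'' X k)"
proof -
  have *: "q m \<otimes>\<^bsub>FD\<^esub> y = q m \<otimes>\<^bsub>FD\<^esub> z"
    if y: "y \<in> carrier FD" "z \<in> carrier FD" "q m \<otimes>\<^bsub>FD\<^esub> (y \<ominus>\<^bsub>FD\<^esub> z) = \<zero>\<^bsub>FD\<^esub>" for y z
  proof -
    have "q m \<otimes>\<^bsub>FD\<^esub> y \<ominus>\<^bsub>FD\<^esub> q m \<otimes>\<^bsub>FD\<^esub> z = \<zero>\<^bsub>FD\<^esub>"
      using y by (simp add: FD.minus_eq FD.r_distr FD.r_minus)
    thus ?thesis using y(1,2) by simp
  qed
  have "q m \<otimes>\<^bsub>FD\<^esub> (proj (letter (Xp X k) b) \<ominus>\<^bsub>FD\<^esub> proj (letter (Xpp X k) b)) = \<zero>\<^bsub>FD\<^esub>" for b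
    using F0_class_relation[OF F0_relationsI(6)[OF assms, of b]] assms
    by (simp add: F0_class_ops F0_class_free_q)
  from this[of False] this[of True] show
    "q m \<otimes>\<^bsub>FD\<^esub> x' X k = q m \<otimes>\<^bsub>FD\<^esub> x'' X k"
    "q m \<otimes>\<^bsub>FD\<^esub> star FD (x' X k) = q m \<otimes>\<^bsub>FD\<^esub> star FD (x'' X k)"
    using assms by (simp_all add: F0_class_letter *)
qed

lemma F0_p_eq: "1 \<le> k \<Longrightarrow> p k = q k \<ominus>\<^bsub>FD\<^esub> q (k - 1)"
proof -
  assume "1 \<le> k"
  then obtain n where k: "k = Suc n" by (cases k) auto
  show ?thesis unfolding k F0_q_Suc using FD.a_comm[of "q n" "p (Suc n)"]
    by (simp add: FD.minus_eq FD.a_assoc FD.r_neg)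
qed

text \<open>Agreement on the q_k gives agreement on p_k = q_k - q_{k-1}. For k = 1 this uses q_0 =
  0, where any two homomorphisms agree.\<close>

lemma F0_star_hom_eqI:
  assumes B: "unital_star_algebra B" and f: "f \<in> star_hom FD B" and g: "g \<in> star_hom FD B"
    and q: "\<And>k. 1 \<le> k \<Longrightarrow> f (q k) = g (q k)"
    and x: "\<And>X k. \<lbrakk>X \<in> G; 1 \<le> k\<rbrakk> \<Longrightarrow> f (x' X k) = g (x' X k)"
      "\<And>X k. \<lbrakk>X \<in> G; 1 \<le> k\<rbrakk> \<Longrightarrow> f (x'' X k) = g (x'' X k)"
    and "y \<in> carrier FD"
  shows "f y = g y"
proof -
  have q': "f (q k) = g (q k)" for k
    using q[of k] star_hom_zero[OF unital_star_algebra_F0 B f] star_hom_zero[OF unital_star_algebra_F0 B g]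
    by (cases "1 \<le> k") (simp_all add: F0_q_0 not_le)
  have p: "f (p k) = g (p k)" if "1 \<le> k" for k
    unfolding F0_p_eq[OF that]
    using star_hom_minus[OF unital_star_algebra_F0 B f] star_hom_minus[OF unital_star_algebra_F0 B g]
    by (simp add: q')
  have "{y \<in> carrier FD. f y = g y} = carrier FD"
  proof (rule F0_generated[OF star_subalgebra_equalizer[OF unital_star_algebra_F0 f g]])
    fix h :: "'g fgen" assume h: "h \<in> fgens G"
    thus "F0_gen G h \<in> {y \<in> carrier FD. f y = g y}" using p x by (cases h) auto
  qed
  thus ?thesis using assms(7) by auto
qed

text \<open>The universal property in terms of an increasing sequence of projections Q rather than
  orthogonal ones, since the comultiplication and the characters are given on the q_k. Words are
  evaluated letter by letter, the kernel of the linear extension is an ideal containing the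
  relations and their adjoints, and the map descends to cosets.\<close>

lemma F0_universal:
  fixes B :: "('b, 'm) star_algebra_scheme" (structure)
  assumes B: "unital_star_algebra B"
    and Q: "\<And>k. Q k \<in> carrier B" "Q 0 = \<zero>" "\<And>k l. Q k \<otimes> Q l = Q (min k l)" "\<And>k. star B (Q k) = Q k"
    and y: "\<And>X k. \<lbrakk>X \<in> G; 1 \<le> k\<rbrakk> \<Longrightarrow> y' X k \<in> carrier B" "\<And>X k. \<lbrakk>X \<in> G; 1 \<le> k\<rbrakk> \<Longrightarrow> y'' X k \<in> carrier B"
      "\<And>X. X \<in> G \<Longrightarrow> y'' X 1 = \<zero>"
    and Qy: "\<And>X k m. \<lbrakk>X \<in> G; 1 \<le> k; k < m\<rbrakk> \<Longrightarrow> Q m \<otimes> y' X k = y' X k"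
      "\<And>X k m. \<lbrakk>X \<in> G; 1 \<le> k; k < m\<rbrakk> \<Longrightarrow> Q m \<otimes> y'' X k = y'' X k"
      "\<And>X k m. \<lbrakk>X \<in> G; 1 \<le> k; k < m\<rbrakk> \<Longrightarrow> Q m \<otimes> star B (y' X k) = star B (y' X k)"
      "\<And>X k m. \<lbrakk>X \<in> G; 1 \<le> k; k < m\<rbrakk> \<Longrightarrow> Q m \<otimes> star B (y'' X k) = star B (y'' X k)"
    and Qyy: "\<And>X k m. \<lbrakk>X \<in> G; 1 \<le> k; m < k\<rbrakk> \<Longrightarrow> Q m \<otimes> y' X k = Q m \<otimes> y'' X k"
      "\<And>X k m. \<lbrakk>X \<in> G; 1 \<le> k; m < k\<rbrakk> \<Longrightarrow> Q m \<otimes> star B (y' X k) = Q m \<otimes> star B (y'' X k)"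
  obtains f where "f \<in> star_hom FD B" "\<And>k. f (q k) = Q k"
    "\<And>X k. \<lbrakk>X \<in> G; 1 \<le> k\<rbrakk> \<Longrightarrow> f (x' X k) = y' X k" "\<And>X k. \<lbrakk>X \<in> G; 1 \<le> k\<rbrakk> \<Longrightarrow> f (x'' X k) = y'' X k"
proof -
  interpret B: unital_star_algebra B by fact
  \<comment> \<open>The image of p_k is the increment of Q; together with Q 0 = 0 the partial sums
    telescope to Q k.\<close>
  define h where "h = (\<lambda>g. case g of Xp X k \<Rightarrow> y' X k | Xpp X k \<Rightarrow> y'' X k | Pj k \<Rightarrow> Q k \<ominus> Q (k - 1))"
  define hl where "hl = (\<lambda>(g, b). if b then star B (h g) else h g)"
  define hw where "hw = (\<lambda>w. foldr (\<lambda>l z. hl l \<otimes> z) w \<one>)"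
  have h: "h g \<in> carrier B" if "g \<in> fgens G" for g using that y(1,2) Q(1) by (cases g) (auto simp: h_def)
  have hl: "hl l \<in> carrier B" if "l \<in> fgens G \<times> UNIV" for l using that h by (auto simp: hl_def)
  have hw: "hw w \<in> carrier B" if "w \<in> lists (fgens G \<times> UNIV)" for w
    using that by (induction w) (auto simp: hw_def hl)
  have hw_Cons: "hw (l # w) = hl l \<otimes> hw w" "hw [] = \<one>" for l w by (simp_all add: hw_def)
  have hw_append: "hw (v @ w) = hw v \<otimes> hw w"
    if "v \<in> lists (fgens G \<times> UNIV)" "w \<in> lists (fgens G \<times> UNIV)" for v w
    using that by (induction v) (auto simp: hw_Cons hw hl B.m_assoc)
  have hw_star: "hw (word_star w) = star B (hw w)" if "w \<in> lists (fgens G \<times> UNIV)" for w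
    using that
  proof (induction w)
    case (Cons l w)
    obtain g b where l: "l = (g, b)" by (cases l)
    have g: "g \<in> fgens G" using Cons l by auto
    have ws: "word_star w \<in> lists (fgens G \<times> UNIV)" using Cons by (auto simp: lists_eq_set)
    have "hw (word_star (l # w)) = star B (hw w) \<otimes> hw [(g, \<not> b)]"
      using hw_append[OF ws, of "[(g, \<not> b)]"] Cons g by (simp add: l)
    also have "hw [(g, \<not> b)] = star B (hl l)" using h[OF g] by (simp add: hw_Cons hl_def l)
    finally show ?case using Cons hl hw by (simp add: hw_Cons B.star_mult)
  qed (simp add: hw_Cons)
  let ?F = "lin_ext B hw"
  have F: "?F \<in> star_hom FA B"
    unfolding free_star_algebra_def
    by (rule star_monoid.lin_ext_star_hom[OF star_monoid_words B])
      (use hw hw_append hw_star in \<open>auto simp: hw_Cons\<close>)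
  note F_ops = star_homD[OF F] star_hom_minus[OF unital_star_algebra_free B F]
    star_hom_zero[OF unital_star_algebra_free B F]
  have F_letter: "?F (letter g b) = (if b then star B (h g) else h g)" if "g \<in> fgens G" for g b
    using B.lin_ext_single[of hw "[(g, b)]" 1] hw[of "[(g, b)]"] h[OF that] that
    by (simp add: letter_def hw_Cons hl_def)
  have F_q: "?F (free_q k) = Q k" for k
  proof (induction k)
    case 0 show ?case using F_ops(8) Q(2) by (simp add: free_q_0 free_simps)
  next
    case (Suc k)
    have "Q k \<oplus> (Q (Suc k) \<ominus> Q k) = Q (Suc k)"
      using Q(1) B.a_lcomm[of "Q k" "Q (Suc k)" "\<ominus> Q k"] by (simp add: B.minus_eq B.r_neg)
    thus ?case unfolding free_q_Suc using Suc by (simp add: F_ops F_letter h_def)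
  qed
  \<comment> \<open>Orthogonality of increments: after expansion, minima of indices appear, and for
    k \<noteq> l the four terms cancel in pairs.\<close>
  have hP: "h (Pj k) \<otimes> h (Pj l) = (if k = l then h (Pj k) else \<zero>)" if "1 \<le> k" "1 \<le> l" for k l
  proof -
    have "h (Pj k) \<otimes> h (Pj l) = (Q (min k l) \<ominus> Q (min k (l - 1))) \<ominus> (Q (min (k - 1) l) \<ominus> Q (min (k - 1) (l - 1)))"
      using Q(1) by (simp add: h_def B.minus_eq B.l_distr B.r_distr B.l_minus B.r_minus Q(3) B.minus_add B.a_ac)
    also have "\<dots> = (if k = l then h (Pj k) else \<zero>)"
    proof (cases k l rule: linorder_cases)
      case less
      hence "min k l = k" "min k (l - 1) = k" "min (k - 1) l = k - 1" "min (k - 1) (l - 1) = k - 1" by auto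
      thus ?thesis using less Q(1) by (simp add: B.minus_eq B.r_neg)
    next
      case equal
      thus ?thesis using Q(1) by (simp add: h_def B.minus_eq B.r_neg)
    next
      case greater
      hence "min k l = l" "min k (l - 1) = l - 1" "min (k - 1) l = l" "min (k - 1) (l - 1) = l - 1"
        using that by auto
      thus ?thesis using greater Q(1) by (simp add: B.minus_eq B.r_neg)
    qed
    finally show ?thesis .
  qed
  have compl: "(\<one> \<ominus> Q m) \<otimes> z = \<zero>" if "z \<in> carrier B" "Q m \<otimes> z = z" for z m
    using that Q(1) by (simp add: B.minus_eq B.l_distr B.l_minus B.r_neg)
  have diff: "Q m \<otimes> (z \<ominus> w) = \<zero>" if "z \<in> carrier B" "w \<in> carrier B" "Q m \<otimes> z = Q m \<otimes> w" for z w m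
    using that Q(1) by (simp add: B.minus_eq B.r_distr B.r_minus B.r_neg)
  have rel: "?F r = \<zero>" if "r \<in> F0_relations G" for r
    using that
  proof (cases rule: F0_relations_cases)
    case (X1 X)
    thus ?thesis using y(3) by (simp add: F_letter h_def)
  next
    case (PP k l)
    thus ?thesis using hP[of k l] h[of "Pj k"] h[of "Pj l"] by (simp add: F_ops F_letter B.minus_eq B.r_neg)
  next
    case (PS k)
    thus ?thesis using Q by (simp add: F_ops F_letter h_def B.star_minus B.minus_eq[of "_ \<ominus> _"] B.r_neg)
  next
    case (Xp X k m b)
    thus ?thesis using y Qy by (cases b) (simp_all add: F_ops F_letter F_q h_def compl)
  next
    case (Xpp X k m b)
    thus ?thesis using y Qy by (cases b) (simp_all add: F_ops F_letter F_q h_def compl)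
  next
    case (XX X k m b)
    thus ?thesis using y Qyy by (cases b) (simp_all add: F_ops F_letter F_q h_def diff)
  qed
  let ?K = "{x \<in> carrier FA. ?F x = \<zero>}"
  have "ideal ?K FA"
  proof (rule idealI[OF FA.ring_axioms])
    have "submodule ?K complex_algebra FA"
      unfolding FA.submodule_iff by (auto simp: F_ops)
    thus "subgroup ?K (add_monoid FA)" by (rule submodule.axioms(1))
  qed (auto simp: F_ops)
  moreover have "F0_relations G \<union> star FA ` F0_relations G \<subseteq> ?K"
    using rel F0_relations_closed by (auto simp: F_ops)
  ultimately have K: "FI \<subseteq> ?K" by (rule F0_ideal_minimal)
  define f where "f = (\<lambda>U. the_elem (?F ` U))"
  have f: "f (proj x) = ?F x" if x: "x \<in> carrier FA" for x
  proof -
    have "?F ` proj x = {?F x}"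
    proof (intro equalityI subsetI)
      fix v assume "v \<in> ?F ` proj x"
      then obtain i where "i \<in> FI" "v = ?F (i \<oplus>\<^bsub>FA\<^esub> x)" by (auto simp: F0_class_def a_r_coset_def')
      thus "v \<in> {?F x}" using K x by (auto simp: F_ops)
    next
      have "x \<in> proj x" unfolding F0_class_def by (rule I.a_rcos_self[OF x])
      thus "v \<in> ?F ` proj x" if "v \<in> {?F x}" for v using that by auto
    qed
    thus ?thesis by (simp add: f_def)
  qed
  have hom: "f \<in> star_hom FD B"
  proof (rule star_homI)
    fix a b assume "a \<in> carrier FD" "b \<in> carrier FD"
    then obtain u v where uv: "a = proj u" "b = proj v" "u \<in> carrier FA" "v \<in> carrier FA"
      unfolding F0_class_surj by auto
    show "f (a \<otimes>\<^bsub>FD\<^esub> b) = f a \<otimes> f b" "f (a \<oplus>\<^bsub>FD\<^esub> b) = f a \<oplus> f b"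
      using uv by (simp_all add: F0_class_ops(2,3)[symmetric] f F_ops)
  next
    fix a c assume "a \<in> carrier FD"
    then obtain u where u: "a = proj u" "u \<in> carrier FA" unfolding F0_class_surj by auto
    show "f a \<in> carrier B" "f (c \<odot>\<^bsub>FD\<^esub> a) = c \<odot> f a" "f (star FD a) = star B (f a)"
      using u by (simp_all add: F0_class_ops(5,6)[symmetric] f F_ops)
  next
    show "f \<one>\<^bsub>FD\<^esub> = \<one>" using f[OF FA.one_closed] by (simp add: F0_class_ops F_ops)
  qed
  show thesis
  proof (rule that[OF hom])
    show "f (q k) = Q k" for k using f[of "free_q k"] by (simp add: F0_class_free_q F_q)
    show "f (x' X k) = y' X k" "f (x'' X k) = y'' X k" if "X \<in> G" "1 \<le> k" for X k
      using f[of "letter (Xp X k) False"] f[of "letter (Xpp X k) False"] that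
      by (simp_all add: F0_class_letter F_letter h_def)
  qed
qed

text \<open>One-dimensional representations: for n \<ge> 1 the projection p_n goes to 1 and every
  other generator to 0. With all X'(k) and X''(k) sent to 0, only the relations among the
  projections carry content. The value n = 0 kills all q_k.\<close>

lemma F0_character:
  obtains \<chi> where "\<chi> \<in> star_hom FD complex_algebra" "\<And>k. \<chi> (q k) = (if 1 \<le> n \<and> n \<le> k then 1 else 0)"
    "\<And>X k. \<lbrakk>X \<in> G; 1 \<le> k\<rbrakk> \<Longrightarrow> \<chi> (x' X k) = 0" "\<And>X k. \<lbrakk>X \<in> G; 1 \<le> k\<rbrakk> \<Longrightarrow> \<chi> (x'' X k) = 0"
  by (rule F0_universal[of complex_algebra "\<lambda>k. if 1 \<le> n \<and> n \<le> k then 1 else 0" "\<lambda>_ _. 0" "\<lambda>_ _. 0"])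
    (auto simp: unital_star_algebra_complex)

lemma star_subalgebra_F0: "star_subalgebra FD S \<longleftrightarrow> star_subalgebra (F0_algebra G) S"
proof -
  interpret A: unital_star_algebra "F0_algebra G" by (rule unital_star_algebra_F0_algebra)
  show ?thesis
  proof
    assume S: "star_subalgebra FD S"
    show "star_subalgebra (F0_algebra G) S"
      by (rule A.star_subalgebraI) (use FD.star_subalgebraD[OF S] in \<open>auto simp: F0_simps\<close>)
  next
    assume S: "star_subalgebra (F0_algebra G) S"
    show "star_subalgebra FD S"
      by (rule FD.star_subalgebraI) (use A.star_subalgebraD[OF S] in \<open>auto simp: F0_simps\<close>)
  qed
qed

private abbreviation (input) "level_gens m \<equiv> {p j | j. 1 \<le> j} \<union> {x' X k | X k. X \<in> G \<and> 1 \<le> k \<and> k \<le> m} \<union>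
  {x'' X k | X k. X \<in> G \<and> 1 \<le> k \<and> k \<le> m}"

lemma F0_level: "F0_level G m = star_generated FD (level_gens m)"
  by (simp add: F0_level_def star_generated_def star_subalgebra_F0)

lemma F0_level_gens_closed: "level_gens m \<subseteq> carrier FD"
  by auto

lemma F0_level_subalgebra: "star_subalgebra FD (F0_level G m)"
  unfolding F0_level by (rule FD.star_subalgebra_star_generated[OF F0_level_gens_closed])

lemma F0_level_gens_level: "g \<in> level_gens m \<Longrightarrow> g \<in> F0_level G m"
  unfolding F0_level by (rule subsetD[OF FD.star_generated_superset])

lemma F0_q_level: "q n \<in> F0_level G m"
  unfolding F0_q_finsum
  by (rule FD.star_subalgebra_finsum[OF F0_level_subalgebra]) (auto intro!: F0_level_gens_level)

lemma F0_chain_infinity: "F0_q G \<infinity> = \<one>\<^bsub>FD\<^esub>"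
  by (simp add: F0_q_def F0_simps)

lemma F0_chain_closed: "F0_q G i \<in> carrier FD"
  by (cases i) (simp_all add: F0_chain_infinity)

lemma F0_chain_mult: "F0_q G i \<otimes>\<^bsub>FD\<^esub> F0_q G j = F0_q G (min i j)"
proof (cases i; cases j)
  fix k l assume "i = enat k" "j = enat l"
  thus ?thesis by (simp add: F0_q_mult)
qed (simp_all add: F0_chain_infinity)

text \<open>The character jumping at k + 1 is 0 at q_k and 1 at every later member of the chain; at
  \<infinity> this is unitality.\<close>

lemma inj_F0_q: "inj (F0_q G)"
proof -
  have less: "F0_q G i \<noteq> F0_q G j" if ij: "i < j" for i j
  proof -
    obtain k where k: "i = enat k" using ij by (cases i) auto
    obtain \<chi> where \<chi>: "\<chi> \<in> star_hom FD complex_algebra"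
      "\<And>l. \<chi> (q l) = (if 1 \<le> Suc k \<and> Suc k \<le> l then 1 else 0)"
      using F0_character[of "Suc k"] by metis
    have "\<chi> (F0_q G i) = 0" using \<chi>(2) by (simp add: k)
    moreover have "\<chi> (F0_q G j) = 1"
    proof (cases j)
      case (enat l) thus ?thesis using \<chi>(2) ij k by simp
    next
      case infinity thus ?thesis using star_homD(4)[OF \<chi>(1)] by (simp add: F0_chain_infinity)
    qed
    ultimately show ?thesis by auto
  qed
  show ?thesis by (rule injI) (metis less linorder_cases)
qed

lemma mono_star_algebra_F0: "mono_star_algebra FD"
proof (intro mono_star_algebra.intro mono_star_algebra_axioms.intro unital_star_algebra_F0; unfold F0_simps(8,9))
  show "star FD (F0_q G i) = F0_q G i" for i
    by (cases i) (simp_all add: F0_q_star F0_chain_infinity)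
  show "F0_q G 0 = \<zero>\<^bsub>FD\<^esub>" using F0_q_0 by (simp add: zero_enat_def)
  fix j assume "\<And>N. q N \<otimes>\<^bsub>FD\<^esub> F0_q G j = q N"
  hence "min (enat N) j = enat N" for N using inj_F0_q by (simp add: F0_chain_mult inj_eq)
  hence "enat N \<le> j" for N by (metis min.cobounded2)
  hence "j = \<infinity>" by (metis Suc_ile_eq enat.exhaust less_irrefl)
  thus "F0_q G j = \<one>\<^bsub>FD\<^esub>" by (simp add: F0_chain_infinity)
qed (simp_all add: F0_level_subalgebra F0_chain_closed F0_chain_mult F0_chain_infinity)

interpretation FD: mono_star_algebra FD
  by (rule mono_star_algebra_F0)

text \<open>The formulation is chosen so that the elements concerned form a *-subalgebra: the
  two-sided equation is preserved by adjoints, and validity for all M \<ge> N lets sums and products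
  use the larger of two thresholds. It then suffices to look at generators.\<close>

lemma F0_asymptotic_scalar:
  assumes "x \<in> carrier FD"
  shows "\<exists>a N. \<forall>M\<ge>N. x \<otimes>\<^bsub>FD\<^esub> (\<one>\<^bsub>FD\<^esub> \<ominus>\<^bsub>FD\<^esub> q M) = a \<odot>\<^bsub>FD\<^esub> (\<one>\<^bsub>FD\<^esub> \<ominus>\<^bsub>FD\<^esub> q M) \<and>
    (\<one>\<^bsub>FD\<^esub> \<ominus>\<^bsub>FD\<^esub> q M) \<otimes>\<^bsub>FD\<^esub> x = a \<odot>\<^bsub>FD\<^esub> (\<one>\<^bsub>FD\<^esub> \<ominus>\<^bsub>FD\<^esub> q M)"
proof -
  let ?e = "\<lambda>M. \<one>\<^bsub>FD\<^esub> \<ominus>\<^bsub>FD\<^esub> q M"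
  let ?P = "\<lambda>x a M. x \<otimes>\<^bsub>FD\<^esub> ?e M = a \<odot>\<^bsub>FD\<^esub> ?e M \<and> ?e M \<otimes>\<^bsub>FD\<^esub> x = a \<odot>\<^bsub>FD\<^esub> ?e M"
  let ?S = "{x \<in> carrier FD. \<exists>a N. \<forall>M\<ge>N. ?P x a M}"
  have e_star: "star FD (?e M) = ?e M" for M by (simp add: FD.star_minus F0_q_star)
  have "?S = carrier FD"
  proof (rule F0_generated[OF FD.star_subalgebraI])
    show "\<one>\<^bsub>FD\<^esub> \<in> ?S" by (auto intro!: exI[of _ 1])
    fix x assume "x \<in> ?S"
    then obtain a N where x: "x \<in> carrier FD" "\<And>M. M \<ge> N \<Longrightarrow> ?P x a M" by auto
    have "?P (c \<odot>\<^bsub>FD\<^esub> x) (c * a) M" if "M \<ge> N" for M c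
      using x that by (simp add: FD.smult_mult_left FD.smult_mult_right FD.scale_scale)
    thus "c \<odot>\<^bsub>FD\<^esub> x \<in> ?S" for c using x by blast
    have "?P (star FD x) (cnj a) M" if "M \<ge> N" for M
    proof -
      have "star FD (x \<otimes>\<^bsub>FD\<^esub> ?e M) = cnj a \<odot>\<^bsub>FD\<^esub> ?e M" "star FD (?e M \<otimes>\<^bsub>FD\<^esub> x) = cnj a \<odot>\<^bsub>FD\<^esub> ?e M"
        using x(2)[OF that] by (simp_all add: FD.star_smult e_star)
      thus ?thesis using x(1) by (simp add: FD.star_mult e_star)
    qed
    thus "star FD x \<in> ?S" using x(1) by blast
    fix y assume "y \<in> ?S"
    then obtain b K where y: "y \<in> carrier FD" "\<And>M. M \<ge> K \<Longrightarrow> ?P y b M" by auto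
    have "?P (x \<oplus>\<^bsub>FD\<^esub> y) (a + b) M" if "M \<ge> max N K" for M
      using x y that by (simp add: FD.l_distr FD.r_distr FD.scale_add_left)
    thus "x \<oplus>\<^bsub>FD\<^esub> y \<in> ?S" using x(1) y(1) by blast
    have "?P (x \<otimes>\<^bsub>FD\<^esub> y) (a * b) M" if "M \<ge> max N K" for M
    proof -
      have "x \<otimes>\<^bsub>FD\<^esub> (y \<otimes>\<^bsub>FD\<^esub> ?e M) = (a * b) \<odot>\<^bsub>FD\<^esub> ?e M" "(?e M \<otimes>\<^bsub>FD\<^esub> x) \<otimes>\<^bsub>FD\<^esub> y = (a * b) \<odot>\<^bsub>FD\<^esub> ?e M"
        using x y that by (simp_all add: FD.smult_mult_left FD.smult_mult_right FD.scale_scale mult.commute)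
      thus ?thesis using x(1) y(1) by (simp add: FD.m_assoc)
    qed
    thus "x \<otimes>\<^bsub>FD\<^esub> y \<in> ?S" using x(1) y(1) by blast
  next
    fix g assume g: "g \<in> fgens G"
    obtain N where N: "\<And>M. M \<ge> N \<Longrightarrow> q M \<otimes>\<^bsub>FD\<^esub> F0_gen G g = F0_gen G g \<and>
        q M \<otimes>\<^bsub>FD\<^esub> star FD (F0_gen G g) = star FD (F0_gen G g)"
    proof (cases g)
      case (Xp X k)
      \<comment> \<open>The defining relations give absorption of X'(k) by q_m only for m strictly
        above k, hence the threshold k + 1.\<close>
      show ?thesis by (rule that[of "Suc k"]) (use g F0_q_gen_mult[of X k] in \<open>simp add: Xp\<close>)
    next
      case (Xpp X k)
      show ?thesis by (rule that[of "Suc k"]) (use g F0_q_gen_mult[of X k] in \<open>simp add: Xpp\<close>)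
    next
      case (Pj k)
      have "q M \<otimes>\<^bsub>FD\<^esub> p k = p k" if "k \<le> M" for M
        using g that arg_cong[OF F0_p_q_mult[of k M], of "star FD"]
        by (simp add: Pj FD.star_mult F0_p_star F0_q_star)
      thus ?thesis by (intro that[of k]) (use g in \<open>simp add: Pj F0_p_star\<close>)
    qed
    \<comment> \<open>Generators have scalar 0 at infinity: absorption from the left is part of the
      relations, and absorption from the right is the adjoint of absorption for the adjoint
      generator.\<close>
    have "?P (F0_gen G g) 0 M" if "M \<ge> N" for M
    proof -
      have "F0_gen G g \<otimes>\<^bsub>FD\<^esub> q M = F0_gen G g"
        using N[OF that, THEN conjunct2, THEN arg_cong[of _ _ "star FD"]] g
        by (simp add: FD.star_mult F0_q_star)
      thus ?thesis using N[OF that] g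
        by (simp add: FD.minus_eq FD.l_distr FD.r_distr FD.l_minus FD.r_minus FD.r_neg)
    qed
    thus "F0_gen G g \<in> ?S" using F0_gen_closed[OF g] by blast
  qed auto
  thus ?thesis using assms by blast
qed

text \<open>The left-hand equation at infinity yields the approximation property: (1 - q_M) x q_L =
  a (1 - q_M) q_L = 0 as soon as M exceeds both the threshold and L. The character jumping at N + 1
  is the separating functional.\<close>

lemma closable_ample_F0: "closable_ample_algebra FD"
proof
  fix x assume x: "x \<in> carrier FD"
  obtain a N where aN: "\<And>M. M \<ge> N \<Longrightarrow> x \<otimes>\<^bsub>FD\<^esub> (\<one>\<^bsub>FD\<^esub> \<ominus>\<^bsub>FD\<^esub> q M) = a \<odot>\<^bsub>FD\<^esub> (\<one>\<^bsub>FD\<^esub> \<ominus>\<^bsub>FD\<^esub> q M) \<and>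
    (\<one>\<^bsub>FD\<^esub> \<ominus>\<^bsub>FD\<^esub> q M) \<otimes>\<^bsub>FD\<^esub> x = a \<odot>\<^bsub>FD\<^esub> (\<one>\<^bsub>FD\<^esub> \<ominus>\<^bsub>FD\<^esub> q M)"
    using F0_asymptotic_scalar[OF x] by blast
  show "\<exists>a N. x \<otimes>\<^bsub>FD\<^esub> (\<one>\<^bsub>FD\<^esub> \<ominus>\<^bsub>FD\<^esub> FD.c N) = a \<odot>\<^bsub>FD\<^esub> (\<one>\<^bsub>FD\<^esub> \<ominus>\<^bsub>FD\<^esub> FD.c N)"
    using aN[of N] by (auto simp: F0_simps(9))
  fix L
  let ?M = "max N L"
  have "(\<one>\<^bsub>FD\<^esub> \<ominus>\<^bsub>FD\<^esub> q ?M) \<otimes>\<^bsub>FD\<^esub> q L = \<zero>\<^bsub>FD\<^esub>"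
    by (simp add: FD.minus_eq FD.l_distr FD.l_minus F0_q_mult min.absorb2 FD.r_neg)
  hence "(\<one>\<^bsub>FD\<^esub> \<ominus>\<^bsub>FD\<^esub> q ?M) \<otimes>\<^bsub>FD\<^esub> x \<otimes>\<^bsub>FD\<^esub> q L = \<zero>\<^bsub>FD\<^esub>"
    using aN[of ?M] by (simp add: FD.smult_mult_left)
  hence "x \<otimes>\<^bsub>FD\<^esub> q L \<ominus>\<^bsub>FD\<^esub> q ?M \<otimes>\<^bsub>FD\<^esub> (x \<otimes>\<^bsub>FD\<^esub> q L) = \<zero>\<^bsub>FD\<^esub>"
    using x by (simp add: FD.minus_eq FD.l_distr FD.l_minus FD.m_assoc)
  hence "q ?M \<otimes>\<^bsub>FD\<^esub> (x \<otimes>\<^bsub>FD\<^esub> q L) = x \<otimes>\<^bsub>FD\<^esub> q L" using x by simp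
  thus "\<exists>K. FD.c K \<otimes>\<^bsub>FD\<^esub> (x \<otimes>\<^bsub>FD\<^esub> FD.c L) = x \<otimes>\<^bsub>FD\<^esub> FD.c L" by (auto simp: F0_simps(9))
next
  fix N
  obtain \<chi> where \<chi>: "\<chi> \<in> star_hom FD complex_algebra"
    "\<And>l. \<chi> (q l) = (if 1 \<le> Suc N \<and> Suc N \<le> l then 1 else 0)"
    using F0_character[of "Suc N"] by metis
  have "\<chi> (q (Suc N) \<ominus>\<^bsub>FD\<^esub> q N) = 1"
    using star_hom_minus[OF unital_star_algebra_F0 unital_star_algebra_complex \<chi>(1), of "q (Suc N)" "q N"]
      \<chi>(2)[of "Suc N"] \<chi>(2)[of N]
      abelian_group.minus_eq[of complex_algebra]
    by (simp add: unital_star_algebra.uminus_eq_scale[OF unital_star_algebra_complex] a_minus_def)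
  thus "\<exists>\<phi>. lin_map FD complex_algebra \<phi> \<and> \<phi> (FD.c (Suc N) \<ominus>\<^bsub>FD\<^esub> FD.c N) \<noteq> 0"
    using star_hom_lin_map[OF \<chi>(1)] by (auto simp: F0_simps(9))
qed

lemma star_hom_restrict: "f \<in> star_hom FD B \<Longrightarrow> restrict f (carrier FD) \<in> star_hom FD B"
  by (rule star_homI) (auto dest: star_homD)

section \<open>Counit and comultiplication\<close>

lemma F0_counit:
  "F0_counit G \<in> star_hom FD complex_algebra"
  "\<lbrakk>X \<in> G; 1 \<le> k\<rbrakk> \<Longrightarrow> F0_counit G (x' X k) = 0"
  "\<lbrakk>X \<in> G; 1 \<le> k\<rbrakk> \<Longrightarrow> F0_counit G (x'' X k) = 0"
  "1 \<le> k \<Longrightarrow> F0_counit G (q k) = 1"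
proof -
  let ?R = "\<lambda>\<epsilon>. \<epsilon> \<in> extensional (carrier FD) \<and> \<epsilon> \<in> star_hom FD complex_algebra \<and>
       (\<forall>k\<ge>1. (\<forall>X\<in>G. \<epsilon> (x' X k) = 0 \<and> \<epsilon> (x'' X k) = 0) \<and> \<epsilon> (q k) = 1)"
  \<comment> \<open>The counit is the character jumping at index 1: it sends p_1 to 1 and every
    other p_k to 0, so all q_k with k \<ge> 1 take the value 1.\<close>
  obtain \<chi> where \<chi>: "\<chi> \<in> star_hom FD complex_algebra" "\<And>k. \<chi> (q k) = (if 1 \<le> (1::nat) \<and> 1 \<le> k then 1 else 0)"
    "\<And>X k. \<lbrakk>X \<in> G; 1 \<le> k\<rbrakk> \<Longrightarrow> \<chi> (x' X k) = 0" "\<And>X k. \<lbrakk>X \<in> G; 1 \<le> k\<rbrakk> \<Longrightarrow> \<chi> (x'' X k) = 0"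
    using F0_character[of 1] by metis
  have "\<exists>!\<epsilon>. ?R \<epsilon>"
  proof (rule ex1I[of _ "restrict \<chi> (carrier FD)"])
    show "?R (restrict \<chi> (carrier FD))"
      using \<chi> star_hom_restrict[OF \<chi>(1)] by auto
    fix \<epsilon> assume \<epsilon>: "?R \<epsilon>"
    show "\<epsilon> = restrict \<chi> (carrier FD)"
    proof (rule extensionalityI[of _ "carrier FD"])
      fix y assume y: "y \<in> carrier FD"
      have "\<epsilon> y = \<chi> y"
        by (rule F0_star_hom_eqI[OF unital_star_algebra_complex _ \<chi>(1) _ _ _ y]) (use \<epsilon> \<chi> in auto)
      thus "\<epsilon> y = restrict \<chi> (carrier FD) y" using y by simp
    qed (use \<epsilon> in auto)
  qed
  from theI'[OF this] have "?R (F0_counit G)" unfolding F0_counit_def Let_def .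
  thus "F0_counit G \<in> star_hom FD complex_algebra"
    "\<lbrakk>X \<in> G; 1 \<le> k\<rbrakk> \<Longrightarrow> F0_counit G (x' X k) = 0"
    "\<lbrakk>X \<in> G; 1 \<le> k\<rbrakk> \<Longrightarrow> F0_counit G (x'' X k) = 0"
    "1 \<le> k \<Longrightarrow> F0_counit G (q k) = 1" by auto
qed

lemma F0_counit_chain: "F0_counit G (F0_q G i) = (if i = 0 then 0 else 1)"
proof (cases i)
  case (enat k)
  show ?thesis
  proof (cases "k = 0")
    case True
    thus ?thesis
      using star_hom_zero[OF unital_star_algebra_F0 unital_star_algebra_complex F0_counit(1)] enat F0_q_0
      by (simp add: zero_enat_def)
  next
    case False
    thus ?thesis using F0_counit(4)[of k] enat by (simp add: zero_enat_def)
  qed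
next
  case infinity
  thus ?thesis using star_homD(4)[OF F0_counit(1)] by (simp add: F0_chain_infinity)
qed

lemma F0_counit_mono_hom: "F0_counit G \<in> mono_hom FD complex_mono"
  using F0_counit(1) F0_counit_chain by (simp add: mono_hom_def star_hom_complex_mono F0_simps(9))

lemma inj_chain_F0: "inj (chain FD)"
  by (simp add: F0_simps(9) inj_F0_q)

interpretation DD: mono_tensor FD FD ..

text \<open>The counit is the slicing functional on the leg F0, and the distinctness of the tensor
  chain is inherited from the other leg. The statement can therefore be iterated.\<close>

lemma inj_chain_tensor_F0:
  assumes "mono_star_algebra E" "inj (chain E)" shows "inj (chain (FD \<boxtimes> E))" "inj (chain (E \<boxtimes> FD))"
proof -
  interpret E: mono_star_algebra E by fact
  interpret L: mono_tensor FD E ..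
  interpret R: mono_tensor E FD ..
  have \<epsilon>: "lin_map FD complex_algebra (F0_counit G)" by (rule star_hom_lin_map[OF F0_counit(1)])
  have c: "F0_counit G (chain FD i) = 1" if "i \<noteq> 0" for i
    using that by (simp add: F0_simps(9) F0_counit_chain)
  show "inj (chain (FD \<boxtimes> E))" by (rule L.inj_chain_left[OF \<epsilon> c assms(2)])
  show "inj (chain (E \<boxtimes> FD))" by (rule R.inj_chain_right[OF \<epsilon> c assms(2)])
qed

lemma mono_star_algebra_DD: "mono_star_algebra (FD \<boxtimes> FD)"
  by (rule DD.mono_star_algebra_tensor) (rule inj_chain_tensor_F0(1)[OF mono_star_algebra_F0 inj_chain_F0])

private abbreviation (input) "T \<equiv> tens FD FD"

text \<open>The relations are tested on q_m \<otimes> q_m. For m > k it absorbs q_k and q_{k-1}, so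
  it fixes both images. For m < k one has q_m q_k = q_m = q_m q_{k-1}, so the different second
  factors of the images of X'(k) and X''(k) become the same and the relation of F0 applies on each
  leg. The image of X''(1) vanishes because q_0 = 0.\<close>

lemma F0_comult_exists:
  obtains f where "f \<in> star_hom FD (FD \<boxtimes> FD)" "\<And>k. f (q k) = T (q k) (q k)"
    "\<And>X k. \<lbrakk>X \<in> G; 1 \<le> k\<rbrakk> \<Longrightarrow> f (x' X k) = T (x' X k) (q k) \<oplus>\<^bsub>FD \<boxtimes> FD\<^esub> T (q k) (x' X k)"
    "\<And>X k. \<lbrakk>X \<in> G; 1 \<le> k\<rbrakk> \<Longrightarrow>
       f (x'' X k) = T (x'' X k) (q (k - 1)) \<oplus>\<^bsub>FD \<boxtimes> FD\<^esub> T (q (k - 1)) (x'' X k)"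
proof -
  note DDs = mtensor_simps(1-7)[of FD FD]
  show thesis
  proof (rule F0_universal[of "FD \<boxtimes> FD" "\<lambda>k. T (q k) (q k)"
      "\<lambda>X k. T (x' X k) (q k) \<oplus>\<^bsub>FD \<boxtimes> FD\<^esub> T (q k) (x' X k)"
      "\<lambda>X k. T (x'' X k) (q (k - 1)) \<oplus>\<^bsub>FD \<boxtimes> FD\<^esub> T (q (k - 1)) (x'' X k)", OF DD.DE.unital_star_algebra_axioms])
    fix X and k m :: nat
    assume k: "X \<in> G" "1 \<le> k" "k < m"
    have "min m (k - 1) = k - 1" "min m k = k" using k by auto
    thus "T (q m) (q m) \<otimes>\<^bsub>FD \<boxtimes> FD\<^esub> (T (x' X k) (q k) \<oplus>\<^bsub>FD \<boxtimes> FD\<^esub> T (q k) (x' X k)) =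
        T (x' X k) (q k) \<oplus>\<^bsub>FD \<boxtimes> FD\<^esub> T (q k) (x' X k)"
      "T (q m) (q m) \<otimes>\<^bsub>FD \<boxtimes> FD\<^esub> (T (x'' X k) (q (k - 1)) \<oplus>\<^bsub>FD \<boxtimes> FD\<^esub> T (q (k - 1)) (x'' X k)) =
        T (x'' X k) (q (k - 1)) \<oplus>\<^bsub>FD \<boxtimes> FD\<^esub> T (q (k - 1)) (x'' X k)"
      "T (q m) (q m) \<otimes>\<^bsub>FD \<boxtimes> FD\<^esub> star (FD \<boxtimes> FD) (T (x' X k) (q k) \<oplus>\<^bsub>FD \<boxtimes> FD\<^esub> T (q k) (x' X k)) =
        star (FD \<boxtimes> FD) (T (x' X k) (q k) \<oplus>\<^bsub>FD \<boxtimes> FD\<^esub> T (q k) (x' X k))"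
      "T (q m) (q m) \<otimes>\<^bsub>FD \<boxtimes> FD\<^esub> star (FD \<boxtimes> FD) (T (x'' X k) (q (k - 1)) \<oplus>\<^bsub>FD \<boxtimes> FD\<^esub> T (q (k - 1)) (x'' X k)) =
        star (FD \<boxtimes> FD) (T (x'' X k) (q (k - 1)) \<oplus>\<^bsub>FD \<boxtimes> FD\<^esub> T (q (k - 1)) (x'' X k))"
      using k F0_q_gen_mult[OF k]
      by (simp_all add: DDs DD.AB.r_distr DD.AB.star_add DD.tens_star DD.tens_mult F0_q_mult F0_q_star)
  next
    fix X and k m :: nat
    assume k: "X \<in> G" "1 \<le> k" "m < k"
    have "min m (k - 1) = m" "min m k = m" using k by auto
    thus "T (q m) (q m) \<otimes>\<^bsub>FD \<boxtimes> FD\<^esub> (T (x' X k) (q k) \<oplus>\<^bsub>FD \<boxtimes> FD\<^esub> T (q k) (x' X k)) =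
        T (q m) (q m) \<otimes>\<^bsub>FD \<boxtimes> FD\<^esub> (T (x'' X k) (q (k - 1)) \<oplus>\<^bsub>FD \<boxtimes> FD\<^esub> T (q (k - 1)) (x'' X k))"
      "T (q m) (q m) \<otimes>\<^bsub>FD \<boxtimes> FD\<^esub> star (FD \<boxtimes> FD) (T (x' X k) (q k) \<oplus>\<^bsub>FD \<boxtimes> FD\<^esub> T (q k) (x' X k)) =
        T (q m) (q m) \<otimes>\<^bsub>FD \<boxtimes> FD\<^esub> star (FD \<boxtimes> FD) (T (x'' X k) (q (k - 1)) \<oplus>\<^bsub>FD \<boxtimes> FD\<^esub> T (q (k - 1)) (x'' X k))"
      using k F0_q_gen_mult_eq[OF k]
      by (simp_all add: DDs DD.AB.r_distr DD.AB.star_add DD.tens_star DD.tens_mult F0_q_mult F0_q_star)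
  next
    show "T (q k) (q k) \<otimes>\<^bsub>FD \<boxtimes> FD\<^esub> T (q l) (q l) = T (q (min k l)) (q (min k l))" for k l
      by (simp add: DDs DD.tens_mult F0_q_mult)
    show "star (FD \<boxtimes> FD) (T (q k) (q k)) = T (q k) (q k)" for k
      by (simp add: DDs DD.tens_star F0_q_star)
  qed (use that in \<open>simp_all add: DDs F0_q_0\<close>)
qed

lemma F0_comult:
  "F0_comult G \<in> star_hom FD (FD \<boxtimes> FD)"
  "\<lbrakk>X \<in> G; 1 \<le> k\<rbrakk> \<Longrightarrow> F0_comult G (x' X k) = T (x' X k) (q k) \<oplus>\<^bsub>FD \<boxtimes> FD\<^esub> T (q k) (x' X k)"
  "\<lbrakk>X \<in> G; 1 \<le> k\<rbrakk> \<Longrightarrow>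
     F0_comult G (x'' X k) = T (x'' X k) (q (k - 1)) \<oplus>\<^bsub>FD \<boxtimes> FD\<^esub> T (q (k - 1)) (x'' X k)"
  "1 \<le> k \<Longrightarrow> F0_comult G (q k) = T (q k) (q k)"
proof -
  let ?R = "\<lambda>\<Delta>. \<Delta> \<in> extensional (carrier FD) \<and> \<Delta> \<in> star_hom FD (FD \<boxtimes> FD) \<and>
       (\<forall>k\<ge>1. (\<forall>X\<in>G.
          \<Delta> (x' X k) = T (x' X k) (q k) \<oplus>\<^bsub>FD \<boxtimes> FD\<^esub> T (q k) (x' X k) \<and>
          \<Delta> (x'' X k) = T (x'' X k) (q (k - 1)) \<oplus>\<^bsub>FD \<boxtimes> FD\<^esub> T (q (k - 1)) (x'' X k)) \<and>
        \<Delta> (q k) = T (q k) (q k))"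
  obtain f where f: "f \<in> star_hom FD (FD \<boxtimes> FD)" "\<And>k. f (q k) = T (q k) (q k)"
    "\<And>X k. \<lbrakk>X \<in> G; 1 \<le> k\<rbrakk> \<Longrightarrow> f (x' X k) = T (x' X k) (q k) \<oplus>\<^bsub>FD \<boxtimes> FD\<^esub> T (q k) (x' X k)"
    "\<And>X k. \<lbrakk>X \<in> G; 1 \<le> k\<rbrakk> \<Longrightarrow>
       f (x'' X k) = T (x'' X k) (q (k - 1)) \<oplus>\<^bsub>FD \<boxtimes> FD\<^esub> T (q (k - 1)) (x'' X k)"
    using F0_comult_exists by metis
  have "\<exists>!\<Delta>. ?R \<Delta>"
  proof (rule ex1I[of _ "restrict f (carrier FD)"])
    show "?R (restrict f (carrier FD))"
      using f star_hom_restrict[OF f(1)] by auto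
    fix \<Delta> assume \<Delta>: "?R \<Delta>"
    show "\<Delta> = restrict f (carrier FD)"
    proof (rule extensionalityI[of _ "carrier FD"])
      fix y assume y: "y \<in> carrier FD"
      have "\<Delta> y = f y"
        by (rule F0_star_hom_eqI[OF DD.DE.unital_star_algebra_axioms _ f(1) _ _ _ y]) (use \<Delta> f in auto)
      thus "\<Delta> y = restrict f (carrier FD) y" using y by simp
    qed (use \<Delta> in auto)
  qed
  from theI'[OF this] have R: "?R (F0_comult G)" unfolding F0_comult_def Let_def .
  show "F0_comult G \<in> star_hom FD (FD \<boxtimes> FD)" using R by blast
  show "\<lbrakk>X \<in> G; 1 \<le> k\<rbrakk> \<Longrightarrow> F0_comult G (x' X k) = T (x' X k) (q k) \<oplus>\<^bsub>FD \<boxtimes> FD\<^esub> T (q k) (x' X k)"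
    "\<lbrakk>X \<in> G; 1 \<le> k\<rbrakk> \<Longrightarrow>
       F0_comult G (x'' X k) = T (x'' X k) (q (k - 1)) \<oplus>\<^bsub>FD \<boxtimes> FD\<^esub> T (q (k - 1)) (x'' X k)"
    "1 \<le> k \<Longrightarrow> F0_comult G (q k) = T (q k) (q k)"
    using R by blast+
qed

lemma F0_comult_q: "F0_comult G (q k) = T (q k) (q k)"
proof (cases "k = 0")
  case True
  thus ?thesis
    using star_hom_zero[OF unital_star_algebra_F0 DD.DE.unital_star_algebra_axioms F0_comult(1)]
    by (simp add: F0_q_0 mtensor_simps)
qed (simp add: F0_comult(4))

text \<open>Every level contains all projections, so the factors q_k and q_{k-1} in the images of
  the generators stay in the level. The preimage of a level is a *-subalgebra, which reduces the
  claim to the level generators.\<close>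

lemma F0_comult_mono_hom: "F0_comult G \<in> mono_hom FD (FD \<boxtimes> FD)"
  unfolding mono_hom_def
proof (intro CollectI conjI allI)
  show hom: "F0_comult G \<in> star_hom FD (FD \<boxtimes> FD)" by (rule F0_comult)
  show "F0_comult G (chain FD i) = chain (FD \<boxtimes> FD) i" for i
  proof (cases i)
    case (enat k) thus ?thesis by (simp add: mtensor_simps F0_simps(9) F0_comult_q)
  next
    case infinity
    thus ?thesis using star_homD(4)[OF hom] DD.tens_one
      by (simp add: mtensor_simps F0_simps(9) F0_chain_infinity)
  qed
  fix m
  let ?L = "level (FD \<boxtimes> FD) m"
  note L = DD.level_subalgebra_tensor[of m]
  let ?V = "{x \<in> carrier FD. F0_comult G x \<in> ?L}"
  have V: "star_subalgebra FD ?V"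
    by (rule star_subalgebra_vimage[OF unital_star_algebra_F0 DD.DE.unital_star_algebra_axioms hom L])
  have lev: "T a b \<in> ?L" if "a \<in> F0_level G m" "b \<in> F0_level G m" for a b
    using that by (intro DD.tens_in_level) (simp_all add: F0_simps(8))
  have add: "s \<oplus>\<^bsub>FD \<boxtimes> FD\<^esub> t \<in> ?L" if "s \<in> ?L" "t \<in> ?L" for s t
    using that by (rule DD.DE.star_subalgebraD(4)[OF L])
  have q: "q k \<in> ?V" for k by (simp add: F0_comult_q lev F0_q_level)
  have "level_gens m \<subseteq> ?V"
  proof
    fix g assume g: "g \<in> level_gens m"
    hence gl: "g \<in> F0_level G m" by (rule F0_level_gens_level)
    from g consider k where "g = p k" "1 \<le> k" | X k where "g = x' X k" "X \<in> G" "1 \<le> k"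
      | X k where "g = x'' X k" "X \<in> G" "1 \<le> k" by blast
    thus "g \<in> ?V"
    proof cases
      case 1
      thus ?thesis using FD.star_subalgebraD(8)[OF V q q, of k "k - 1"] by (simp add: F0_p_eq)
    next
      case 2
      thus ?thesis using gl by (simp add: F0_comult add lev F0_q_level)
    next
      case 3
      thus ?thesis using gl by (simp add: F0_comult add lev F0_q_level)
    qed
  qed
  hence "F0_level G m \<subseteq> ?V" unfolding F0_level by (rule FD.star_generated_minimal[OF V])
  thus "F0_comult G ` level FD m \<subseteq> level (FD \<boxtimes> FD) m" by (auto simp: F0_simps(8))
qed

interpretation DDm: mono_star_algebra "FD \<boxtimes> FD" by (rule mono_star_algebra_DD)

lemma mono_star_algebra_triple:
  "mono_star_algebra (FD \<boxtimes> FD \<boxtimes> FD)" "mono_star_algebra ((FD \<boxtimes> FD) \<boxtimes> FD)"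
proof -
  interpret R: mono_tensor "FD" "FD \<boxtimes> FD" ..
  interpret L: mono_tensor "FD \<boxtimes> FD" "FD" ..
  have inj: "inj (chain (FD \<boxtimes> FD))"
    by (rule inj_chain_tensor_F0(1)[OF mono_star_algebra_F0 inj_chain_F0])
  show "mono_star_algebra (FD \<boxtimes> FD \<boxtimes> FD)"
    by (rule R.mono_star_algebra_tensor[OF inj_chain_tensor_F0(1)[OF mono_star_algebra_DD inj]])
  show "mono_star_algebra ((FD \<boxtimes> FD) \<boxtimes> FD)"
    by (rule L.mono_star_algebra_tensor[OF inj_chain_tensor_F0(2)[OF mono_star_algebra_DD inj]])
qed

text \<open>The chain of the scalars takes only two values, so distinctness must come from the F0
  leg; the functional on the scalar leg is the identity.\<close>

lemma mono_star_algebra_complex_tensor: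
  "mono_star_algebra (complex_mono \<boxtimes> FD)" "mono_star_algebra (FD \<boxtimes> complex_mono)"
proof -
  interpret C: closable_algebra complex_mono by (rule closable_algebra_complex)
  interpret CD: mono_tensor complex_mono "FD" ..
  interpret DC: mono_tensor "FD" complex_mono ..
  have id: "lin_map complex_mono complex_algebra (\<lambda>x. x)" by (simp add: lin_map_def)
  show "mono_star_algebra (complex_mono \<boxtimes> FD)"
    by (rule CD.mono_star_algebra_tensor[OF CD.inj_chain_left[OF id _ inj_chain_F0]]) simp
  show "mono_star_algebra (FD \<boxtimes> complex_mono)"
    by (rule DC.mono_star_algebra_tensor[OF DC.inj_chain_right[OF id _ inj_chain_F0]]) simp
qed

section \<open>The bialgebra identities on F0\<close>

private abbreviation (input) "\<Delta> \<equiv> F0_comult G"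
private abbreviation (input) "\<epsilon> \<equiv> F0_counit G"
private abbreviation (input) "\<Delta>id \<equiv> tensor_map (FD \<boxtimes> FD) (FD) \<Delta> id"
private abbreviation (input) "id\<Delta> \<equiv> tensor_map (FD) (FD \<boxtimes> FD) id \<Delta>"
private abbreviation (input) "\<epsilon>id \<equiv> tensor_map complex_mono (FD) \<epsilon> id"
private abbreviation (input) "id\<epsilon> \<equiv> tensor_map (FD) complex_mono id \<epsilon>"

lemma F0_mono_hom_legs:
  "\<Delta>id \<in> mono_hom (FD \<boxtimes> FD) ((FD \<boxtimes> FD) \<boxtimes> FD)"
  "id\<Delta> \<in> mono_hom (FD \<boxtimes> FD) (FD \<boxtimes> FD \<boxtimes> FD)"
  "\<epsilon>id \<in> mono_hom (FD \<boxtimes> FD) (complex_mono \<boxtimes> FD)"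
  "id\<epsilon> \<in> mono_hom (FD \<boxtimes> FD) (FD \<boxtimes> complex_mono)"
  by (intro mono_hom_tensor_map mono_star_algebra_F0 mono_star_algebra_DD mono_star_algebra_triple
      mono_star_algebra_complex_tensor F0_comult_mono_hom F0_counit_mono_hom id_mono_hom
      closable_algebra.axioms(1)[OF closable_algebra_complex])+

lemma F0_legs_tens:
  assumes "a \<in> carrier (FD)" "b \<in> carrier (FD)"
  shows "\<Delta>id (T a b) = tens (FD \<boxtimes> FD) (FD) (\<Delta> a) b"
    "id\<Delta> (T a b) = tens (FD) (FD \<boxtimes> FD) a (\<Delta> b)"
    "\<epsilon>id (T a b) = tens complex_mono (FD) (\<epsilon> a) b"
    "id\<epsilon> (T a b) = tens (FD) complex_mono a (\<epsilon> b)"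
proof -
  note u = FD.unital_star_algebra_axioms DD.DE.unital_star_algebra_axioms
    mono_star_algebra.axioms(1)[OF closable_algebra.axioms(1)[OF closable_algebra_complex]]
  note h = mono_homD(1)[OF id_mono_hom] F0_comult(1) mono_homD(1)[OF F0_counit_mono_hom]
  show "\<Delta>id (T a b) = tens (FD \<boxtimes> FD) (FD) (\<Delta> a) b"
    "id\<Delta> (T a b) = tens (FD) (FD \<boxtimes> FD) a (\<Delta> b)"
    "\<epsilon>id (T a b) = tens complex_mono (FD) (\<epsilon> a) b"
    "id\<epsilon> (T a b) = tens (FD) complex_mono a (\<epsilon> b)"
    using tensor_map_star_hom(2)[OF u(1) u(1) u(2) u(1) h(2) h(1) assms]
      tensor_map_star_hom(2)[OF u(1) u(1) u(1) u(2) h(1) h(2) assms]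
      tensor_map_star_hom(2)[OF u(1) u(1) u(3) u(1) h(3) h(1) assms]
      tensor_map_star_hom(2)[OF u(1) u(1) u(1) u(3) h(1) h(3) assms]
    by simp_all
qed

text \<open>Both sides are *-homomorphisms out of F0, so the comparison takes place on the q_k,
  where each side is q_k \<otimes> q_k \<otimes> q_k, and on the X'(k) and X''(k).\<close>

lemma coassociative_F0:
  assumes "y \<in> carrier (FD)"
  shows "tensor_assoc (FD) (\<Delta>id (\<Delta> y)) = id\<Delta> (\<Delta> y)"
proof -
  let ?X = "FD \<boxtimes> FD \<boxtimes> FD" and ?Y = "(FD \<boxtimes> FD) \<boxtimes> FD"
  interpret X: mono_star_algebra ?X by (rule mono_star_algebra_triple)
  interpret R: mono_tensor "FD" "FD \<boxtimes> FD" ..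
  interpret L: mono_tensor "FD \<boxtimes> FD" "FD" ..
  note assoc = mono_hom_tensor_assoc[OF mono_star_algebra_F0 mono_star_algebra_DD mono_star_algebra_triple(1)]
  note \<Delta> = F0_comult(1)
  note a_ops = star_homD[OF mono_homD(1)[OF assoc(1)]]
  note l_ops = star_homD[OF mono_homD(1)[OF F0_mono_hom_legs(1)]]
  note r_ops = star_homD[OF mono_homD(1)[OF F0_mono_hom_legs(2)]]
  have T: "T a b \<in> carrier (FD \<boxtimes> FD)" if "a \<in> carrier (FD)" "b \<in> carrier (FD)" for a b
    using that by (simp add: mtensor_simps)
  have TL: "tens (FD \<boxtimes> FD) (FD) s c \<in> carrier ?Y"
    if "s \<in> carrier (FD \<boxtimes> FD)" "c \<in> carrier (FD)" for s c
    using that by (simp add: mtensor_simps(1)[of "FD \<boxtimes> FD" "FD"])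
  have TR: "tens (FD) (FD \<boxtimes> FD) a s \<in> carrier ?X"
    if "a \<in> carrier (FD)" "s \<in> carrier (FD \<boxtimes> FD)" for s a
    using that by (simp add: mtensor_simps(1)[of "FD" "FD \<boxtimes> FD"])
  have L_add: "tens (FD \<boxtimes> FD) (FD) (s \<oplus>\<^bsub>FD \<boxtimes> FD\<^esub> t) c =
      tens (FD \<boxtimes> FD) (FD) s c \<oplus>\<^bsub>?Y\<^esub> tens (FD \<boxtimes> FD) (FD) t c"
    if "s \<in> carrier (FD \<boxtimes> FD)" "t \<in> carrier (FD \<boxtimes> FD)" "c \<in> carrier (FD)" for s t c
    using that by (simp add: L.tens_bilin mtensor_simps(5)[of "FD \<boxtimes> FD" "FD"])
  have R_add: "tens (FD) (FD \<boxtimes> FD) a (s \<oplus>\<^bsub>FD \<boxtimes> FD\<^esub> t) =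
      tens (FD) (FD \<boxtimes> FD) a s \<oplus>\<^bsub>?X\<^esub> tens (FD) (FD \<boxtimes> FD) a t"
    if "s \<in> carrier (FD \<boxtimes> FD)" "t \<in> carrier (FD \<boxtimes> FD)" "a \<in> carrier (FD)" for s t a
    using that by (simp add: R.tens_bilin mtensor_simps(5)[of "FD" "FD \<boxtimes> FD"])
  \<comment> \<open>X'(k) with q_k and X''(k) with q_{k-1} are both primitive relative to a
    group-like projection q. For such x both iterations give x \<otimes> q \<otimes> q + q \<otimes>
    x \<otimes> q + q \<otimes> q \<otimes> x.\<close>
  have prim: "tensor_assoc (FD) (\<Delta>id (\<Delta> x)) = id\<Delta> (\<Delta> x)"
    if x: "x \<in> carrier (FD)" "\<Delta> x = T x (q k) \<oplus>\<^bsub>FD \<boxtimes> FD\<^esub> T (q k) x" for x k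
  proof -
    let ?q = "q k"
    note C = x(1) F0_q_closed[of k] T TL TR
    note Y_closed = L.DE.a_closed
    have l: "\<Delta>id (\<Delta> x) = (tens (FD \<boxtimes> FD) (FD) (T x ?q) ?q \<oplus>\<^bsub>?Y\<^esub>
        tens (FD \<boxtimes> FD) (FD) (T ?q x) ?q) \<oplus>\<^bsub>?Y\<^esub> tens (FD \<boxtimes> FD) (FD) (T ?q ?q) x"
      by (simp add: x C l_ops(3) F0_legs_tens L_add F0_comult_q)
    have "tensor_assoc (FD) (\<Delta>id (\<Delta> x)) = (tens (FD) (FD \<boxtimes> FD) x (T ?q ?q) \<oplus>\<^bsub>?X\<^esub>
        tens (FD) (FD \<boxtimes> FD) ?q (T x ?q)) \<oplus>\<^bsub>?X\<^esub> tens (FD) (FD \<boxtimes> FD) ?q (T ?q x)"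
      unfolding l by (simp add: C Y_closed a_ops(3) assoc(2))
    also have "\<dots> = id\<Delta> (\<Delta> x)"
      by (simp add: x C r_ops(3) F0_legs_tens R_add F0_comult_q X.a_assoc)
    finally show ?thesis .
  qed
  have hl: "(tensor_assoc (FD) \<circ> \<Delta>id) \<circ> \<Delta> \<in> star_hom (FD) ?X"
    by (rule star_hom_comp[OF \<Delta> star_hom_comp[OF mono_homD(1)[OF F0_mono_hom_legs(1)] mono_homD(1)[OF assoc(1)]]])
  have hr: "id\<Delta> \<circ> \<Delta> \<in> star_hom (FD) ?X"
    by (rule star_hom_comp[OF \<Delta> mono_homD(1)[OF F0_mono_hom_legs(2)]])
  have "((tensor_assoc (FD) \<circ> \<Delta>id) \<circ> \<Delta>) y = (id\<Delta> \<circ> \<Delta>) y"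
  proof (rule F0_star_hom_eqI[OF X.unital_star_algebra_axioms hl hr _ _ _ assms])
    show "((tensor_assoc (FD) \<circ> \<Delta>id) \<circ> \<Delta>) (q k) = (id\<Delta> \<circ> \<Delta>) (q k)" for k
      by (simp add: F0_comult_q F0_legs_tens assoc(2))
    show "((tensor_assoc (FD) \<circ> \<Delta>id) \<circ> \<Delta>) (x' X k) = (id\<Delta> \<circ> \<Delta>) (x' X k)"
      "((tensor_assoc (FD) \<circ> \<Delta>id) \<circ> \<Delta>) (x'' X k) = (id\<Delta> \<circ> \<Delta>) (x'' X k)"
      if "X \<in> G" "1 \<le> k" for X k
      using prim[OF _ F0_comult(2)[OF that]] prim[OF _ F0_comult(3)[OF that]] that by simp_all
  qed
  thus ?thesis by simp
qed

lemma counital_F0: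
  assumes "y \<in> carrier (FD)"
  shows "tensor_unit_left (FD) (\<epsilon>id (\<Delta> y)) = y" "tensor_unit_right (FD) (id\<epsilon> (\<Delta> y)) = y"
proof -
  note ul = mono_hom_unit_left[OF mono_star_algebra_F0]
  note ur = mono_hom_unit_right[OF mono_star_algebra_F0]
  let ?l = "(tensor_unit_left (FD) \<circ> \<epsilon>id)" and ?r = "(tensor_unit_right (FD) \<circ> id\<epsilon>)"
  have l: "?l \<in> star_hom (FD \<boxtimes> FD) (FD)" and r: "?r \<in> star_hom (FD \<boxtimes> FD) (FD)"
    by (rule star_hom_comp[OF mono_homD(1)[OF F0_mono_hom_legs(3)] mono_homD(1)[OF ul(1)]],
        rule star_hom_comp[OF mono_homD(1)[OF F0_mono_hom_legs(4)] mono_homD(1)[OF ur(1)]])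
  have T: "T a b \<in> carrier (FD \<boxtimes> FD)" if "a \<in> carrier (FD)" "b \<in> carrier (FD)" for a b
    using that by (simp add: mtensor_simps)
  have lT: "?l (T a b) = \<epsilon> a \<odot>\<^bsub>FD\<^esub> b" and rT: "?r (T a b) = \<epsilon> b \<odot>\<^bsub>FD\<^esub> a"
    if "a \<in> carrier (FD)" "b \<in> carrier (FD)" for a b
    using that by (simp_all add: F0_legs_tens ul ur)
  \<comment> \<open>The expression a \<otimes> b + b \<otimes> a is symmetric, so the left and the
    right counit law are instances of one statement about f.\<close>
  have eq: "f (\<Delta> y) = y"
    if f: "f \<in> star_hom (FD \<boxtimes> FD) (FD)"
      and fT: "\<And>a b. \<lbrakk>a \<in> carrier (FD); b \<in> carrier (FD); \<epsilon> a = 0\<rbrakk> \<Longrightarrow>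
        f (T a b \<oplus>\<^bsub>FD \<boxtimes> FD\<^esub> T b a) = \<epsilon> b \<odot>\<^bsub>FD\<^esub> a"
      and fq: "\<And>k. 1 \<le> k \<Longrightarrow> f (T (q k) (q k)) = q k" for f
  proof -
    have "(f \<circ> \<Delta>) y = id y"
    proof (rule F0_star_hom_eqI[OF FD.unital_star_algebra_axioms star_hom_comp[OF F0_comult(1) f]
        mono_homD(1)[OF id_mono_hom] _ _ _ assms])
      show "(f \<circ> \<Delta>) (q k) = id (q k)" if "1 \<le> k" for k using fq that by (simp add: F0_comult)
      fix X and k :: nat assume k: "X \<in> G" "1 \<le> k"
      show "(f \<circ> \<Delta>) (x' X k) = id (x' X k)"
        using fT[of "x' X k" "q k"] k by (simp add: F0_comult F0_counit)
      \<comment> \<open>For k = 1 the factor q_0 = 0 has counit 0 and would not return X''(1); the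
        law holds there because X''(1) = 0.\<close>
      have \<epsilon>q: "\<epsilon> (q (k - 1)) = (if k = 1 then 0 else 1)"
        using F0_counit_chain[of "enat (k - 1)"] k(2) by (auto simp: zero_enat_def)
      show "(f \<circ> \<Delta>) (x'' X k) = id (x'' X k)"
        using fT[of "x'' X k" "q (k - 1)"] k F0_Xpp_1[OF k(1)] \<epsilon>q
          star_hom_zero[OF FD.unital_star_algebra_axioms FD.unital_star_algebra_axioms
            star_hom_comp[OF F0_comult(1) f]]
        by (cases "k = 1") (simp_all add: F0_comult F0_counit)
    qed
    thus ?thesis by simp
  qed
  have "?l (\<Delta> y) = y"
    by (rule eq[OF l]) (simp_all only: star_homD(3)[OF l] T lT F0_q_closed, simp_all add: F0_counit FD.l_zero)
  thus "tensor_unit_left (FD) (\<epsilon>id (\<Delta> y)) = y" by simp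
  have "?r (\<Delta> y) = y"
    by (rule eq[OF r]) (simp_all only: star_homD(3)[OF r] T rT F0_q_closed, simp_all add: F0_counit)
  thus "tensor_unit_right (FD) (id\<epsilon> (\<Delta> y)) = y" by simp
qed

end

section \<open>Transfer of the bialgebra structure to the monotone closures\<close>

theorem theorem4p2:
  fixes G :: "'g set"
  shows "monotone_closed_quantum_semigroup (F0 G) (F0_comult G) (F0_counit G)"
proof -
  let ?D = "F0 G"
  let ?DD = "?D \<boxtimes> ?D"
  interpret DA: closable_ample_algebra ?D by (rule closable_ample_F0)
  \<comment> \<open>The tensor square is the codomain of the comultiplication and must have a
    closure with products. The triple products and those with the scalars are interpreted as
    \<open>mono_star_algebra\<close>, which suffices for lifting maps and comparing classes.\<close>
  interpret DD: closable_algebra ?DD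
    by (rule closable_algebra_tensor[OF closable_ample_F0 closable_ample_F0 mono_star_algebra_DD])
  interpret C: closable_algebra complex_mono by (rule closable_algebra_complex)
  interpret R3: mono_star_algebra "?D \<boxtimes> ?DD" by (rule mono_star_algebra_triple)
  interpret L3: mono_star_algebra "?DD \<boxtimes> ?D" by (rule mono_star_algebra_triple)
  interpret CD: mono_star_algebra "complex_mono \<boxtimes> ?D" by (rule mono_star_algebra_complex_tensor)
  interpret DC: mono_star_algebra "?D \<boxtimes> complex_mono" by (rule mono_star_algebra_complex_tensor)
  interpret \<Delta>: closable_pair ?D ?DD ..
  interpret \<epsilon>: closable_pair ?D complex_mono ..
  interpret \<Delta>id: mono_pair ?DD "?DD \<boxtimes> ?D" ..
  interpret id\<Delta>: mono_pair ?DD "?D \<boxtimes> ?DD" ..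
  interpret \<epsilon>id: mono_pair ?DD "complex_mono \<boxtimes> ?D" ..
  interpret id\<epsilon>: mono_pair ?DD "?D \<boxtimes> complex_mono" ..
  interpret as: mono_pair "?DD \<boxtimes> ?D" "?D \<boxtimes> ?DD" ..
  interpret ul: mono_pair "complex_mono \<boxtimes> ?D" ?D ..
  interpret ur: mono_pair "?D \<boxtimes> complex_mono" ?D ..
  note hom = F0_comult_mono_hom[of G] F0_counit_mono_hom[of G]
  note legs = F0_mono_hom_legs[of G]
  note assoc = mono_hom_tensor_assoc(1)[OF mono_star_algebra_F0 mono_star_algebra_DD
      mono_star_algebra_triple(1), of G]
  note ul = mono_hom_unit_left(1)[OF mono_star_algebra_F0[of G]]
  note ur = mono_hom_unit_right(1)[OF mono_star_algebra_F0[of G]]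
  have counit: "mcounit (F0_counit G) \<in> star_hom (mclosure ?D) complex_algebra"
  proof -
    have "mcounit (F0_counit G) = eventual_value \<circ> mlift complex_mono (F0_counit G)"
      by (simp add: mcounit_def fun_eq_iff)
    thus ?thesis
      using star_hom_comp[OF \<epsilon>.mlift_star_hom[OF hom(2)] eventual_value_star_hom] by simp
  qed
  \<comment> \<open>All liftings act termwise, so on a representative each identity becomes its
    counterpart on F0 at every x_m with m \<ge> 1. The domains on the two sides are merely required
    to make both pairs operators with monotone closure.\<close>
  have eqs: "mlift (?D \<boxtimes> ?DD) (tensor_assoc ?D)
        (mtensor_map ?DD ?D (F0_comult G) id (mcomult ?D (F0_comult G) U)) =
      mtensor_map ?D ?DD id (F0_comult G) (mcomult ?D (F0_comult G) U) \<and>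
      mlift ?D (tensor_unit_left ?D)
        (mtensor_map complex_mono ?D (F0_counit G) id (mcomult ?D (F0_comult G) U)) = U \<and>
      mlift ?D (tensor_unit_right ?D)
        (mtensor_map ?D complex_mono id (F0_counit G) (mcomult ?D (F0_comult G) U)) = U"
    if U: "U \<in> carrier (mclosure ?D)" for U
  proof -
    obtain x e where Ux: "U = mco_class ?D x e" and x: "(x, e) \<in> owmc ?D"
      using U by (auto simp: DA.mclosure_carrier)
    note xm = DA.owmcD(2)[OF x]
    note x1 = \<Delta>.mono_hom_owmc[OF hom(1) x]
    note xl = \<Delta>id.mono_hom_owmc[OF legs(1) x1] and xr = id\<Delta>.mono_hom_owmc[OF legs(2) x1]
      and xcl = \<epsilon>id.mono_hom_owmc[OF legs(3) x1] and xcr = id\<epsilon>.mono_hom_owmc[OF legs(4) x1]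
    note lift = mtensor_map_def mcomult_def Ux \<Delta>.mlift_mco_class[OF hom(1) x]
      \<Delta>id.mlift_mco_class[OF legs(1) x1] id\<Delta>.mlift_mco_class[OF legs(2) x1]
      \<epsilon>id.mlift_mco_class[OF legs(3) x1] id\<epsilon>.mlift_mco_class[OF legs(4) x1]
      as.mlift_mco_class[OF assoc xl] ul.mlift_mco_class[OF ul xcl] ur.mlift_mco_class[OF ur xcr]
    show ?thesis
      unfolding lift
    proof (intro conjI)
      show "mco_class (?D \<boxtimes> ?DD)
          (tensor_assoc ?D \<circ> (tensor_map ?DD ?D (F0_comult G) id \<circ> (F0_comult G \<circ> x)))
          (tensor_assoc ?D \<circ> (tensor_map ?DD ?D (F0_comult G) id \<circ> (F0_comult G \<circ> e))) =
        mco_class (?D \<boxtimes> ?DD) (tensor_map ?D ?DD id (F0_comult G) \<circ> (F0_comult G \<circ> x))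
          (tensor_map ?D ?DD id (F0_comult G) \<circ> (F0_comult G \<circ> e))"
        by (rule R3.mco_class_cong[OF as.mono_hom_owmc[OF assoc xl] xr]) (simp add: coassociative_F0 xm)
      show "mco_class ?D
          (tensor_unit_left ?D \<circ> (tensor_map complex_mono ?D (F0_counit G) id \<circ> (F0_comult G \<circ> x)))
          (tensor_unit_left ?D \<circ> (tensor_map complex_mono ?D (F0_counit G) id \<circ> (F0_comult G \<circ> e))) =
        mco_class ?D x e"
        by (rule DA.mco_class_cong[OF ul.mono_hom_owmc[OF ul xcl] x]) (simp add: counital_F0 xm)
      show "mco_class ?D
          (tensor_unit_right ?D \<circ> (tensor_map ?D complex_mono id (F0_counit G) \<circ> (F0_comult G \<circ> x)))
          (tensor_unit_right ?D \<circ> (tensor_map ?D complex_mono id (F0_counit G) \<circ> (F0_comult G \<circ> e))) =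
        mco_class ?D x e"
        by (rule DA.mco_class_cong[OF ur.mono_hom_owmc[OF ur xcr] x]) (simp add: counital_F0 xm)
    qed
  qed
  show ?thesis
    unfolding monotone_closed_quantum_semigroup_def
    using DA.unital_star_algebra_mclosure DD.unital_star_algebra_mclosure
      \<Delta>.mono_hom_well_defined[OF hom(1)] \<epsilon>.mono_hom_well_defined[OF hom(2)]
      \<Delta>.mlift_star_hom[OF hom(1)] counit
      \<Delta>id.mono_hom_well_defined[OF legs(1)] id\<Delta>.mono_hom_well_defined[OF legs(2)]
      \<epsilon>id.mono_hom_well_defined[OF legs(3)] id\<epsilon>.mono_hom_well_defined[OF legs(4)] eqs
    by (simp add: mcomult_def[abs_def])
qed

end
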